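(* Let $s\in(0,1)$, let $(a,b)$ be a bounded interval, let $r\ge0$ and $f\in H^r_s(a,b)$. Then the solution $u$ of the Dirichlet problem $$(-\Delta)^su=f\ \text{ in }(a,b),\qquad u=0\ \text{ in }\mathbb{R}\setminus(a,b),$$ can be expressed in the form $u=\omega^s\phi$ in $(a,b)$ for some $\phi\in H^{r+2s}_s(a,b)$, where $\omega^s(x)=(x-a)^s(b-x)^s$.
   Context: Fractional Laplacian: $(-\Delta)^su(x)=C_1(s)\,\mathrm{P.V.}\int_{\mathbb{R}}\frac{u(x)-u(y)}{|x-y|^{1+2s}}\,dy$ with $C_1(s)=\frac{2^{2s}s\,\Gamma(s+1/2)}{\pi^{1/2}\Gamma(1-s)}$. "The solution" is the unique weak solution: $u\in H^s(\mathbb{R})$, $u=0$ a.e. outside $(a,b)$, and $\frac{C_1(s)}2\iint_{\mathbb{R}^2}\frac{(u(x)-u(y))(v(x)-v(y))}{|x-y|^{1+2s}}\,dx\,dy=\int_a^bfv\,dx$ for all $v\in C_c^\infty(a,b)$. Weighted spaces: $L^2_s(a,b)=\{\phi:\int_a^b|\phi|^2\omega^s<\infty\}$. On $(-1,1)$ (weight $(1-x^2)^s$) let $C_j^{(s+1/2)}$ be the Gegenbauer polynomials ($C_0^{(\alpha)}=1$, $C_1^{(\alpha)}(x)=2\alpha x$, $C_n^{(\alpha)}(x)=\frac1n[2x(n+\alpha-1)C_{n-1}^{(\alpha)}(x)-(n+2\alpha-2)C_{n-2}^{(\alpha)}(x)]$), and $\tilde C_j^{(s+1/2)}=C_j^{(s+1/2)}/\|C_j^{(s+1/2)}\|_{L^2_s(-1,1)}$.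 For $v\in L^2_s(-1,1)$ put $v_j=\int_{-1}^1v(x)\tilde C_j^{(s+1/2)}(x)(1-x^2)^s\,dx$. For $r\ge0$, $H^r_s(-1,1)=\{v\in L^2_s(-1,1):\sum_{j\ge0}(1+j^2)^r|v_j|^2<\infty\}$. The space $H^r_s(a,b)$ is obtained by the affine change of variables: $v\in H^r_s(a,b)$ iff $\xi\mapsto v\big(a+\frac{(b-a)(\xi+1)}{2}\big)$ belongs to $H^r_s(-1,1)$. *)

theory Defs
  imports "HOL-Analysis.Analysis"
begin

section \<open>Weak solutions of the Dirichlet problem for the fractional Laplacian\<close>

definition frac_const :: "real \<Rightarrow> real" where
  "frac_const s = 2 powr (2 * s) * s * Gamma (s + 1/2) / (sqrt pi * Gamma (1 - s))"

text \<open>The space $H^s(\mathbb{R})$ for $0 < s < 1$, with the Gagliardo seminorm. Elements of function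
  spaces are represented by Lebesgue measurable functions, which are not identified when they agree
  almost everywhere. The quotient in the seminorm is 0 on the diagonal, a null set.\<close>

definition frac_sobolev :: "real \<Rightarrow> (real \<Rightarrow> real) set" where
  "frac_sobolev s =
    {u \<in> borel_measurable lebesgue.
       integrable lebesgue (\<lambda>x. (u x)\<^sup>2) \<and>
       integrable lebesgue (\<lambda>(x, y). (u x - u y)\<^sup>2 / \<bar>x - y\<bar> powr (1 + 2 * s))}"

definition test_functions :: "real \<Rightarrow> real \<Rightarrow> (real \<Rightarrow> real) set" where
  "test_functions a b =
    {v. (\<forall>n x. (deriv ^^ n) v field_differentiable at x) \<and>
        compact (closure {x. v x \<noteq> 0}) \<and> closure {x. v x \<noteq> 0} \<subseteq> {a<..<b}}"

definition frac_form :: "real \<Rightarrow> (real \<Rightarrow> real) \<Rightarrow> (real \<Rightarrow> real) \<Rightarrow> real" where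
  "frac_form s u v = frac_const s / 2 *
     (\<integral>(x, y). (u x - u y) * (v x - v y) / \<bar>x - y\<bar> powr (1 + 2 * s) \<partial>lebesgue)"

definition weak_solution :: "real \<Rightarrow> real \<Rightarrow> real \<Rightarrow> (real \<Rightarrow> real) \<Rightarrow> (real \<Rightarrow> real) \<Rightarrow> bool" where
  "weak_solution s a b f u \<longleftrightarrow>
     u \<in> frac_sobolev s \<and>
     (AE x in lebesgue. x \<notin> {a<..<b} \<longrightarrow> u x = 0) \<and>
     (\<forall>v \<in> test_functions a b. frac_form s u v = (\<integral>x. f x * v x \<partial>lebesgue_on {a<..<b}))"


section \<open>Weighted spaces\<close>

definition omega :: "real \<Rightarrow> real \<Rightarrow> real \<Rightarrow> real" where
  "omega a b x = (x - a) * (b - x)"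

text \<open>On $(-1,1)$ the weight is $(1 - x^2)^s$.\<close>

lemma omega_unit: "omega (-1) 1 x = 1 - x\<^sup>2"
  by (simp add: omega_def power2_eq_square algebra_simps)

text \<open>Only the values on $(a,b)$ matter.\<close>

definition weighted_L2 :: "real \<Rightarrow> real \<Rightarrow> real \<Rightarrow> (real \<Rightarrow> real) set" where
  "weighted_L2 s a b =
    {\<phi> \<in> borel_measurable (lebesgue_on {a<..<b}).
       integrable (lebesgue_on {a<..<b}) (\<lambda>x. (\<phi> x)\<^sup>2 * omega a b x powr s)}"

fun gegenbauer :: "real \<Rightarrow> nat \<Rightarrow> real \<Rightarrow> real" where
  "gegenbauer \<alpha> 0 x = 1"
| "gegenbauer \<alpha> (Suc 0) x = 2 * \<alpha> * x"
| "gegenbauer \<alpha> (Suc (Suc m)) x =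
    (let n = real (Suc (Suc m)) in
       (2 * x * (n + \<alpha> - 1) * gegenbauer \<alpha> (Suc m) x - (n + 2 * \<alpha> - 2) * gegenbauer \<alpha> m x) / n)"

definition gegenbauer_normalized :: "real \<Rightarrow> nat \<Rightarrow> real \<Rightarrow> real" where
  "gegenbauer_normalized s j x = gegenbauer (s + 1/2) j x /
     sqrt (\<integral>y. (gegenbauer (s + 1/2) j y)\<^sup>2 * (1 - y\<^sup>2) powr s \<partial>lebesgue_on {-1<..<1})"

definition gegenbauer_coeff :: "real \<Rightarrow> (real \<Rightarrow> real) \<Rightarrow> nat \<Rightarrow> real" where
  "gegenbauer_coeff s v j =
     (\<integral>x. v x * gegenbauer_normalized s j x * (1 - x\<^sup>2) powr s \<partial>lebesgue_on {-1<..<1})"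

definition weighted_sobolev_unit :: "real \<Rightarrow> real \<Rightarrow> (real \<Rightarrow> real) set" where
  "weighted_sobolev_unit r s =
    {v \<in> weighted_L2 s (-1) 1.
       summable (\<lambda>j. (1 + (real j)\<^sup>2) powr r * \<bar>gegenbauer_coeff s v j\<bar>\<^sup>2)}"

definition weighted_sobolev :: "real \<Rightarrow> real \<Rightarrow> real \<Rightarrow> real \<Rightarrow> (real \<Rightarrow> real) set" where
  "weighted_sobolev r s a b =
    {v. (\<lambda>\<xi>. v (a + (b - a) * (\<xi> + 1) / 2)) \<in> weighted_sobolev_unit r s}"

end

theory Submission
  imports Defs "HOL-Real_Asymp.Real_Asymp"
begin

text \<open>Write $w(x) = 1 - x^2$ and $K(x,y) = |x-y|^{-1-2s}$ on the reference interval $(-1,1)$. The map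
  $q \mapsto (-\Delta)^s(w^s q)$ preserves polynomials and is diagonal in the Gegenbauer polynomials
  $C_j^{(s+1/2)}$, with eigenvalues $\kappa\,(1+2s)_j/j!$ that grow like $j^{2s}$. If $u$ solves the
  problem with right-hand side $f$, testing with $w^s C_j$ (a limit of test functions) gives
  $\int f C_j w^s = \kappa\,\frac{(1+2s)_j}{j!} \int u\,C_j$, and $\int u\,C_j$ is the $j$-th coefficient of
  $\phi = u / w^s$. So the coefficients of $\phi$ are those of $f$ divided by the eigenvalues, which
  is the gain of $2s$ in the weighted Sobolev scale. Neither completeness of the polynomials nor
  uniqueness of the solution enters, because $\phi$ is defined from $u$; that $\phi$ lies in $L^2_s$ is
  a Hardy inequality (\<open>Hardy_weight\<close>): restricting the Gagliardo integral to $|x| < 1 \le |y|$ bounds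
  $\int u^2 w^{-2s}$.

  The eigenvalue relation is obtained through the generating family $p_c(x) = w^s(x)/(1 - cx)$,
  $|c| < 1$, for which
  \[ (-\Delta)^s p_c(x) = \kappa\,(1-c^2)^s (1-cx)^{-1-2s}, \qquad |x| < 1. \]
  Here is why. The bilinear form of $u$ and $p_c$ is truncated to $|x-y| \ge \epsilon\,|1-xy|$, a
  condition that is symmetric in $x$ and $y$ and invariant under the Moebius maps of $(-1,1)$.
  For fixed $x$ the inner integrals can then be computed: $\int K(x,y)\,dy$ is elementary
  (\<open>integral_kern_far\<close>), and in $\int p_c(y) K(x,y)\,dy$ the substitution $z = (y-x)/(1-xy)$, the
  even part in $z$, and $t = z^{-2} - 1$ lead to $\int_0^T t^s/(t+\sigma)\,dt$ with
  $\sigma = (1-c^2)(1-x^2)/(1-cx)^2$ (\<open>integral_profile_far\<close>). The divergent terms cancel up to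
  $O(\epsilon^{2-2s})$, and what is left scales like $\sigma^s$ (\<open>far_identity\<close>, \<open>form_profile\<close>).
  Dominated convergence is justified on the one side by $u\,w^{-s} \in L^1$, on the other side by a
  Hoelder bound for $p_c$ which holds uniformly for smooth cut-offs of $p_c$ and is square
  integrable against $K$ (\<open>cut_profile_Hoelder\<close>, \<open>integrable_Hoelder_bound\<close>).

  Expanding in powers of $c$ expresses the moments $\int f x^n w^s$ through the moments
  $\int u\,x^m$. That the resulting triangular matrix has the Gegenbauer polynomials as
  eigenvectors is a statement on their monomial coefficients, which follows from the two-term
  recurrence equivalent to the Gegenbauer differential equation (\<open>gegenbauer_eigen_mono\<close>,
  \<open>generating_identity_gegenbauer\<close>, \<open>coefficient_relation\<close>). An affine change of variables carries
  everything to $(a,b)$ (\<open>weak_form_rescale\<close>).\<close>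

section \<open>Gegenbauer polynomials in the monomial basis\<close>

text \<open>The coefficient of $x^m$ in $C_n^{(\alpha)}$; it is $0$ for $m > n$.\<close>

fun gegenbauer_mono :: "real \<Rightarrow> nat \<Rightarrow> nat \<Rightarrow> real" where
  "gegenbauer_mono \<alpha> 0 m = (if m = 0 then 1 else 0)"
| "gegenbauer_mono \<alpha> (Suc 0) m = (if m = 1 then 2 * \<alpha> else 0)"
| "gegenbauer_mono \<alpha> (Suc (Suc n)) m =
     (2 * (real n + 1 + \<alpha>) * (case m of 0 \<Rightarrow> 0 | Suc k \<Rightarrow> gegenbauer_mono \<alpha> (Suc n) k)
       - (real n + 2 * \<alpha>) * gegenbauer_mono \<alpha> n m) / (real n + 2)"

lemma gegenbauer_mono_eq_0: "n < m \<Longrightarrow> gegenbauer_mono \<alpha> n m = 0"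
  by (induction \<alpha> n m rule: gegenbauer_mono.induct) (auto split: nat.split)

lemma gegenbauer_eq_sum: "gegenbauer \<alpha> n x = (\<Sum>m\<le>n. gegenbauer_mono \<alpha> n m * x ^ m)"
proof (induction \<alpha> n x rule: gegenbauer.induct)
  case (3 \<alpha> n x)
  let ?c = "gegenbauer_mono \<alpha>"
  have 1: "(\<Sum>m\<le>Suc (Suc n). (case m of 0 \<Rightarrow> 0 | Suc k \<Rightarrow> ?c (Suc n) k) * x ^ m)
      = x * (\<Sum>m\<le>Suc n. ?c (Suc n) m * x ^ m)"
    unfolding sum_distrib_left by (subst sum.atMost_Suc_shift) (simp add: mult_ac)
  have 2: "(\<Sum>m\<le>Suc (Suc n). ?c n m * x ^ m) = (\<Sum>m\<le>n. ?c n m * x ^ m)"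
    by (simp add: gegenbauer_mono_eq_0)
  have "(\<Sum>m\<le>Suc (Suc n). ?c (Suc (Suc n)) m * x ^ m)
    = (2 * (real n + 1 + \<alpha>) * (\<Sum>m\<le>Suc (Suc n). (case m of 0 \<Rightarrow> 0 | Suc k \<Rightarrow> ?c (Suc n) k) * x ^ m)
        - (real n + 2 * \<alpha>) * (\<Sum>m\<le>Suc (Suc n). ?c n m * x ^ m)) / (real n + 2)"
    unfolding sum_distrib_left sum_subtractf[symmetric] sum_divide_distrib
    by (intro sum.cong refl) (simp add: field_simps)
  also have "\<dots> = gegenbauer \<alpha> (Suc (Suc n)) x"
    unfolding 1 2 using 3[OF refl] by (simp add: Let_def field_simps)
  finally show ?case ..
qed (simp_all add: sum.atMost_Suc)

text \<open>These are $n C_n = x C_n' - C_{n-1}'$ and $(n+2\alpha) C_n = C_{n+1}' - x C_n'$, read off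
  coefficientwise; the induction needs both at once.\<close>

lemma gegenbauer_mono_contiguous:
  shows "real (m + 1) * gegenbauer_mono \<alpha> n (m + 1) = (real m - real n - 1) * gegenbauer_mono \<alpha> (n + 1) m"
    and "real (m + 1) * gegenbauer_mono \<alpha> (n + 1) (m + 1) = (real n + real m + 2 * \<alpha>) * gegenbauer_mono \<alpha> n m"
proof (induction n arbitrary: m)
  case 0
  { case 1 show ?case by auto }
  { case 2 show ?case by auto }
next
  case (Suc n)
  let ?c = "gegenbauer_mono \<alpha>"
  have i: "real (k + 1) * ?c n (k + 1) = (real k - real n - 1) * ?c (n + 1) k" for k by (rule Suc.IH(1))
  have ii: "real (k + 1) * ?c (n + 1) (k + 1) = (real n + real k + 2 * \<alpha>) * ?c n k" for k by (rule Suc.IH(2))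
  have n2: "real n + 2 \<noteq> 0" by linarith
  have r: "(real n + 2) * ?c (Suc (Suc n)) (Suc k)
     = 2 * (real n + 1 + \<alpha>) * ?c (Suc n) k - (real n + 2 * \<alpha>) * ?c n (Suc k)" for k
    by simp
  have r0: "(real n + 2) * ?c (Suc (Suc n)) 0 = - ((real n + 2 * \<alpha>) * ?c n 0)" using n2 by simp
  { case 1
    show ?case
    proof (cases m)
      case 0
      have "real (0 + 1) * ?c (Suc n) (0 + 1) = - ((real n + 2) * ?c (Suc (Suc n)) 0)"
        unfolding r0 using ii[of 0] by (simp del: gegenbauer_mono.simps)
      then show ?thesis unfolding 0 by (simp add: algebra_simps del: gegenbauer_mono.simps)
    next
      case (Suc k)
      define A where "A = ?c n (k + 1)"
      have a: "(real k + 2) * ?c (Suc n) (k + 2) = (real n + real k + 1 + 2 * \<alpha>) * A"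
        using ii[of "k + 1"] by (simp add: A_def algebra_simps)
      have b: "(real k + 1) * A = (real k - real n - 1) * ?c (Suc n) k"
        using i[of k] by (simp add: A_def algebra_simps)
      have "(real n + 2) * ((real k - real n - 1) * ?c (Suc (Suc n)) (Suc k))
         = (real k - real n - 1) * (2 * (real n + 1 + \<alpha>) * ?c (Suc n) k - (real n + 2 * \<alpha>) * A)"
        using arg_cong[OF r[of k], of "\<lambda>z. (real k - real n - 1) * z"] by (simp add: A_def mult_ac)
      also have "\<dots> = 2 * (real n + 1 + \<alpha>) * ((real k + 1) * A) - (real k - real n - 1) * (real n + 2 * \<alpha>) * A"
        unfolding b by (simp add: algebra_simps)
      also have "\<dots> = (real n + 2) * ((real n + real k + 1 + 2 * \<alpha>) * A)"
        by (simp add: algebra_simps)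
      finally have "(real k - real n - 1) * ?c (Suc (Suc n)) (Suc k) = (real k + 2) * ?c (Suc n) (k + 2)"
        unfolding a using n2 by (metis mult_left_cancel)
      then show ?thesis unfolding Suc by (simp add: algebra_simps)
    qed }
  { case 2
    have b: "(real m + 1) * ?c n (Suc m) = (real m - real n - 1) * ?c (Suc n) m"
      using i[of m] by (simp add: algebra_simps)
    have "(real n + 2) * (real (m + 1) * ?c (Suc (Suc n)) (Suc m))
      = (real m + 1) * (2 * (real n + 1 + \<alpha>) * ?c (Suc n) m) - (real n + 2 * \<alpha>) * ((real m + 1) * ?c n (Suc m))"
      using arg_cong[OF r[of m], of "\<lambda>z. real (m + 1) * z"] by (simp add: algebra_simps del: gegenbauer_mono.simps)
    also have "\<dots> = (real n + 2) * ((real n + 1 + real m + 2 * \<alpha>) * ?c (Suc n) m)"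
      unfolding b by (simp add: algebra_simps)
    finally have "real (m + 1) * ?c (Suc (Suc n)) (Suc m) = (real n + 1 + real m + 2 * \<alpha>) * ?c (Suc n) m"
      using n2 by (metis mult_left_cancel)
    then show ?case by (simp add: algebra_simps) }
qed

text \<open>The Gegenbauer equation $(1-x^2)C_n'' - (2\alpha+1)x\,C_n' + n(n+2\alpha)C_n = 0$ in terms of
  coefficients.\<close>

lemma gegenbauer_mono_recurrence:
  "(real m + 2) * (real m + 1) * gegenbauer_mono \<alpha> n (m + 2)
     = (real m - real n) * (real m + real n + 2 * \<alpha>) * gegenbauer_mono \<alpha> n m"
proof (cases n)
  case 0
  then show ?thesis by auto
next
  case (Suc k)
  have a: "(real m + 2) * gegenbauer_mono \<alpha> n (m + 2) = (real k + real m + 1 + 2 * \<alpha>) * gegenbauer_mono \<alpha> k (m + 1)"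
    using gegenbauer_mono_contiguous(2)[where m = "m + 1" and n = k] by (simp add: Suc algebra_simps)
  have b: "(real m + 1) * gegenbauer_mono \<alpha> k (m + 1) = (real m - real k - 1) * gegenbauer_mono \<alpha> n m"
    using gegenbauer_mono_contiguous(1)[where m = "m" and n = k] by (simp add: Suc algebra_simps)
  have "(real m + 2) * (real m + 1) * gegenbauer_mono \<alpha> n (m + 2)
    = (real m + 1) * ((real m + 2) * gegenbauer_mono \<alpha> n (m + 2))" by simp
  also have "\<dots> = (real k + real m + 1 + 2 * \<alpha>) * ((real m + 1) * gegenbauer_mono \<alpha> k (m + 1))"
    unfolding a by simp
  also have "\<dots> = (real m - real n) * (real m + real n + 2 * \<alpha>) * gegenbauer_mono \<alpha> n m"
    unfolding b by (simp add: Suc algebra_simps)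
  finally show ?thesis .
qed

text \<open>The coefficient of $t^k$ in $(1-t)^s$.\<close>

definition alt_binomial :: "real \<Rightarrow> nat \<Rightarrow> real" where
  "alt_binomial s k = (-1) ^ k * (s gchoose k)"

text \<open>The coefficient of $z^l$ in $(1-z)^{-1-2s}$. Up to a constant factor, it is also the $l$-th
  eigenvalue of $q \mapsto (-\Delta)^s(w^s q)$.\<close>

definition eigen_factor :: "real \<Rightarrow> nat \<Rightarrow> real" where
  "eigen_factor s l = pochhammer (1 + 2 * s) l / fact l"

lemma alt_binomial_Suc: "(real k + 1) * alt_binomial s (Suc k) = - (s - real k) * alt_binomial s k"
proof -
  have "(real k + 1) * (s gchoose Suc k) = (s - real k) * (s gchoose k)"
    using gbinomial_absorption[of k s] gbinomial_absorb_comp[of s k] by (simp add: algebra_simps)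
  then have "(-1) ^ k * ((real k + 1) * (s gchoose Suc k)) = (-1) ^ k * ((s - real k) * (s gchoose k))"
    by simp
  then show ?thesis by (simp add: alt_binomial_def algebra_simps)
qed

lemma eigen_factor_Suc: "(real l + 1) * eigen_factor s (Suc l) = (real l + 1 + 2 * s) * eigen_factor s l"
proof -
  have "(real l + 1) * eigen_factor s (Suc l)
    = (real l + 1) * (pochhammer (1 + 2 * s) l * (1 + 2 * s + real l)) / ((real l + 1) * fact l)"
    by (simp add: eigen_factor_def pochhammer_Suc add_ac)
  also have "\<dots> = pochhammer (1 + 2 * s) l * (1 + 2 * s + real l) / fact l"
    by (subst mult_divide_mult_cancel_left) linarith+
  finally show ?thesis by (simp add: eigen_factor_def mult_ac add_ac)
qed

lemma eigen_factor_pos: "0 < s \<Longrightarrow> 0 < eigen_factor s l"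
  by (simp add: eigen_factor_def pochhammer_pos)

text \<open>Write $b_k$ and $e_l$ for the values of \<open>alt_binomial\<close> and \<open>eigen_factor\<close>. The operator
  $x^m \mapsto \sum_k b_k e_{m-2k}\, x^{m-2k}$ has the eigenvector $C_n^{(s+1/2)}$ with
  eigenvalue $e_n$. It commutes with the Gegenbauer differential operator, so the coefficients of the
  image satisfy the same two-term recurrence as those of $e_n C_n$; both sequences agree from
  index $n$ on, hence everywhere.\<close>

lemma gegenbauer_eigen_mono:
  fixes s :: real
  defines "c \<equiv> gegenbauer_mono (s + 1/2)"
  assumes s: "0 < s"
  shows "eigen_factor s l * (\<Sum>k\<le>n. alt_binomial s k * c n (l + 2 * k)) = eigen_factor s n * c n l"
proof -
  let ?b = "alt_binomial s" and ?e = "eigen_factor s"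
  define S where "S l = (\<Sum>k\<le>n. ?b k * c n (l + 2 * k))" for l
  have c0: "c n m = 0" if "n < m" for m using that by (simp add: c_def gegenbauer_mono_eq_0)
  have rec: "(real m + 2) * (real m + 1) * c n (m + 2) = (real m - real n) * (real m + real n + 1 + 2 * s) * c n m" for m
    using gegenbauer_mono_recurrence[of m "s + 1/2" n] by (simp add: c_def algebra_simps)
  have step: "(real l + 2) * (real l + 1) * (?e (l + 2) * S (l + 2)) = (real l - real n) * (real l + real n + 1 + 2 * s) * (?e l * S l)" for l
  proof -
    have e2: "(real l + 2) * (real l + 1) * ?e (l + 2) = (real l + 1 + 2 * s) * (real l + 2 + 2 * s) * ?e l"
    proof -
      have "(real l + 2) * ?e (Suc (Suc l)) = (real l + 2 + 2 * s) * ?e (Suc l)"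
        using eigen_factor_Suc[of "Suc l" s] by (simp add: add_ac)
      then have "(real l + 1) * ((real l + 2) * ?e (Suc (Suc l))) = (real l + 1) * ((real l + 2 + 2 * s) * ?e (Suc l))"
        by simp
      then have "(real l + 2) * (real l + 1) * ?e (l + 2) = (real l + 2 + 2 * s) * ((real l + 1) * ?e (Suc l))"
        by (simp add: mult_ac)
      then show ?thesis unfolding eigen_factor_Suc by (simp add: algebra_simps)
    qed
    define t where "t k = 2 * real k * (2 * real l + 2 * real k + 1 + 2 * s) * ?b k * c n (l + 2 * k)" for k
    \<comment> \<open>the difference of the two sides of the recurrence telescopes\<close>
    have tele: "(\<Sum>k\<le>n. t (Suc k)) = (\<Sum>k\<le>n. t k)"
    proof -
      have "(\<Sum>k\<le>n. t (Suc k)) = (\<Sum>k\<le>Suc n. t k) - t 0" by (subst sum.atMost_Suc_shift) simp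
      moreover have "t 0 = 0" by (simp add: t_def)
      moreover have "t (Suc n) = 0" by (simp add: t_def c0)
      ultimately show ?thesis by simp
    qed
    have tS: "t (Suc k) = - 2 * (s - real k) * (2 * real l + 2 * real k + 3 + 2 * s) * ?b k * c n (l + 2 * k + 2)" for k
    proof -
      have "t (Suc k) = 2 * ((real k + 1) * ?b (Suc k)) * (2 * real l + 2 * real k + 3 + 2 * s) * c n (l + 2 * k + 2)"
        by (simp add: t_def algebra_simps)
      then show ?thesis unfolding alt_binomial_Suc by (simp add: algebra_simps)
    qed
    have "(real l - real n) * (real l + real n + 1 + 2 * s) * S l
       = (\<Sum>k\<le>n. ?b k * ((real (l + 2 * k) - real n) * (real (l + 2 * k) + real n + 1 + 2 * s) * c n (l + 2 * k)) - t k)"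
      unfolding S_def sum_distrib_left by (intro sum.cong refl) (simp add: t_def algebra_simps)
    also have "\<dots> = (\<Sum>k\<le>n. ?b k * ((real (l + 2 * k) - real n) * (real (l + 2 * k) + real n + 1 + 2 * s) * c n (l + 2 * k)) - t (Suc k))"
      unfolding sum_subtractf tele ..
    also have "\<dots> = (\<Sum>k\<le>n. (real l + 1 + 2 * s) * (real l + 2 + 2 * s) * (?b k * c n (l + 2 + 2 * k)))"
    proof (intro sum.cong refl)
      fix k
      show "?b k * ((real (l + 2 * k) - real n) * (real (l + 2 * k) + real n + 1 + 2 * s) * c n (l + 2 * k)) - t (Suc k)
        = (real l + 1 + 2 * s) * (real l + 2 + 2 * s) * (?b k * c n (l + 2 + 2 * k))"
        unfolding rec[of "l + 2 * k", symmetric] tS by (simp add: algebra_simps)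
    qed
    also have "\<dots> = (real l + 1 + 2 * s) * (real l + 2 + 2 * s) * S (l + 2)"
      by (simp add: S_def sum_distrib_left)
    finally have "(real l - real n) * (real l + real n + 1 + 2 * s) * (?e l * S l)
       = ((real l + 1 + 2 * s) * (real l + 2 + 2 * s) * ?e l) * S (l + 2)"
      by (simp add: mult_ac)
    then show ?thesis unfolding e2[symmetric] by (simp add: mult_ac)
  qed
  have "?e l * S l = ?e n * c n l"
  proof (induction "n - l" arbitrary: l rule: less_induct)
    case less
    consider "l > n" | "l = n" | "l < n" by linarith
    then show ?case
    proof cases
      case 1
      then show ?thesis by (simp add: S_def c0)
    next
      case 2
      have "S n = (\<Sum>k\<in>{0}. ?b k * c n (n + 2 * k))"
        unfolding S_def by (intro sum.mono_neutral_right) (auto simp: c0)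
      then show ?thesis using 2 by (simp add: alt_binomial_def)
    next
      case 3
      have "?e (l + 2) * S (l + 2) = ?e n * c n (l + 2)"
      proof (cases "l + 2 \<le> n")
        case True then show ?thesis using 3 by (intro less) auto
      next
        case False then show ?thesis by (simp add: S_def c0)
      qed
      then have "(real l - real n) * (real l + real n + 1 + 2 * s) * (?e l * S l)
         = ?e n * ((real l + 2) * (real l + 1) * c n (l + 2))"
        using step[of l] by (simp add: mult_ac)
      also have "\<dots> = (real l - real n) * (real l + real n + 1 + 2 * s) * (?e n * c n l)"
        unfolding rec by (simp add: mult_ac)
      finally have "(real l - real n) * (real l + real n + 1 + 2 * s) * (?e l * S l)
         = (real l - real n) * (real l + real n + 1 + 2 * s) * (?e n * c n l)" .
      moreover have "real l + real n + 1 + 2 * s \<noteq> 0" using s by linarith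
      moreover have "real l - real n \<noteq> 0" using 3 by simp
      ultimately show ?thesis by simp
    qed
  qed
  then show ?thesis by (simp add: S_def)
qed

section \<open>From generating functions to Gegenbauer coefficients\<close>

lemma powser_coeffs_unique:
  fixes a b :: "nat \<Rightarrow> real"
  assumes "\<And>c. \<bar>c\<bar> < 1 \<Longrightarrow> (\<lambda>n. a n * c ^ n) sums g c"
    and "\<And>c. \<bar>c\<bar> < 1 \<Longrightarrow> (\<lambda>n. b n * c ^ n) sums g c"
  shows "a n = b n"
proof (induction n rule: less_induct)
  case (less n)
  define d where "d = (\<lambda>n. a n - b n)"
  have d: "(\<lambda>n. d n * c ^ n) sums 0" if "\<bar>c\<bar> < 1" for c
    using sums_diff[OF assms(1)[OF that] assms(2)[OF that]] by (simp add: d_def algebra_simps)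
  have "(\<lambda>m. d (m + n) * c ^ m) sums 0" if "c \<noteq> 0" "norm c < 1" for c
  proof -
    have "(\<lambda>m. d (m + n) * c ^ (m + n)) sums (0 - (\<Sum>i<n. d i * c ^ i))"
      using sums_split_initial_segment[OF d, of c n] that by simp
    moreover have "(\<Sum>i<n. d i * c ^ i) = 0" using less by (intro sum.neutral) (auto simp: d_def)
    ultimately have "(\<lambda>m. c ^ n * (d (m + n) * c ^ m)) sums (c ^ n * 0)"
      by (simp add: power_add mult_ac)
    then show ?thesis using that by (subst (asm) sums_mult_iff) auto
  qed
  then have "((\<lambda>_. 0) \<longlongrightarrow> d (0 + n)) (at (0::real))"
    by (intro powser_limit_0_strong[where s = 1 and a = "\<lambda>m. d (m + n)"]) auto
  then have "d n = 0" by (simp add: tendsto_const_iff)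
  then show ?case by (simp add: d_def)
qed

lemma alt_binomial_even_sums:
  assumes c: "\<bar>c\<bar> < (1::real)"
  shows "(\<lambda>n. (if even n then alt_binomial s (n div 2) else 0) * c ^ n) sums (1 - c\<^sup>2) powr s"
    and "summable (\<lambda>n. norm ((if even n then alt_binomial s (n div 2) else 0) * c ^ n))"
proof -
  let ?g = "\<lambda>n. (if even n then alt_binomial s (n div 2) else 0) * c ^ n"
  let ?f = "\<lambda>k. alt_binomial s k * (c\<^sup>2) ^ k"
  have c2: "\<bar>c\<^sup>2\<bar> < 1" using c by (simp add: abs_square_less_1)
  have inj: "strict_mono (\<lambda>k::nat. 2 * k)" by (auto simp: strict_mono_def)
  \<comment> \<open>the even powers of \<open>c\<close>\<close>
  have e: "(\<lambda>k. ?g (2 * k)) = ?f" by (auto simp: power_mult)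
  have z: "?g n = 0" if "n \<notin> range (\<lambda>k::nat. 2 * k)" for n using that by (auto elim: evenE)
  have "(\<lambda>k. (s gchoose k) * (- (c\<^sup>2)) ^ k) sums (1 + - (c\<^sup>2)) powr s"
    by (rule gen_binomial_real) (use c2 in simp)
  moreover have "(s gchoose k) * (- (c\<^sup>2)) ^ k = ?f k" for k
    by (subst power_minus) (simp add: alt_binomial_def)
  ultimately have f: "?f sums (1 - c\<^sup>2) powr s" by simp
  then show "?g sums (1 - c\<^sup>2) powr s"
    using sums_mono_reindex[OF inj, of ?g] z e by simp
  have "summable (\<lambda>k. norm (?f k))"
  proof -
    define d where "d = (1 + c\<^sup>2) / 2"
    have d: "\<bar>c\<^sup>2\<bar> < \<bar>d\<bar>" "\<bar>d\<bar> < 1" using c2 by (auto simp: d_def)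
    have "(\<lambda>k. (s gchoose k) * (- d) ^ k) sums (1 + - d) powr s"
      by (rule gen_binomial_real) (use d in simp)
    then have "summable (\<lambda>k. (s gchoose k) * (- d) ^ k)" by (rule sums_summable)
    from powser_insidea[OF this, of "c\<^sup>2"] d show ?thesis by (simp add: alt_binomial_def abs_mult)
  qed
  then show "summable (\<lambda>n. norm (?g n))"
    using summable_mono_reindex[OF inj, of "\<lambda>n. norm (?g n)"] z e by (simp add: fun_eq_iff power_mult)
qed

text \<open>Comparison of coefficients in $\sum F_n c^n = \kappa (1-c^2)^s \sum e_n U_n c^n$, where $e_n$ is
  \<open>eigen_factor s n\<close>.\<close>

lemma generating_identity_coeffs:
  fixes F U :: "nat \<Rightarrow> real"
  assumes s: "0 < s"
    and F: "\<And>c. \<bar>c\<bar> < 1 \<Longrightarrow> (\<lambda>n. F n * c ^ n) sums (\<kappa> * (1 - c\<^sup>2) powr s * H c)"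
    and U: "\<And>c. \<bar>c\<bar> < 1 \<Longrightarrow> (\<lambda>n. eigen_factor s n * U n * c ^ n) sums H c"
  shows "F n = \<kappa> * (\<Sum>i\<le>n. (if even i then alt_binomial s (i div 2) * (eigen_factor s (n - i) * U (n - i)) else 0))"
proof -
  let ?b = "\<lambda>n. if even n then alt_binomial s (n div 2) else 0" and ?u = "\<lambda>n. eigen_factor s n * U n"
  have "(\<lambda>n. (\<kappa> * (\<Sum>i\<le>n. ?b i * ?u (n - i))) * c ^ n) sums (\<kappa> * (1 - c\<^sup>2) powr s * H c)" if c: "\<bar>c\<bar> < 1" for c
  proof -
    define d where "d = (1 + \<bar>c\<bar>) / 2"
    have d: "\<bar>d\<bar> < 1" "norm c < norm d" using c by (auto simp: d_def)
    have "summable (\<lambda>n. norm (?u n * c ^ n))"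
      by (rule powser_insidea[OF sums_summable[OF U[OF d(1)]] d(2)])
    from Cauchy_product_sums[OF alt_binomial_even_sums(2)[OF c] this]
    have "(\<lambda>k. \<Sum>i\<le>k. ?b i * c ^ i * (?u (k - i) * c ^ (k - i))) sums ((1 - c\<^sup>2) powr s * H c)"
      using sums_unique[OF alt_binomial_even_sums(1)[OF c]] sums_unique[OF U[OF c]] by simp
    moreover have "(\<Sum>i\<le>k. ?b i * c ^ i * (?u (k - i) * c ^ (k - i))) = (\<Sum>i\<le>k. ?b i * ?u (k - i)) * c ^ k" for k
      unfolding sum_distrib_right
    proof (intro sum.cong refl)
      fix i assume "i \<in> {..k}"
      then have "c ^ k = c ^ i * c ^ (k - i)" by (simp flip: power_add)
      then show "?b i * c ^ i * (?u (k - i) * c ^ (k - i)) = ?b i * ?u (k - i) * c ^ k" by (simp add: mult_ac)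
    qed
    ultimately have "(\<lambda>k. (\<Sum>i\<le>k. ?b i * ?u (k - i)) * c ^ k) sums ((1 - c\<^sup>2) powr s * H c)" by simp
    from sums_mult[OF this, of \<kappa>] show ?thesis by (simp only: mult.assoc)
  qed
  from powser_coeffs_unique[OF F this] have "F n = \<kappa> * (\<Sum>i\<le>n. ?b i * ?u (n - i))" .
  also have "(\<Sum>i\<le>n. ?b i * ?u (n - i)) = (\<Sum>i\<le>n. (if even i then alt_binomial s (i div 2) * ?u (n - i) else 0))"
    by (intro sum.cong) auto
  finally show ?thesis .
qed

lemma generating_identity_gegenbauer:
  fixes F U :: "nat \<Rightarrow> real"
  assumes s: "0 < s"
    and F: "\<And>c. \<bar>c\<bar> < 1 \<Longrightarrow> (\<lambda>n. F n * c ^ n) sums (\<kappa> * (1 - c\<^sup>2) powr s * H c)"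
    and U: "\<And>c. \<bar>c\<bar> < 1 \<Longrightarrow> (\<lambda>n. eigen_factor s n * U n * c ^ n) sums H c"
  shows "(\<Sum>m\<le>n. gegenbauer_mono (s + 1/2) n m * F m) = \<kappa> * eigen_factor s n * (\<Sum>m\<le>n. gegenbauer_mono (s + 1/2) n m * U m)"
proof -
  let ?c = "gegenbauer_mono (s + 1/2) n" and ?b = "alt_binomial s" and ?e = "eigen_factor s"
  have Fm: "F m = \<kappa> * (\<Sum>k\<in>{k. 2 * k \<le> m}. ?b k * (?e (m - 2 * k) * U (m - 2 * k)))" for m
  proof -
    have "(\<Sum>i\<le>m. (if even i then ?b (i div 2) * (?e (m - i) * U (m - i)) else 0))
       = (\<Sum>i\<in>(\<lambda>k. 2 * k) ` {k. 2 * k \<le> m}. ?b (i div 2) * (?e (m - i) * U (m - i)))"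
      by (intro sum.mono_neutral_cong_right) (auto elim: evenE)
    also have "\<dots> = (\<Sum>k\<in>{k. 2 * k \<le> m}. ?b k * (?e (m - 2 * k) * U (m - 2 * k)))"
      by (subst sum.reindex) (auto intro: inj_onI)
    finally show ?thesis using generating_identity_coeffs[OF assms, of m] by simp
  qed
  have fin: "finite {k. 2 * k \<le> m}" for m :: nat by (rule finite_subset[of _ "{..m}"]) auto
  have "(\<Sum>m\<le>n. ?c m * F m) = \<kappa> * (\<Sum>m\<le>n. \<Sum>k\<in>{k. 2 * k \<le> m}. ?c m * (?b k * (?e (m - 2 * k) * U (m - 2 * k))))"
    by (subst Fm) (simp add: sum_distrib_left mult_ac)
  also have "(\<Sum>m\<le>n. \<Sum>k\<in>{k. 2 * k \<le> m}. ?c m * (?b k * (?e (m - 2 * k) * U (m - 2 * k))))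
     = (\<Sum>(m, k)\<in>Sigma {..n} (\<lambda>m. {k. 2 * k \<le> m}). ?c m * (?b k * (?e (m - 2 * k) * U (m - 2 * k))))"
    by (rule sum.Sigma) (auto intro: fin)
  also have "\<dots> = (\<Sum>(l, k)\<in>{..n} \<times> {..n}. ?c (l + 2 * k) * (?b k * (?e l * U l)))"
    by (rule sum.reindex_bij_witness_not_neutral[where S' = "{}" and T' = "{(l,k)\<in>{..n} \<times> {..n}. n < l + 2 * k}"
          and i = "\<lambda>(l, k). (l + 2 * k, k)" and j = "\<lambda>(m, k). (m - 2 * k, k)"])
       (auto simp: gegenbauer_mono_eq_0 intro: finite_subset[of _ "{..n} \<times> {..n}"])
  also have "\<dots> = (\<Sum>l\<le>n. (?e l * (\<Sum>k\<le>n. ?b k * ?c (l + 2 * k))) * U l)"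
    by (simp add: sum.cartesian_product[symmetric] sum_distrib_left sum_distrib_right mult_ac)
  also have "\<dots> = (\<Sum>l\<le>n. ?e n * ?c l * U l)"
    using gegenbauer_eigen_mono[OF s] by simp
  finally show ?thesis by (simp add: sum_distrib_left mult_ac)
qed

lemma powr_Bernoulli:
  fixes s x :: real
  assumes "0 \<le> s" "s \<le> 1" "0 < x"
  shows "x powr s \<le> 1 + s * (x - 1)"
  using Youngs_inequality_0[of s "1 - s" x 1] assms by (simp add: algebra_simps)

text \<open>The growth of the eigenvalues: Bernoulli's inequality compares the ratio of consecutive
  eigenvalues with that of $(n+2)^{2s}$.\<close>

lemma eigen_factor_lower_bound:
  assumes "0 < s" "s < 1"
  shows "(1 + (real n)\<^sup>2) powr s \<le> 4 powr s * eigen_factor s n"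
proof -
  have *: "((real n + 2)\<^sup>2) powr s \<le> 4 powr s * eigen_factor s n"
  proof (induction n)
    case 0
    then show ?case by (simp add: eigen_factor_def)
  next
    case (Suc n)
    define m where "m = real n + 2"
    have m: "m \<ge> 2" by (simp add: m_def)
    have "((m + 1)\<^sup>2 / m\<^sup>2) powr s \<le> 1 + s * ((m + 1)\<^sup>2 / m\<^sup>2 - 1)"
      using assms m by (intro powr_Bernoulli) auto
    also have "(m + 1)\<^sup>2 / m\<^sup>2 - 1 \<le> 2 / (m - 1)"
      using m by (simp add: field_simps power2_eq_square)
    finally have b: "((m + 1)\<^sup>2 / m\<^sup>2) powr s \<le> 1 + s * (2 / (m - 1))"
      using assms by (simp add: mult_left_mono)
    have e: "eigen_factor s (Suc n) = (1 + s * (2 / (m - 1))) * eigen_factor s n"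
    proof -
      have "(m - 1) * eigen_factor s (Suc n) = (m - 1 + 2 * s) * eigen_factor s n"
        using eigen_factor_Suc[of n s] by (simp add: m_def add_ac)
      then have "eigen_factor s (Suc n) = (m - 1 + 2 * s) * eigen_factor s n / (m - 1)" using m by (simp add: eq_divide_eq mult_ac)
      also have "\<dots> = (1 + s * (2 / (m - 1))) * eigen_factor s n" using m by (simp add: field_simps)
      finally show ?thesis .
    qed
    have "((real (Suc n) + 2)\<^sup>2) powr s = ((m + 1)\<^sup>2 / m\<^sup>2 * m\<^sup>2) powr s"
      using m by (simp add: m_def add_ac)
    also have "\<dots> = ((m + 1)\<^sup>2 / m\<^sup>2) powr s * (m\<^sup>2) powr s"
      by (rule powr_mult)
    also have "\<dots> \<le> (1 + s * (2 / (m - 1))) * (4 powr s * eigen_factor s n)"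
      using b Suc.IH m assms by (intro mult_mono) (auto simp: m_def)
    also have "\<dots> = 4 powr s * eigen_factor s (Suc n)" unfolding e by simp
    finally show ?case .
  qed
  have "(1 + (real n)\<^sup>2) powr s \<le> ((real n + 2)\<^sup>2) powr s"
    using assms by (intro powr_mono2) (auto simp: power2_eq_square algebra_simps)
  with * show ?thesis by linarith
qed

section \<open>The singular kernel outside a Moebius-invariant neighbourhood\<close>

lemma powr_of_square: "0 \<le> (x::real) \<Longrightarrow> (x\<^sup>2) powr a = x powr (2 * a)"
  by (cases "x = 0") (simp_all add: powr_powr flip: powr_numeral)

abbreviation plane :: "(real \<times> real) measure" where
  "plane \<equiv> lborel \<Otimes>\<^sub>M lborel"

text \<open>The kernel $|x-y|^{-1-2s}$, with value $0$ on the diagonal.\<close>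

abbreviation kern :: "real \<Rightarrow> real \<Rightarrow> real \<Rightarrow> real" where
  "kern s x y \<equiv> 1 / \<bar>x - y\<bar> powr (1 + 2 * s)"

lemma nn_integral_kern_tail:
  assumes s: "0 < s" and A: "x < (A::real)"
  shows "(\<integral>\<^sup>+y. ennreal (indicator {A..} y * kern s x y) \<partial>lborel) = ennreal ((A - x) powr (-2 * s) / (2 * s))"
proof -
  have "(\<integral>\<^sup>+y. ennreal ((y - x) powr (-2 * s - 1)) * indicator {A..} y \<partial>lborel)
    = ennreal (0 - (- ((A - x) powr (-2 * s)) / (2 * s)))"
  proof (rule nn_integral_FTC_atLeast[where F = "\<lambda>y. - ((y - x) powr (-2 * s)) / (2 * s)"])
    show "((\<lambda>y. - ((y - x) powr (- 2 * s)) / (2 * s)) has_real_derivative (y - x) powr (- 2 * s - 1)) (at y)" if "A \<le> y" for y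
      using that A s by (auto intro!: derivative_eq_intros simp: field_simps)
    show "((\<lambda>y. - ((y - x) powr (- 2 * s)) / (2 * s)) \<longlongrightarrow> 0) at_top"
    proof -
      have "((\<lambda>y. (y - x) powr (- 2 * s)) \<longlongrightarrow> 0) at_top"
        using s by (intro tendsto_neg_powr filterlim_tendsto_add_at_top[of "\<lambda>_. -x" "-x", simplified]) (auto intro: filterlim_ident)
      then show ?thesis using tendsto_divide_zero[of "\<lambda>y. - ((y - x) powr (- 2 * s))"] tendsto_minus by force
    qed
  qed auto
  moreover have "ennreal ((y - x) powr (-2 * s - 1)) * indicator {A..} y = ennreal (indicator {A..} y * kern s x y)" for y
  proof (cases "A \<le> y")
    case True
    have "(y - x) powr (-2 * s - 1) = kern s x y"
    proof -
      have e: "-2 * s - 1 = - (1 + 2 * s)" by simp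
      show ?thesis unfolding e powr_minus_divide using True A by (simp add: abs_minus_commute)
    qed
    then show ?thesis using True by simp
  qed auto
  ultimately show ?thesis by simp
qed

lemma nn_integral_kern_tail':
  assumes s: "0 < s" and A: "(A::real) < x"
  shows "(\<integral>\<^sup>+y. ennreal (indicator {..A} y * kern s x y) \<partial>lborel) = ennreal ((x - A) powr (-2 * s) / (2 * s))"
proof -
  have "(\<integral>\<^sup>+y. ennreal (indicator {..A} y * kern s x y) \<partial>lborel)
     = (\<integral>\<^sup>+y. ennreal (indicator {-A..} y * kern s (-x) y) \<partial>lborel)"
    by (subst nn_integral_real_affine[where t = 0 and c = "-1"])
       (auto intro!: nn_integral_cong simp: indicator_def abs_minus_commute)
  also have "\<dots> = ennreal ((- A - (- x)) powr (-2 * s) / (2 * s))"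
    by (rule nn_integral_kern_tail[OF s]) (use A in simp)
  finally show ?thesis by simp
qed

text \<open>The points at pseudo-hyperbolic distance at least $\epsilon$ from $x$. For $|x| < 1$ and $0 < \epsilon < 1$ it
  contains all $y$ with $|y| \ge 1$, so that one condition truncates the form on the whole plane.\<close>

definition far :: "real \<Rightarrow> real \<Rightarrow> real set" where
  "far \<epsilon> x = {y. \<epsilon> * \<bar>1 - x * y\<bar> \<le> \<bar>x - y\<bar>}"

lemma far_sym: "y \<in> far \<epsilon> x \<longleftrightarrow> x \<in> far \<epsilon> y"
  by (simp add: far_def mult.commute abs_minus_commute)

lemma one_plus_pos: "\<bar>x\<bar> < 1 \<Longrightarrow> \<bar>z\<bar> \<le> 1 \<Longrightarrow> 0 < 1 + x * (z::real)"
  "\<bar>x\<bar> < 1 \<Longrightarrow> \<bar>z\<bar> \<le> 1 \<Longrightarrow> 0 < 1 - x * (z::real)"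
proof -
  assume "\<bar>x\<bar> < 1" "\<bar>z\<bar> \<le> 1"
  then have "\<bar>x * z\<bar> < 1" using mult_le_one[of "\<bar>z\<bar>" "\<bar>x\<bar>"]
    by (metis abs_ge_zero abs_mult linorder_not_le mult.commute mult_left_le order.strict_trans1 order_less_le_trans)
  then show "0 < 1 + x * z" "0 < 1 - x * z" by (simp_all add: abs_less_iff)
qed

text \<open>The complement of the set is an open interval around $x$, whose end points are the images of $\pm\epsilon$ under
  the Moebius map $z \mapsto (x+z)/(1+xz)$.\<close>

lemma far_eq:
  assumes x: "\<bar>x\<bar> < 1" and e: "0 < \<epsilon>" "\<epsilon> < 1"
  shows "far \<epsilon> x = {(x + \<epsilon>) / (1 + x * \<epsilon>)..} \<union> {..(x - \<epsilon>) / (1 - x * \<epsilon>)}"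
    and "(x - \<epsilon>) / (1 - x * \<epsilon>) < x" "x < (x + \<epsilon>) / (1 + x * \<epsilon>)"
proof -
  have p: "0 < 1 + x * \<epsilon>" "0 < 1 - x * \<epsilon>" using one_plus_pos[OF x, of \<epsilon>] e by auto
  have x2: "x * x < 1" using x by (metis abs_square_less_1 power2_eq_square)
  then have ex: "\<epsilon> * (x * x) < \<epsilon>" using e by simp
  show lt: "(x - \<epsilon>) / (1 - x * \<epsilon>) < x" "x < (x + \<epsilon>) / (1 + x * \<epsilon>)"
    using p ex by (simp_all add: divide_less_eq less_divide_eq algebra_simps)
  show "far \<epsilon> x = {(x + \<epsilon>) / (1 + x * \<epsilon>)..} \<union> {..(x - \<epsilon>) / (1 - x * \<epsilon>)}"
  proof (intro set_eqI)
    fix y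
    define P where "P = (1 + x * \<epsilon>) * y - (x + \<epsilon>)"
    define N where "N = (1 - x * \<epsilon>) * y - (x - \<epsilon>)"
    have "y \<in> far \<epsilon> x \<longleftrightarrow> (\<epsilon> * (1 - x * y))\<^sup>2 \<le> (x - y)\<^sup>2"
      unfolding far_def using e by (simp add: abs_le_square_iff[symmetric] abs_mult)
    also have "\<dots> \<longleftrightarrow> 0 \<le> P * N"
      unfolding P_def N_def by (simp add: power2_eq_square algebra_simps)
    also have "\<dots> \<longleftrightarrow> 0 \<le> P \<or> N \<le> 0"
    proof -
      have "0 < N" if "0 \<le> P"
      proof -
        have "(x + \<epsilon>) / (1 + x * \<epsilon>) \<le> y" using that p by (simp add: P_def divide_le_eq mult_ac)
        then have "(x - \<epsilon>) / (1 - x * \<epsilon>) < y" using lt by linarith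
        then show ?thesis using p by (simp add: N_def divide_less_eq mult_ac)
      qed
      then show ?thesis by (auto simp: zero_le_mult_iff)
    qed
    also have "\<dots> \<longleftrightarrow> y \<in> {(x + \<epsilon>) / (1 + x * \<epsilon>)..} \<union> {..(x - \<epsilon>) / (1 - x * \<epsilon>)}"
      using p by (simp add: P_def N_def divide_le_eq le_divide_eq mult_ac)
    finally show "y \<in> far \<epsilon> x \<longleftrightarrow> y \<in> {(x + \<epsilon>) / (1 + x * \<epsilon>)..} \<union> {..(x - \<epsilon>) / (1 - x * \<epsilon>)}" .
  qed
qed

lemma far_measurable [measurable]: "far \<epsilon> x \<in> sets borel"
  unfolding far_def by measurable

lemma integral_kern_far:
  assumes s: "0 < s" and x: "\<bar>x\<bar> < 1" and e: "0 < \<epsilon>" "\<epsilon> < 1"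
  shows "has_bochner_integral lborel (\<lambda>y. indicator (far \<epsilon> x) y * kern s x y)
    ((1 - x\<^sup>2) powr (-2 * s) * \<epsilon> powr (-2 * s) * ((1 + x * \<epsilon>) powr (2 * s) + (1 - x * \<epsilon>) powr (2 * s)) / (2 * s))"
proof (rule has_bochner_integral_nn_integral)
  define yp where "yp = (x + \<epsilon>) / (1 + x * \<epsilon>)"
  define yn where "yn = (x - \<epsilon>) / (1 - x * \<epsilon>)"
  have p: "0 < 1 + x * \<epsilon>" "0 < 1 - x * \<epsilon>" using one_plus_pos[OF x, of \<epsilon>] e by auto
  have lt: "yn < x" "x < yp" using far_eq[OF x e] by (auto simp: yp_def yn_def)
  have x2: "0 < 1 - x\<^sup>2" using x by (simp add: abs_square_less_1)
  have "yp - x = (1 - x\<^sup>2) * \<epsilon> / (1 + x * \<epsilon>)" "x - yn = (1 - x\<^sup>2) * \<epsilon> / (1 - x * \<epsilon>)"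
    using p by (simp_all add: yp_def yn_def field_simps power2_eq_square)
  then have v: "(yp - x) powr (-2 * s) = (1 - x\<^sup>2) powr (-2 * s) * \<epsilon> powr (-2 * s) * (1 + x * \<epsilon>) powr (2 * s)"
    "(x - yn) powr (-2 * s) = (1 - x\<^sup>2) powr (-2 * s) * \<epsilon> powr (-2 * s) * (1 - x * \<epsilon>) powr (2 * s)"
    using p e x2 by (simp_all add: powr_divide powr_mult powr_minus_divide)
  have "(\<integral>\<^sup>+y. ennreal (indicator (far \<epsilon> x) y * kern s x y) \<partial>lborel)
    = (\<integral>\<^sup>+y. ennreal (indicator {yp..} y * kern s x y) + ennreal (indicator {..yn} y * kern s x y) \<partial>lborel)"
    unfolding far_eq[OF x e] yp_def[symmetric] yn_def[symmetric] using lt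
    by (intro nn_integral_cong) (auto simp: indicator_def)
  also have "\<dots> = ennreal ((yp - x) powr (-2 * s) / (2 * s)) + ennreal ((x - yn) powr (-2 * s) / (2 * s))"
    by (subst nn_integral_add) (use s lt in \<open>simp_all only: nn_integral_kern_tail nn_integral_kern_tail', measurable\<close>)
  also have "\<dots> = ennreal ((yp - x) powr (-2 * s) / (2 * s) + (x - yn) powr (-2 * s) / (2 * s))"
    using s by (subst ennreal_plus) auto
  also have "(yp - x) powr (-2 * s) / (2 * s) + (x - yn) powr (-2 * s) / (2 * s)
    = (1 - x\<^sup>2) powr (-2 * s) * \<epsilon> powr (-2 * s) * ((1 + x * \<epsilon>) powr (2 * s) + (1 - x * \<epsilon>) powr (2 * s)) / (2 * s)"
    unfolding v by (simp add: add_divide_distrib algebra_simps)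
  finally show "(\<integral>\<^sup>+y. ennreal (indicator (far \<epsilon> x) y * kern s x y) \<partial>lborel) = ennreal \<dots>" .
qed (use s in auto)

text \<open>The integral $\int_0^X t^{s-1}/(1+t)\,dt$ and its limit as $X \to \infty$, which is the
  constant in the eigenvalues.\<close>

definition beta_part :: "real \<Rightarrow> real \<Rightarrow> real" where
  "beta_part s X = (\<integral>t. indicator {0..X} t * (t powr (s - 1) / (1 + t)) \<partial>lborel)"

definition beta_full :: "real \<Rightarrow> real" where
  "beta_full s = (\<integral>t. indicator {0..} t * (t powr (s - 1) / (1 + t)) \<partial>lborel)"

lemma integrable_beta_full:
  assumes s: "0 < s" "s < 1"
  shows "integrable lborel (\<lambda>t::real. indicator {0..} t * (t powr (s - 1) / (1 + t)))"
proof -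
  have a: "(\<integral>\<^sup>+t. ennreal (t powr (s - 1)) * indicator {0..1} t \<partial>lborel) = ennreal (1 / s)"
    using nn_integral_has_integral_lebesgue'[OF _ has_integral_powr_from_0[of "s - 1" 1]] s by simp
  have b: "(\<integral>\<^sup>+t. ennreal (t powr (s - 2)) * indicator {1..} t \<partial>lborel) = ennreal (1 / (1 - s))"
    using nn_integral_has_integral_lebesgue'[OF _ has_integral_powr_to_inf[of "s - 2" 1]] s
    by (simp add: minus_divide_right)
  have "(\<integral>\<^sup>+t. ennreal (indicator {0..} t * (t powr (s - 1) / (1 + t))) \<partial>lborel)
    \<le> (\<integral>\<^sup>+t. ennreal (t powr (s - 1)) * indicator {0..1} t + ennreal (t powr (s - 2)) * indicator {1..} t \<partial>lborel)"
  proof (intro nn_integral_mono)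
    fix t :: real
    consider "t < 0" | "0 \<le> t" "t < 1" | "1 \<le> t" by linarith
    then show "ennreal (indicator {0..} t * (t powr (s - 1) / (1 + t)))
      \<le> ennreal (t powr (s - 1)) * indicator {0..1} t + ennreal (t powr (s - 2)) * indicator {1..} t"
    proof cases
      case 2
      have "t powr (s - 1) / (1 + t) \<le> t powr (s - 1) / 1" using 2 by (intro divide_left_mono) auto
      then show ?thesis using 2 by (auto simp: indicator_def intro!: ennreal_leI add_increasing2)
    next
      case 3
      have "t powr (s - 1) / (1 + t) \<le> t powr (s - 1) / t" using 3 by (intro divide_left_mono) auto
      also have "\<dots> = t powr (s - 2)" using 3 powr_diff[of t "s - 1" 1] by simp
      finally have "ennreal (indicator {0..} t * (t powr (s - 1) / (1 + t))) \<le> 0 + ennreal (t powr (s - 2)) * indicator {1..} t"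
        using 3 by (auto simp: indicator_def intro!: ennreal_leI)
      also have "\<dots> \<le> ennreal (t powr (s - 1)) * indicator {0..1} t + ennreal (t powr (s - 2)) * indicator {1..} t"
        by (intro add_right_mono) simp
      finally show ?thesis .
    qed auto
  qed
  also have "\<dots> = ennreal (1 / s) + ennreal (1 / (1 - s))"
    by (subst nn_integral_add) (simp_all only: a b, measurable)
  also have "\<dots> < \<infinity>" by simp
  finally have fin: "(\<integral>\<^sup>+t. ennreal (indicator {0..} t * (t powr (s - 1) / (1 + t))) \<partial>lborel) < \<infinity>" .
  show ?thesis
    by (rule integrableI_nonneg[OF _ _ fin]) (measurable, auto simp: indicator_def)
qed

lemma beta_part_integrable:
  assumes s: "0 < s" "s < 1"
  shows "integrable lborel (\<lambda>t::real. indicator {0..X} t * (t powr (s - 1) / (1 + t)))"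
  by (rule Bochner_Integration.integrable_bound[OF integrable_beta_full[OF s]]) (auto simp: indicator_def)

lemma beta_part_bounds:
  assumes s: "0 < s" "s < 1"
  shows "0 \<le> beta_part s X" "beta_part s X \<le> beta_full s"
proof -
  show "0 \<le> beta_part s X" unfolding beta_part_def by (intro integral_nonneg_AE) (auto simp: indicator_def)
  show "beta_part s X \<le> beta_full s" unfolding beta_part_def beta_full_def
    by (intro integral_mono beta_part_integrable integrable_beta_full s) (auto simp: indicator_def)
qed

lemma beta_full_pos:
  assumes s: "0 < s" "s < 1"
  shows "0 < beta_full s"
proof -
  have "beta_full s \<noteq> 0"
  proof
    assume "beta_full s = 0"
    then have "AE t in lborel. indicator {0..} t * (t powr (s - 1) / (1 + t)) = (0::real)"
      unfolding beta_full_def by (subst (asm) integral_nonneg_eq_0_iff_AE[OF integrable_beta_full[OF s]]) (auto simp: indicator_def)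
    then have "AE t in lborel. t \<notin> {0<..<1::real}" by eventually_elim (auto simp: indicator_def split: if_splits)
    then have "emeasure lborel {0<..<1::real} = 0" by (subst (asm) AE_iff_measurable[where N = "{0<..<1::real}"]) auto
    then show False by simp
  qed
  moreover have "0 \<le> beta_full s" unfolding beta_full_def by (intro integral_nonneg_AE) (auto simp: indicator_def)
  ultimately show ?thesis by simp
qed

lemma beta_part_tendsto:
  assumes s: "0 < s" "s < 1"
  shows "(beta_part s \<longlongrightarrow> beta_full s) at_top"
  unfolding beta_part_def beta_full_def
proof (rule integral_dominated_convergence_at_top[where w = "\<lambda>t. indicator {0..} t * (t powr (s - 1) / (1 + t))"])
  show "AE t in lborel. ((\<lambda>X. indicator {0..X} t * (t powr (s - 1) / (1 + t))) \<longlongrightarrow> indicator {0..} t * (t powr (s - 1) / (1 + t))) at_top"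
  proof (rule AE_I2)
    fix t :: real
    have "\<forall>\<^sub>F X in at_top. indicator {0..} t * (t powr (s - 1) / (1 + t)) = indicator {0..X} t * (t powr (s - 1) / (1 + t))"
      using eventually_ge_at_top[of t] by eventually_elim (auto simp: indicator_def)
    then show "((\<lambda>X. indicator {0..X} t * (t powr (s - 1) / (1 + t))) \<longlongrightarrow> indicator {0..} t * (t powr (s - 1) / (1 + t))) at_top"
      by (rule Lim_transform_eventually[OF tendsto_const])
  qed
qed (use integrable_beta_full[OF s] in \<open>auto simp: indicator_def\<close>)

text \<open>From $t^s/(t+\sigma) = t^{s-1} - \sigma t^{s-1}/(t+\sigma)$, and scaling by $\sigma$ in the second term.\<close>

lemma integral_powr_over_shift:
  assumes s: "0 < s" "s < 1" and T: "0 \<le> T" and g: "0 < \<sigma>"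
  shows "has_bochner_integral lborel (\<lambda>t. indicator {0..T} t * (t powr s / (t + \<sigma>)))
    (T powr s / s - \<sigma> powr s * beta_part s (T / \<sigma>))"
proof -
  have a: "has_bochner_integral lborel (\<lambda>t. indicator {0..T} t * t powr (s - 1)) (T powr s / s)"
    using nn_integral_has_integral_lebesgue'[OF _ has_integral_powr_from_0[of "s - 1" T]] s T
    by (intro has_bochner_integral_nn_integral) (auto simp: indicator_mult_ennreal mult.commute simp flip: nn_integral_set_ennreal)
  have "has_bochner_integral lborel (\<lambda>t. indicator {0..T / \<sigma>} t * (t powr (s - 1) / (1 + t))) (beta_part s (T / \<sigma>))"
    unfolding beta_part_def by (rule has_bochner_integral_integrable[OF beta_part_integrable[OF s]])
  then have "has_bochner_integral lborel (\<lambda>t. indicator {0..T / \<sigma>} (0 + 1 / \<sigma> * t) * ((0 + 1 / \<sigma> * t) powr (s - 1) / (1 + (0 + 1 / \<sigma> * t)))) (beta_part s (T / \<sigma>) /\<^sub>R \<bar>1 / \<sigma>\<bar>)"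
    using g by (subst lborel_has_bochner_integral_real_affine_iff[symmetric]) auto
  then have main: "has_bochner_integral lborel (\<lambda>t. \<sigma> powr (s - 1) * (indicator {0..T / \<sigma>} (0 + 1 / \<sigma> * t) * ((0 + 1 / \<sigma> * t) powr (s - 1) / (1 + (0 + 1 / \<sigma> * t))))) (\<sigma> powr (s - 1) * (beta_part s (T / \<sigma>) /\<^sub>R \<bar>1 / \<sigma>\<bar>))"
    by (rule has_bochner_integral_mult_right)
  have val: "\<sigma> powr (s - 1) * (beta_part s (T / \<sigma>) /\<^sub>R \<bar>1 / \<sigma>\<bar>) = \<sigma> powr s * beta_part s (T / \<sigma>)"
    using g powr_add[of \<sigma> "s - 1" 1] by simp
  have fe: "\<sigma> powr (s - 1) * (indicator {0..T / \<sigma>} (0 + 1 / \<sigma> * t) * ((0 + 1 / \<sigma> * t) powr (s - 1) / (1 + (0 + 1 / \<sigma> * t))))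
     = indicator {0..T} t * (\<sigma> * t powr (s - 1) / (t + \<sigma>))" for t
  proof (cases "t \<in> {0..T}")
    case True
    then have h: "t powr (s - 1) = \<sigma> powr (s - 1) * (t / \<sigma>) powr (s - 1)" using g by (simp add: powr_divide)
    show ?thesis using True g by (auto simp: indicator_def divide_simps h algebra_simps)
  next
    case False
    then show ?thesis using g by (auto simp: indicator_def divide_simps split: if_splits)
  qed
  have b: "has_bochner_integral lborel (\<lambda>t. indicator {0..T} t * (\<sigma> * t powr (s - 1) / (t + \<sigma>))) (\<sigma> powr s * beta_part s (T / \<sigma>))"
    using main unfolding fe val .
  have "indicator {0..T} t * t powr (s - 1) - indicator {0..T} t * (\<sigma> * t powr (s - 1) / (t + \<sigma>))
     = indicator {0..T} t * (t powr s / (t + \<sigma>))" for t :: real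
  proof (cases "0 \<le> t")
    case True
    have "t powr s = t * t powr (s - 1)" using powr_add[of t "s - 1" 1] True s by (cases "t = 0") auto
    then show ?thesis using True g by (simp add: indicator_def field_simps)
  qed simp
  with has_bochner_integral_diff[OF a b] show ?thesis by simp
qed

section \<open>The profiles and their truncated kernel integrals\<close>

text \<open>The generating function $(1-x^2)^s/(1-cx)$ of the functions $(1-x^2)^s x^n$, extended by $0$.\<close>

definition profile :: "real \<Rightarrow> real \<Rightarrow> real \<Rightarrow> real" where
  "profile s c x = (if \<bar>x\<bar> < 1 then (1 - x\<^sup>2) powr s / (1 - c * x) else 0)"

lemma profile_nonneg: "\<bar>c\<bar> < 1 \<Longrightarrow> 0 \<le> profile s c x"
  unfolding profile_def using one_plus_pos(2)[of c x] by (auto intro!: divide_nonneg_pos)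

lemma profile_measurable [measurable]: "profile s c \<in> borel_measurable borel"
  unfolding profile_def by measurable

text \<open>The change of variables $y = (x+z)/(1+xz)$ separates the dependence on $x$: it stays in the
  factor in front and in the single parameter $\tau$.\<close>

lemma moebius_integrand:
  assumes x: "\<bar>x\<bar> < 1" and c: "\<bar>c\<bar> < 1" and z: "\<bar>z\<bar> \<le> 1" and e: "0 < \<epsilon>"
  defines "y \<equiv> (x + z) / (1 + x * z)" and "\<tau> \<equiv> (c - x) / (1 - c * x)"
  shows "indicator (far \<epsilon> x) y * (profile s c y * kern s x y) * ((1 - x\<^sup>2) / (1 + x * z)\<^sup>2)
    = (1 - x\<^sup>2) powr (-s) / (1 - c * x) * (indicator {\<epsilon>..} \<bar>z\<bar> * ((1 - z\<^sup>2) powr s / (1 - \<tau> * z) / \<bar>z\<bar> powr (1 + 2 * s)))"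
proof -
  define A B Z E where "A = 1 - x\<^sup>2" and "B = 1 + x * z" and "Z = 1 - z\<^sup>2" and "E = 1 - c * x"
  have A: "0 < A" using x by (simp add: A_def abs_square_less_1)
  have B: "0 < B" using one_plus_pos(1)[OF x z] by (simp add: B_def)
  have E: "0 < E" using one_plus_pos(2)[OF c, of x] x by (simp add: E_def)
  have Z: "0 \<le> Z" using z by (simp add: Z_def abs_square_le_1)
  have xy: "x - y = - (z * A / B)" and xy1: "1 - x * y = A / B" and yy: "1 - y\<^sup>2 = A * Z / B\<^sup>2"
    and cy: "1 - c * y = E * (1 - \<tau> * z) / B"
  proof -
    have yB: "y * B = x + z" using B by (simp add: y_def B_def)
    have tE: "\<tau> * E = c - x" using E by (simp add: \<tau>_def E_def)
    have "(x - y) * B = x * B - y * B" by (simp add: algebra_simps)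
    also have "\<dots> = - (z * A)" unfolding yB by (simp add: A_def B_def power2_eq_square algebra_simps)
    finally have "x - y = (- (z * A)) / B" using B by (subst eq_divide_eq) simp
    then show "x - y = - (z * A / B)" by simp
    have "(1 - x * y) * B = B - x * (y * B)" by (simp add: algebra_simps)
    also have "\<dots> = A" unfolding yB by (simp add: A_def B_def power2_eq_square algebra_simps)
    finally show "1 - x * y = A / B" using B by (simp add: eq_divide_eq)
    have "(1 - y\<^sup>2) * B\<^sup>2 = B\<^sup>2 - (y * B)\<^sup>2" by (simp add: power_mult_distrib algebra_simps)
    also have "\<dots> = A * Z" unfolding yB by (simp add: A_def B_def Z_def power2_eq_square algebra_simps)
    finally show "1 - y\<^sup>2 = A * Z / B\<^sup>2" using B by (simp add: eq_divide_eq)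
    have "(1 - c * y) * B = B - c * (y * B)" by (simp add: algebra_simps)
    also have "\<dots> = E - (\<tau> * E) * z" unfolding yB tE by (simp add: B_def E_def algebra_simps)
    finally show "1 - c * y = E * (1 - \<tau> * z) / B" using B by (simp add: eq_divide_eq algebra_simps)
  qed
  have axy: "\<bar>x - y\<bar> = \<bar>z\<bar> * A / B" unfolding xy using A B by (simp add: abs_mult)
  have far: "y \<in> far \<epsilon> x \<longleftrightarrow> \<epsilon> \<le> \<bar>z\<bar>"
  proof -
    have "\<bar>1 - x * y\<bar> = A / B" unfolding xy1 using A B by simp
    then have "y \<in> far \<epsilon> x \<longleftrightarrow> \<epsilon> * (A / B) \<le> \<bar>z\<bar> * (A / B)"
      unfolding far_def mem_Collect_eq axy by simp
    moreover have "0 < A / B" using A B by simp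
    ultimately show ?thesis using mult_le_cancel_right_pos[of "A / B" \<epsilon> "\<bar>z\<bar>"] by blast
  qed
  show ?thesis
  proof (cases "\<epsilon> \<le> \<bar>z\<bar>")
    case False
    then show ?thesis using far by simp
  next
    case True
    have pr: "profile s c y = (1 - y\<^sup>2) powr s / (1 - c * y)"
    proof (cases "\<bar>y\<bar> < 1")
      case False
      then have "1 - y\<^sup>2 \<le> 0" using abs_square_less_1[of y] by linarith
      moreover have "0 \<le> 1 - y\<^sup>2" unfolding yy using A Z by simp
      ultimately show ?thesis using False by (simp add: profile_def)
    qed (simp add: profile_def)
    have z0: "0 < \<bar>z\<bar>" using True e by linarith
    have k: "kern s x y = B * (B powr s * B powr s) / (\<bar>z\<bar> powr (1 + 2 * s) * (A * (A powr s * A powr s)))"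
    proof -
      have "(\<bar>z\<bar> * A / B) powr (1 + 2 * s) = \<bar>z\<bar> powr (1 + 2 * s) * A powr (1 + 2 * s) / B powr (1 + 2 * s)"
        by (simp only: powr_mult powr_divide)
      moreover have "p powr (1 + 2 * s) = p * (p powr s * p powr s)" if "0 < p" for p :: real
        using that powr_add[of p 1 "s + s"] powr_add[of p s s] by (simp only: powr_one mult_2)
      ultimately show ?thesis unfolding axy using A B by simp
    qed
    have w: "(1 - y\<^sup>2) powr s = A powr s * Z powr s / (B powr s * B powr s)"
      unfolding yy by (simp only: powr_mult powr_divide power2_eq_square[of B])
    have Ap: "0 < A powr s" "0 < B powr s" using A B by auto
    have alg: "(a * q / (b * b)) / (E * t / B) * (B * (b * b) / (k * (A * (a * a)))) * (A / B\<^sup>2) = 1 / a / E * (q / t / k)"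
      if "0 < a" "0 < b" for a b q t k :: real
      using that A B E by (cases "t = 0"; cases "k = 0") (simp_all add: power2_eq_square field_simps)
    have "profile s c y * kern s x y * (A / B\<^sup>2) = A powr (-s) / E * (Z powr s / (1 - \<tau> * z) / \<bar>z\<bar> powr (1 + 2 * s))"
      unfolding pr k w cy powr_minus_divide by (rule alg[OF Ap])
    then show ?thesis using True far unfolding A_def B_def Z_def E_def by simp
  qed
qed

lemma integral_profile_far:
  assumes s: "0 < s" "s < 1" and x: "\<bar>x\<bar> < 1" and c: "\<bar>c\<bar> < 1" and e: "0 < \<epsilon>" "\<epsilon> < 1"
  defines "T \<equiv> 1 / \<epsilon>\<^sup>2 - 1" and "\<sigma> \<equiv> (1 - c\<^sup>2) * (1 - x\<^sup>2) / (1 - c * x)\<^sup>2"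
  shows "has_bochner_integral lborel (\<lambda>y. indicator (far \<epsilon> x) y * (profile s c y * kern s x y))
    ((1 - x\<^sup>2) powr (-s) / (1 - c * x) * (T powr s / s - \<sigma> powr s * beta_part s (T / \<sigma>)))"
    (is "has_bochner_integral _ ?F _")
proof -
  define \<tau> where "\<tau> = (c - x) / (1 - c * x)"
  define M where "M = (1 - x\<^sup>2) powr (-s) / (1 - c * x)"
  define H where "H z = (1 - z\<^sup>2) powr s / (1 - \<tau> * z) / \<bar>z\<bar> powr (1 + 2 * s)" for z
  have E: "0 < 1 - c * x" using one_plus_pos(2)[OF c, of x] x by simp
  have x2: "0 < 1 - x\<^sup>2" and c2: "0 < 1 - c\<^sup>2" using x c by (simp_all add: abs_square_less_1)
  have sig: "\<sigma> = 1 - \<tau>\<^sup>2"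
  proof -
    have "(1 - \<tau>\<^sup>2) * (1 - c * x)\<^sup>2 = (1 - c * x)\<^sup>2 - (c - x)\<^sup>2"
      using E by (simp add: \<tau>_def power_divide algebra_simps)
    also have "\<dots> = (1 - c\<^sup>2) * (1 - x\<^sup>2)" by (simp add: power2_eq_square algebra_simps)
    finally show ?thesis unfolding \<sigma>_def using E by (simp add: divide_eq_eq)
  qed
  have sig0: "0 < \<sigma>" unfolding \<sigma>_def using E x2 c2 by simp
  have tau: "\<bar>\<tau>\<bar> < 1" using sig sig0 abs_square_less_1[of \<tau>] by simp
  have T0: "0 \<le> T" using e by (simp add: T_def power_le_one)
  have M0: "0 \<le> M" using E by (simp add: M_def)
  have H0: "0 \<le> H z" if "\<bar>z\<bar> \<le> 1" for z
    using one_plus_pos(2)[OF tau that] by (simp add: H_def)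
  have Hm [measurable]: "H \<in> borel_measurable borel" unfolding H_def by measurable
  have "(\<integral>\<^sup>+y. ennreal (?F y) \<partial>lborel) = (\<integral>\<^sup>+y. ennreal (?F y * indicator {-1..1} y) \<partial>lborel)"
    by (intro nn_integral_cong) (auto simp: profile_def indicator_def)
  also have "\<dots> = (\<integral>\<^sup>+z. ennreal (?F ((x + z) / (1 + x * z)) * ((1 - x\<^sup>2) / (1 + x * z)\<^sup>2) * indicator {-1..1} z) \<partial>lborel)"
  proof -
    have ends: "(x + -1) / (1 + x * -1) = -1" "(x + 1) / (1 + x * 1) = 1" using x by (auto simp: field_simps)
    have I: "(\<integral>\<^sup>+y. ennreal (?F y * indicator {(x + -1) / (1 + x * -1)..(x + 1) / (1 + x * 1)} y) \<partial>lborel)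
     = (\<integral>\<^sup>+z. ennreal (?F ((x + z) / (1 + x * z)) * ((1 - x\<^sup>2) / (1 + x * z)\<^sup>2) * indicator {-1..1} z) \<partial>lborel)"
    proof (rule nn_integral_substitution)
      fix z :: real assume z: "z \<in> {-1..1}"
      then have p: "0 < 1 + x * z" by (intro one_plus_pos(1)[OF x]) (simp add: abs_le_iff)
      show "((\<lambda>z. (x + z) / (1 + x * z)) has_real_derivative (1 - x\<^sup>2) / (1 + x * z)\<^sup>2) (at z)"
        using p by (auto intro!: derivative_eq_intros simp: power2_eq_square field_simps)
      show "0 \<le> (1 - x\<^sup>2) / (1 + x * z)\<^sup>2" using x2 by simp
    next
      show "continuous_on {-1..1} (\<lambda>z. (1 - x\<^sup>2) / (1 + x * z)\<^sup>2)"
      proof (intro continuous_intros ballI)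
        fix z :: real assume "z \<in> {-1..1}"
        then have "0 < 1 + x * z" by (intro one_plus_pos(1)[OF x]) (simp add: abs_le_iff)
        then show "(1 + x * z)\<^sup>2 \<noteq> 0" by simp
      qed
    qed (auto simp: set_borel_measurable_def)
    show ?thesis using I unfolding ends .
  qed
  also have "\<dots> = (\<integral>\<^sup>+z. ennreal M * ennreal (indicator {\<epsilon>..1} \<bar>z\<bar> * H z) \<partial>lborel)"
  proof (intro nn_integral_cong)
    fix z :: real
    show "ennreal (?F ((x + z) / (1 + x * z)) * ((1 - x\<^sup>2) / (1 + x * z)\<^sup>2) * indicator {-1..1} z)
      = ennreal M * ennreal (indicator {\<epsilon>..1} \<bar>z\<bar> * H z)"
    proof (cases "\<bar>z\<bar> \<le> 1")
      case True
      have "?F ((x + z) / (1 + x * z)) * ((1 - x\<^sup>2) / (1 + x * z)\<^sup>2) = M * (indicator {\<epsilon>..} \<bar>z\<bar> * H z)"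
        unfolding moebius_integrand[OF x c True e(1)] M_def H_def \<tau>_def by simp
      then show ?thesis using True M0 by (auto simp: indicator_def ennreal_mult' abs_le_iff)
    qed (auto simp: indicator_def abs_le_iff)
  qed
  also have "\<dots> = ennreal M * (\<integral>\<^sup>+z. ennreal (indicator {\<epsilon>..1} \<bar>z\<bar> * H z) \<partial>lborel)"
    by (rule nn_integral_cmult) measurable
  also have "(\<integral>\<^sup>+z. ennreal (indicator {\<epsilon>..1} \<bar>z\<bar> * H z) \<partial>lborel)
    = (\<integral>\<^sup>+z. ennreal (indicator {\<epsilon>..1} z * H z) + ennreal (indicator {-1..-\<epsilon>} z * H z) \<partial>lborel)"
    using e by (intro nn_integral_cong) (auto simp: indicator_def)
  also have "\<dots> = (\<integral>\<^sup>+z. ennreal (indicator {\<epsilon>..1} z * H z) \<partial>lborel) + (\<integral>\<^sup>+z. ennreal (indicator {-1..-\<epsilon>} z * H z) \<partial>lborel)"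
    by (rule nn_integral_add) measurable
  \<comment> \<open>only the even part of \<open>H\<close> contributes\<close>
  also have "(\<integral>\<^sup>+z. ennreal (indicator {-1..-\<epsilon>} z * H z) \<partial>lborel) = (\<integral>\<^sup>+z. ennreal (indicator {\<epsilon>..1} z * H (- z)) \<partial>lborel)"
    by (subst nn_integral_real_affine[where t = 0 and c = "-1"]) (auto intro!: nn_integral_cong simp: indicator_def)
  also have "(\<integral>\<^sup>+z. ennreal (indicator {\<epsilon>..1} z * H z) \<partial>lborel) + (\<integral>\<^sup>+z. ennreal (indicator {\<epsilon>..1} z * H (- z)) \<partial>lborel)
     = (\<integral>\<^sup>+z. ennreal (indicator {\<epsilon>..1} z * H z) + ennreal (indicator {\<epsilon>..1} z * H (- z)) \<partial>lborel)"
    by (rule nn_integral_add[symmetric]) measurable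
  also have "\<dots> = (\<integral>\<^sup>+z. ennreal ((- (1 - 1 / z\<^sup>2)) powr s / (- (1 - 1 / z\<^sup>2) + \<sigma>) * (2 / z ^ 3) * indicator {\<epsilon>..1} z) \<partial>lborel)"
  proof (intro nn_integral_cong)
    fix z :: real
    show "ennreal (indicator {\<epsilon>..1} z * H z) + ennreal (indicator {\<epsilon>..1} z * H (- z))
      = ennreal ((- (1 - 1 / z\<^sup>2)) powr s / (- (1 - 1 / z\<^sup>2) + \<sigma>) * (2 / z ^ 3) * indicator {\<epsilon>..1} z)"
    proof (cases "z \<in> {\<epsilon>..1}")
      case True
      then have z: "0 < z" "z \<le> 1" "\<bar>z\<bar> \<le> 1" "\<bar>- z\<bar> \<le> 1" using e by auto
      have p: "0 < 1 - \<tau> * z" "0 < 1 + \<tau> * z" using one_plus_pos[OF tau z(3)] by auto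
      have z2: "z\<^sup>2 \<le> 1" using z by (simp add: power_le_one)
      have w: "- (1 - 1 / z\<^sup>2) = (1 - z\<^sup>2) / z\<^sup>2" using z by (simp add: field_simps)
      have zp: "\<bar>z\<bar> powr (1 + 2 * s) = z * (z\<^sup>2) powr s" using z by (simp add: powr_add powr_of_square)
      have q: "0 < (z\<^sup>2) powr s" using z by simp
      have d: "(1 - z\<^sup>2) / z\<^sup>2 + \<sigma> = (1 - \<tau> * z) * (1 + \<tau> * z) / z\<^sup>2"
        using z unfolding sig by (simp add: field_simps power2_eq_square)
      have "H z + H (- z) = (1 - z\<^sup>2) powr s * (1 / (1 - \<tau> * z) + 1 / (1 + \<tau> * z)) / (z * (z\<^sup>2) powr s)"
        unfolding H_def abs_minus_cancel zp by (simp add: add_divide_distrib distrib_left)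
      also have "1 / (1 - \<tau> * z) + 1 / (1 + \<tau> * z) = 2 / ((1 - \<tau> * z) * (1 + \<tau> * z))"
        using p by (simp add: field_simps)
      also have "(1 - z\<^sup>2) powr s * (2 / ((1 - \<tau> * z) * (1 + \<tau> * z))) / (z * (z\<^sup>2) powr s)
         = (- (1 - 1 / z\<^sup>2)) powr s / (- (1 - 1 / z\<^sup>2) + \<sigma>) * (2 / z ^ 3)"
        unfolding w d using z p q z2 by (simp add: powr_divide power2_eq_square power3_eq_cube divide_simps)
      finally have *: "H z + H (- z) = (- (1 - 1 / z\<^sup>2)) powr s / (- (1 - 1 / z\<^sup>2) + \<sigma>) * (2 / z ^ 3)" .
      show ?thesis using True H0[OF z(3)] H0[OF z(4)] unfolding *[symmetric] by (simp add: ennreal_plus)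
    qed simp
  qed
  \<comment> \<open>the substitution $t = 1 - z^{-2}$, increasing on $[\epsilon, 1]$; the sign is reversed afterwards\<close>
  also have "\<dots> = (\<integral>\<^sup>+t. ennreal ((- t) powr s / (- t + \<sigma>) * indicator {1 - 1 / \<epsilon>\<^sup>2..1 - 1 / 1\<^sup>2} t) \<partial>lborel)"
  proof (rule nn_integral_substitution[symmetric])
    fix z assume "z \<in> {\<epsilon>..1}"
    then have z: "0 < z" using e by auto
    show "((\<lambda>z. 1 - 1 / z\<^sup>2) has_real_derivative 2 / z ^ 3) (at z)"
      using z by (auto intro!: derivative_eq_intros simp: power2_eq_square power3_eq_cube field_simps)
    show "0 \<le> 2 / z ^ 3" using z by simp
  next
    show "continuous_on {\<epsilon>..1} (\<lambda>z. 2 / z ^ 3)" using e by (intro continuous_intros) auto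
  qed (use e in \<open>auto simp: set_borel_measurable_def\<close>)
  also have "\<dots> = (\<integral>\<^sup>+t. ennreal (indicator {0..T} t * (t powr s / (t + \<sigma>))) \<partial>lborel)"
    by (subst nn_integral_real_affine[where t = 0 and c = "-1"])
       (auto intro!: nn_integral_cong simp: indicator_def T_def)
  also have "\<dots> = ennreal (T powr s / s - \<sigma> powr s * beta_part s (T / \<sigma>))"
  proof -
    note I = integral_powr_over_shift[OF s T0 sig0]
    have "(\<integral>\<^sup>+t. ennreal (indicator {0..T} t * (t powr s / (t + \<sigma>))) \<partial>lborel)
      = ennreal (\<integral>t. indicator {0..T} t * (t powr s / (t + \<sigma>)) \<partial>lborel)"
      using I sig0 by (intro nn_integral_eq_integral) (auto simp: has_bochner_integral_iff indicator_def)
    then show ?thesis using I by (simp add: has_bochner_integral_iff)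
  qed
  also have "ennreal M * \<dots> = ennreal (M * (T powr s / s - \<sigma> powr s * beta_part s (T / \<sigma>)))"
    using M0 by (simp add: ennreal_mult')
  finally have nn: "(\<integral>\<^sup>+y. ennreal (?F y) \<partial>lborel) = ennreal (M * (T powr s / s - \<sigma> powr s * beta_part s (T / \<sigma>)))" .
  have "T powr s / s - \<sigma> powr s * beta_part s (T / \<sigma>) = (\<integral>t. indicator {0..T} t * (t powr s / (t + \<sigma>)) \<partial>lborel)"
    using integral_powr_over_shift[OF s T0 sig0] by (simp add: has_bochner_integral_iff)
  also have "0 \<le> \<dots>" using sig0 by (intro integral_nonneg_AE) (auto simp: indicator_def)
  finally have "0 \<le> T powr s / s - \<sigma> powr s * beta_part s (T / \<sigma>)" .
  then show ?thesis
    unfolding M_def[symmetric] using nn M0 profile_nonneg[OF c]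
    by (intro has_bochner_integral_nn_integral) auto
qed

section \<open>Smooth cutoffs with compact support\<close>

lemma power_le_fact_exp:
  fixes t :: real
  assumes "0 \<le> t"
  shows "t ^ m \<le> fact m * exp t"
proof -
  have "(\<Sum>n\<in>{m}. inverse (fact n) * t ^ n) \<le> (\<Sum>n. inverse (fact n) * t ^ n)"
    by (rule sum_le_suminf[OF summable_exp]) (use assms in auto)
  also have "\<dots> = exp t" by (simp add: exp_def field_simps)
  finally show ?thesis by (simp add: field_simps)
qed

lemma DERIV_zero_quadratic:
  fixes f :: "real \<Rightarrow> real"
  assumes "\<And>y. \<bar>f y - f x\<bar> \<le> C * (y - x)\<^sup>2"
  shows "DERIV f x :> 0"
  unfolding has_field_derivative_iff
proof (rule Lim_null_comparison)
  show "\<forall>\<^sub>F y in at x. norm ((f y - f x) / (y - x)) \<le> C * \<bar>y - x\<bar>"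
    unfolding eventually_at_filter
  proof (intro always_eventually allI impI)
    fix y assume "y \<noteq> x"
    then show "norm ((f y - f x) / (y - x)) \<le> C * \<bar>y - x\<bar>"
      using assms[of y] by (simp add: divide_le_eq power2_eq_square mult.assoc flip: abs_mult)
  qed
  have "((\<lambda>y. C * \<bar>y - x\<bar>) \<longlongrightarrow> C * \<bar>x - x\<bar>) (at x)" by (intro tendsto_intros)
  then show "((\<lambda>y. C * \<bar>y - x\<bar>) \<longlongrightarrow> 0) (at x)" by simp
qed

text \<open>A family that contains the cut-off profiles and is closed under differentiation, so that its
  members are smooth. The exponential factor makes the extension by $0$ across $1 - x^2 = \delta$
  smooth.\<close>

definition cutoff_family :: "real \<Rightarrow> real \<Rightarrow> real poly \<Rightarrow> real \<Rightarrow> nat \<Rightarrow> nat \<Rightarrow> real \<Rightarrow> real" where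
  "cutoff_family c \<delta> q \<beta> k j x = (if \<delta> < 1 - x\<^sup>2 then
     poly q x * (1 - x\<^sup>2) powr \<beta> / (1 - c * x) ^ k * (exp (- (\<delta> / (1 - x\<^sup>2 - \<delta>))) / (1 - x\<^sup>2 - \<delta>) ^ j) else 0)"

lemma abs_less_1_of_cutoff: "0 < \<delta> \<Longrightarrow> \<delta> \<le> 1 - x\<^sup>2 \<Longrightarrow> \<bar>x::real\<bar> < 1"
  using abs_square_less_1[of x] by linarith

lemma compact_cutoff_support: "0 < \<delta> \<Longrightarrow> compact {x::real. \<delta> \<le> 1 - x\<^sup>2}"
  unfolding compact_eq_bounded_closed
proof
  assume "0 < \<delta>"
  then have "{x. \<delta> \<le> 1 - x\<^sup>2} \<subseteq> {-1..1}" using abs_less_1_of_cutoff by (fastforce simp: abs_less_iff)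
  then show "bounded {x. \<delta> \<le> 1 - x\<^sup>2}" using bounded_closed_interval bounded_subset by blast
  show "closed {x::real. \<delta> \<le> 1 - x\<^sup>2}" by (intro closed_Collect_le continuous_intros)
qed

text \<open>The exponential beats every power of $1 - x^2 - \delta$; the second power is all that the
  derivative at the boundary of the support requires.\<close>

lemma cutoff_family_quadratic:
  assumes c: "\<bar>c\<bar> < 1" and d: "0 < \<delta>"
  obtains C where "0 \<le> C" "\<And>y. \<bar>cutoff_family c \<delta> q \<beta> k j y\<bar> \<le> C * (max 0 (1 - y\<^sup>2 - \<delta>))\<^sup>2"
proof -
  let ?S = "{x::real. \<delta> \<le> 1 - x\<^sup>2}" and ?g = "\<lambda>y. poly q y * (1 - y\<^sup>2) powr \<beta> / (1 - c * y) ^ k"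
  have nz: "1 - c * y \<noteq> 0" "1 - y\<^sup>2 \<noteq> 0" if "y \<in> ?S" for y
  proof -
    have "\<bar>y\<bar> < 1" using abs_less_1_of_cutoff[OF d] that by blast
    then show "1 - c * y \<noteq> 0" using one_plus_pos(2)[OF c, of y] by simp
    show "1 - y\<^sup>2 \<noteq> 0" using that d by auto
  qed
  have "continuous_on ?S ?g" by (intro continuous_intros ballI) (metis nz power_not_zero)+
  then have "bounded (?g ` ?S)"
    using compact_cutoff_support[OF d] compact_continuous_image compact_imp_bounded by blast
  then obtain M where M: "\<And>y. y \<in> ?S \<Longrightarrow> \<bar>?g y\<bar> \<le> M" by (auto simp: bounded_iff)
  define C where "C = \<bar>M\<bar> * (fact (j + 2) / \<delta> ^ (j + 2))"
  show ?thesis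
  proof
    show "0 \<le> C" unfolding C_def using d by simp
    fix y
    show "\<bar>cutoff_family c \<delta> q \<beta> k j y\<bar> \<le> C * (max 0 (1 - y\<^sup>2 - \<delta>))\<^sup>2"
    proof (cases "\<delta> < 1 - y\<^sup>2")
      case True
      define \<tau> where "\<tau> = 1 - y\<^sup>2 - \<delta>"
      have t: "0 < \<tau>" using True by (simp add: \<tau>_def)
      have "(\<delta> / \<tau>) ^ (j + 2) \<le> fact (j + 2) * exp (\<delta> / \<tau>)" using t d by (intro power_le_fact_exp) simp
      have "exp (- (\<delta> / \<tau>)) / \<tau> ^ j \<le> fact (j + 2) / \<delta> ^ (j + 2) * \<tau>\<^sup>2"
      proof -
        have alg: "inverse e / tj \<le> F / p * t2" if "p / (tj * t2) \<le> F * e" "0 < e" "0 < p" "0 < tj" "0 < t2" for e p tj t2 F :: real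
          using that by (simp add: field_simps)
        have "\<delta> ^ (j + 2) / (\<tau> ^ j * \<tau>\<^sup>2) \<le> fact (j + 2) * exp (\<delta> / \<tau>)"
          using \<open>(\<delta> / \<tau>) ^ (j + 2) \<le> fact (j + 2) * exp (\<delta> / \<tau>)\<close> by (simp only: power_divide power_add times_divide_times_eq)
        then show ?thesis unfolding exp_minus by (rule alg) (use d t in auto)
      qed
      moreover have "\<bar>?g y\<bar> \<le> \<bar>M\<bar>" using M[of y] True by simp
      ultimately have "\<bar>?g y\<bar> * (exp (- (\<delta> / \<tau>)) / \<tau> ^ j) \<le> \<bar>M\<bar> * (fact (j + 2) / \<delta> ^ (j + 2) * \<tau>\<^sup>2)"
        using t by (intro mult_mono) auto
      then show ?thesis using True t unfolding cutoff_family_def \<tau>_def[symmetric] C_def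
        by (simp add: abs_mult abs_divide)
    qed (simp add: cutoff_family_def \<open>0 \<le> C\<close>)
  qed
qed

lemma cutoff_family_deriv:
  assumes c: "\<bar>c\<bar> < 1" and d: "0 < \<delta>"
  shows "\<exists>q'. \<forall>x. (cutoff_family c \<delta> q \<beta> k j has_real_derivative cutoff_family c \<delta> q' (\<beta> - 1) (Suc k) (j + 2) x) (at x)"
proof -
  define W L \<T> :: "real poly" where "W = [:1, 0, -1:]" and "L = [:1, -c:]" and "\<T> = [:1 - \<delta>, 0, -1:]"
  define D :: "real poly" where "D = [:0, -2:]"
  define q' where "q' = pderiv q * W * L * \<T>\<^sup>2 + smult \<beta> (q * D * L * \<T>\<^sup>2) + smult \<delta> (q * W * L * D)
     + smult (real k * c) (q * W * \<T>\<^sup>2) - smult (real j) (q * W * L * \<T> * D)"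
  have ev: "poly W x = 1 - x\<^sup>2" "poly L x = 1 - c * x" "poly \<T> x = 1 - x\<^sup>2 - \<delta>" "poly D x = - 2 * x" for x
    by (simp_all add: W_def L_def \<T>_def D_def power2_eq_square)
  show ?thesis
  proof (intro exI[of _ q'] allI)
    fix x
    consider "\<delta> < 1 - x\<^sup>2" | "1 - x\<^sup>2 < \<delta>" | "1 - x\<^sup>2 = \<delta>" by linarith
    then show "(cutoff_family c \<delta> q \<beta> k j has_real_derivative cutoff_family c \<delta> q' (\<beta> - 1) (Suc k) (j + 2) x) (at x)"
    proof cases
      case 1
      define w l t where "w = 1 - x\<^sup>2" and "l = 1 - c * x" and "t = 1 - x\<^sup>2 - \<delta>"
      have w: "0 < w" and t: "0 < t" using 1 d by (auto simp: w_def t_def)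
      have l: "0 < l" using abs_less_1_of_cutoff[OF d, of x] 1 one_plus_pos(2)[OF c, of x] by (simp add: l_def)
      let ?f = "\<lambda>x. poly q x * (1 - x\<^sup>2) powr \<beta> / (1 - c * x) ^ k * (exp (- (\<delta> / (1 - x\<^sup>2 - \<delta>))) / (1 - x\<^sup>2 - \<delta>) ^ j)"
      have dw: "((\<lambda>x. (1 - x\<^sup>2) powr \<beta>) has_real_derivative \<beta> * w powr (\<beta> - 1) * (- 2 * x)) (at x)"
        using w unfolding w_def by (auto intro!: derivative_eq_intros)
      have dl: "((\<lambda>x. inverse ((1 - c * x) ^ k)) has_real_derivative real k * c / l ^ Suc k) (at x)"
      proof -
        have "((\<lambda>x. inverse ((1 - c * x) ^ k)) has_real_derivative - (inverse (l ^ k) * (real k * (l ^ (k - 1) * - c)) * inverse (l ^ k))) (at x)"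
          using l unfolding l_def by (auto intro!: derivative_eq_intros)
        moreover have "- (inverse (l ^ k) * (real k * (l ^ (k - 1) * - c)) * inverse (l ^ k)) = real k * c / l ^ Suc k"
          using l by (cases k) (auto simp: field_simps)
        ultimately show ?thesis by simp
      qed
      have dt: "((\<lambda>x. inverse ((1 - x\<^sup>2 - \<delta>) ^ j)) has_real_derivative real j * (2 * x) / t ^ Suc j) (at x)"
      proof -
        have "((\<lambda>x. inverse ((1 - x\<^sup>2 - \<delta>) ^ j)) has_real_derivative - (inverse (t ^ j) * (real j * (t ^ (j - 1) * (- 2 * x))) * inverse (t ^ j))) (at x)"
          using t unfolding t_def by (auto intro!: derivative_eq_intros)
        moreover have "- (inverse (t ^ j) * (real j * (t ^ (j - 1) * (- 2 * x))) * inverse (t ^ j)) = real j * (2 * x) / t ^ Suc j"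
          using t by (cases j) (auto simp: field_simps)
        ultimately show ?thesis by simp
      qed
      have de: "((\<lambda>x. exp (- (\<delta> / (1 - x\<^sup>2 - \<delta>)))) has_real_derivative exp (- (\<delta> / t)) * (\<delta> * (- 2 * x) / t\<^sup>2)) (at x)"
        using t unfolding t_def by (auto intro!: derivative_eq_intros simp: power2_eq_square field_simps)
      have tw: "w - \<delta> = t" by (simp add: w_def t_def)
      define E P where "E = exp (- (\<delta> / t))" and "P = w powr (\<beta> - 1)"
      have wP: "w powr \<beta> = w * P" using w powr_add[of w "\<beta> - 1" 1] by (simp add: P_def)
      have "(?f has_real_derivative
         (poly (pderiv q) x * (w * P) + poly q x * (\<beta> * P * (- 2 * x))) / l ^ k * (E / t ^ j)
         + poly q x * (w * P) * (real k * c / l ^ Suc k) * (E / t ^ j)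
         + poly q x * (w * P) / l ^ k * (E * (\<delta> * (- 2 * x) / t\<^sup>2) / t ^ j + E * (real j * (2 * x) / t ^ Suc j))) (at x)"
      proof -
        have "((\<lambda>x. poly q x * (1 - x\<^sup>2) powr \<beta>) has_real_derivative
            poly (pderiv q) x * (w * P) + poly q x * (\<beta> * P * (- 2 * x))) (at x)"
          using DERIV_mult[OF poly_DERIV[of q x] dw] unfolding P_def[symmetric] w_def[symmetric] wP by (simp only: mult.commute)
        from DERIV_mult[OF this dl]
        have 1: "((\<lambda>x. poly q x * (1 - x\<^sup>2) powr \<beta> / (1 - c * x) ^ k) has_real_derivative
            (poly (pderiv q) x * (w * P) + poly q x * (\<beta> * P * (- 2 * x))) / l ^ k
            + poly q x * (w * P) * (real k * c / l ^ Suc k)) (at x)"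
          unfolding w_def[symmetric] l_def[symmetric] wP divide_inverse[symmetric] by (simp add: mult.commute)
        from DERIV_mult[OF de dt]
        have 2: "((\<lambda>x. exp (- (\<delta> / (1 - x\<^sup>2 - \<delta>))) / (1 - x\<^sup>2 - \<delta>) ^ j) has_real_derivative
            E * (\<delta> * (- 2 * x) / t\<^sup>2) / t ^ j + E * (real j * (2 * x) / t ^ Suc j)) (at x)"
          unfolding t_def[symmetric] E_def[symmetric] divide_inverse[symmetric] by (simp add: mult.commute)
        show ?thesis
          by (rule DERIV_cong[OF DERIV_mult[OF 1 2]])
             (simp only: w_def[symmetric] l_def[symmetric] tw E_def[symmetric] wP distrib_right distrib_left mult_ac add_ac times_divide_eq_right times_divide_eq_left)
      qed
      also have "(poly (pderiv q) x * (w * P) + poly q x * (\<beta> * P * (- 2 * x))) / l ^ k * (E / t ^ j)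
         + poly q x * (w * P) * (real k * c / l ^ Suc k) * (E / t ^ j)
         + poly q x * (w * P) / l ^ k * (E * (\<delta> * (- 2 * x) / t\<^sup>2) / t ^ j + E * (real j * (2 * x) / t ^ Suc j))
         = poly q' x * P / l ^ Suc k * (E / t ^ (j + 2))"
      proof -
        have alg: "(dq * (w * P) + q0 * (\<beta> * P * (- 2 * x))) / lk * (E / tj)
         + q0 * (w * P) * (real k * c / (l * lk)) * (E / tj)
         + q0 * (w * P) / lk * (E * (\<delta> * (- 2 * x) / t\<^sup>2) / tj + E * (real j * (2 * x) / (t * tj)))
         = (dq * w * l * t\<^sup>2 + \<beta> * (q0 * (- 2 * x) * l * t\<^sup>2) + \<delta> * (q0 * w * l * (- 2 * x))
            + real k * c * (q0 * w * t\<^sup>2) - real j * (q0 * w * l * t * (- 2 * x))) * P / (l * lk) * (E / (tj * t\<^sup>2))"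
          if "lk \<noteq> 0" "tj \<noteq> 0" for dq q0 lk tj :: real
          using that l t by (simp add: field_simps power2_eq_square)
        have q'x: "poly q' x = poly (pderiv q) x * w * l * t\<^sup>2 + \<beta> * (poly q x * (- 2 * x) * l * t\<^sup>2)
            + \<delta> * (poly q x * w * l * (- 2 * x)) + real k * c * (poly q x * w * t\<^sup>2)
            - real j * (poly q x * w * l * t * (- 2 * x))"
          unfolding q'_def by (simp add: ev w_def l_def t_def)
        show ?thesis unfolding q'x power_Suc power_add using l t by (intro alg) auto
      qed
      also have "\<dots> = cutoff_family c \<delta> q' (\<beta> - 1) (Suc k) (j + 2) x"
        using 1 by (simp add: cutoff_family_def w_def l_def t_def P_def E_def)
      finally have "(?f has_real_derivative cutoff_family c \<delta> q' (\<beta> - 1) (Suc k) (j + 2) x) (at x)" .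
      moreover have "open {x::real. \<delta> < 1 - x\<^sup>2}" by (intro open_Collect_less continuous_intros)
      ultimately show ?thesis using 1
        by (elim has_field_derivative_transform_within_open) (auto simp: cutoff_family_def)
    next
      case 2
      have "((\<lambda>_. 0::real) has_real_derivative cutoff_family c \<delta> q' (\<beta> - 1) (Suc k) (j + 2) x) (at x)"
        using 2 by (simp add: cutoff_family_def)
      moreover have "open {x::real. 1 - x\<^sup>2 < \<delta>}" by (intro open_Collect_less continuous_intros)
      ultimately show ?thesis using 2
        by (elim has_field_derivative_transform_within_open) (auto simp: cutoff_family_def)
    next
      case 3
      obtain C where C: "0 \<le> C" "\<And>y. \<bar>cutoff_family c \<delta> q \<beta> k j y\<bar> \<le> C * (max 0 (1 - y\<^sup>2 - \<delta>))\<^sup>2"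
        using cutoff_family_quadratic[OF c d] by blast
      have "(cutoff_family c \<delta> q \<beta> k j has_real_derivative 0) (at x)"
      proof (rule DERIV_zero_quadratic)
        fix y
        have "max 0 (1 - y\<^sup>2 - \<delta>) \<le> 2 * \<bar>y - x\<bar>"
        proof (cases "\<delta> \<le> 1 - y\<^sup>2")
          case True
          have "\<bar>x\<bar> < 1" "\<bar>y\<bar> < 1" using abs_less_1_of_cutoff[OF d] 3 True by auto
          have "1 - y\<^sup>2 - \<delta> = (x - y) * (x + y)" using 3 by (simp add: power2_eq_square algebra_simps)
          also have "\<dots> \<le> \<bar>x - y\<bar> * \<bar>x + y\<bar>" by (simp flip: abs_mult)
          also have "\<dots> \<le> \<bar>x - y\<bar> * 2" using \<open>\<bar>x\<bar> < 1\<close> \<open>\<bar>y\<bar> < 1\<close> by (intro mult_left_mono) auto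
          finally show ?thesis by (simp add: abs_minus_commute)
        qed auto
        then have "(max 0 (1 - y\<^sup>2 - \<delta>))\<^sup>2 \<le> (2 * \<bar>y - x\<bar>)\<^sup>2" by (intro power_mono) auto
        then have "C * (max 0 (1 - y\<^sup>2 - \<delta>))\<^sup>2 \<le> C * (4 * (y - x)\<^sup>2)" using C(1) by (intro mult_left_mono) (auto simp: power_mult_distrib)
        moreover have "cutoff_family c \<delta> q \<beta> k j x = 0" using 3 by (simp add: cutoff_family_def)
        ultimately show "\<bar>cutoff_family c \<delta> q \<beta> k j y - cutoff_family c \<delta> q \<beta> k j x\<bar> \<le> C * 4 * (y - x)\<^sup>2"
          using C(2)[of y] by simp
      qed
      then show ?thesis using 3 by (simp add: cutoff_family_def)
    qed
  qed
qed

lemma cutoff_family_test_function: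
  assumes c: "\<bar>c\<bar> < 1" and d: "0 < \<delta>"
  shows "cutoff_family c \<delta> q \<beta> k j \<in> test_functions (-1) 1"
proof -
  let ?v = "cutoff_family c \<delta> q \<beta> k j"
  have iter: "\<exists>q' \<beta>' k' j'. (deriv ^^ n) ?v = cutoff_family c \<delta> q' \<beta>' k' j'" for n
  proof (induction n)
    case 0
    show ?case by auto
  next
    case (Suc n)
    then obtain q' \<beta>' k' j' where e: "(deriv ^^ n) ?v = cutoff_family c \<delta> q' \<beta>' k' j'" by blast
    obtain q'' where "\<forall>x. (cutoff_family c \<delta> q' \<beta>' k' j' has_real_derivative cutoff_family c \<delta> q'' (\<beta>' - 1) (Suc k') (j' + 2) x) (at x)"
      using cutoff_family_deriv[OF c d] by blast
    then have "deriv (cutoff_family c \<delta> q' \<beta>' k' j') = cutoff_family c \<delta> q'' (\<beta>' - 1) (Suc k') (j' + 2)"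
      by (intro ext DERIV_imp_deriv) auto
    then show ?case using e by auto
  qed
  have "(deriv ^^ n) ?v field_differentiable at x" for n x
    using iter[of n] cutoff_family_deriv[OF c d] unfolding field_differentiable_def by metis
  moreover have cl: "closure {x. ?v x \<noteq> 0} \<subseteq> {x. \<delta> \<le> 1 - x\<^sup>2}"
    by (rule closure_minimal) (auto simp: cutoff_family_def compact_cutoff_support[OF d] compact_imp_closed split: if_splits)
  moreover have "{x. \<delta> \<le> 1 - x\<^sup>2} \<subseteq> {-1<..<1}" using abs_less_1_of_cutoff[OF d] by (force simp: abs_less_iff)
  moreover have "compact (closure {x. ?v x \<noteq> 0})"
    using compact_cutoff_support[OF d] cl closed_closure compact_eq_bounded_closed bounded_subset by metis
  ultimately show ?thesis unfolding test_functions_def by blast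
qed

section \<open>Uniform Hoelder bounds for the cut-off profiles\<close>

text \<open>The weight $1 - x^2$ on $(-1,1)$, extended by $0$.\<close>

definition wplus :: "real \<Rightarrow> real" where "wplus x = max 0 (1 - x\<^sup>2)"

text \<open>A smooth cutoff in the variable $t = 1 - x^2$, which tends to $1$ on $t > 0$ as
  $\delta \to 0$.\<close>

definition cutoff :: "real \<Rightarrow> real \<Rightarrow> real" where
  "cutoff \<delta> t = (if \<delta> < t then exp (- (\<delta> / (t - \<delta>))) else 0)"

text \<open>The test functions that approximate the profile.\<close>

definition cut_profile :: "real \<Rightarrow> real \<Rightarrow> real \<Rightarrow> real \<Rightarrow> real" where
  "cut_profile s c \<delta> x = profile s c x * cutoff \<delta> (1 - x\<^sup>2)"

lemma cut_profile_test_function: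
  assumes "\<bar>c\<bar> < 1" and d: "0 < \<delta>"
  shows "cut_profile s c \<delta> \<in> test_functions (-1) 1"
proof -
  have "cut_profile s c \<delta> = cutoff_family c \<delta> 1 s 1 0"
    using abs_less_1_of_cutoff[OF d] by (auto simp: fun_eq_iff cut_profile_def cutoff_family_def profile_def cutoff_def)
  then show ?thesis using cutoff_family_test_function[OF assms] by simp
qed

lemma cutoff_nonneg: "0 \<le> cutoff \<delta> t" by (simp add: cutoff_def)

lemma cutoff_le_1: "0 < \<delta> \<Longrightarrow> cutoff \<delta> t \<le> 1" by (simp add: cutoff_def)

lemma cutoff_measurable [measurable]: "cutoff \<delta> \<in> borel_measurable borel"
  unfolding cutoff_def by measurable

lemma cutoff_mono:
  assumes "0 < \<delta>" "t' \<le> t" shows "cutoff \<delta> t' \<le> cutoff \<delta> t"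
  using assms unfolding cutoff_def by (auto intro!: divide_left_mono)

lemma cutoff_tendsto_1:
  assumes "0 < t"
  shows "((\<lambda>\<delta>. cutoff \<delta> t) \<longlongrightarrow> 1) (at_right 0)"
proof -
  have "((\<lambda>\<delta>. exp (- (\<delta> / (t - \<delta>)))) \<longlongrightarrow> exp (- (0 / (t - 0)))) (at_right 0)"
    using assms by (intro tendsto_intros) auto
  moreover have "\<forall>\<^sub>F \<delta> in at_right 0. exp (- (\<delta> / (t - \<delta>))) = cutoff \<delta> t"
    using eventually_at_right_less[of 0] order_tendstoD(2)[OF tendsto_ident_at assms]
    by eventually_elim (simp add: cutoff_def)
  ultimately show ?thesis by (simp add: Lim_transform_eventually)
qed

text \<open>The bound does not depend on $\delta$, since $t \chi'(t)$ is bounded uniformly in $\delta$ for the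
  cutoff $\chi$.\<close>

lemma cutoff_diff:
  assumes d: "0 < \<delta>" and t: "0 < t'" "t' \<le> t"
  shows "cutoff \<delta> t - cutoff \<delta> t' \<le> 2 * (t - t') / t'"
proof (cases "t' \<le> \<delta>")
  case True
  then have z: "cutoff \<delta> t' = 0" by (simp add: cutoff_def)
  show ?thesis
  proof (cases "\<delta> < t")
    case False
    then show ?thesis using z t by (simp add: cutoff_def)
  next
    case 2: True
    define r where "r = \<delta> / (t - \<delta>)"
    have r: "0 < r" using 2 d by (simp add: r_def)
    have "r * exp (- r) \<le> 1" 
    proof -
      have "r \<le> exp r" using exp_ge_add_one_self[of r] by linarith
      then show ?thesis by (simp add: exp_minus field_simps)
    qed
    then have "exp (- r) \<le> 1 / r" using r by (simp add: field_simps)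
    then have "cutoff \<delta> t \<le> (t - \<delta>) / \<delta>" using 2 by (simp add: cutoff_def r_def)
    also have "\<dots> \<le> (t - t') / t'" using True t d 2 by (intro frac_le) auto
    also have "\<dots> \<le> 2 * (t - t') / t'" using t by (intro divide_right_mono) auto
    finally show ?thesis using z by simp
  qed
next
  case False
  show ?thesis
  proof (cases "t = t'")
    case True then show ?thesis by simp
  next
    case ne: False
    then have lt: "t' < t" using t by simp
    let ?f = "\<lambda>t. exp (- (\<delta> / (t - \<delta>)))"
    have "\<exists>\<xi>. t' < \<xi> \<and> \<xi> < t \<and> ?f t - ?f t' = (t - t') * (exp (- (\<delta> / (\<xi> - \<delta>))) * (\<delta> / (\<xi> - \<delta>)\<^sup>2))"
    proof (rule MVT2[OF lt])
      fix x assume "t' \<le> x"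
      then have "\<delta> < x" using False by simp
      then show "(?f has_real_derivative exp (- (\<delta> / (x - \<delta>))) * (\<delta> / (x - \<delta>)\<^sup>2)) (at x)"
        by (auto intro!: derivative_eq_intros simp: power2_eq_square)
    qed
    then obtain \<xi> where xi: "t' < \<xi>" "\<xi> < t"
      and eq: "?f t - ?f t' = (t - t') * (exp (- (\<delta> / (\<xi> - \<delta>))) * (\<delta> / (\<xi> - \<delta>)\<^sup>2))" by blast
    define r where "r = \<delta> / (\<xi> - \<delta>)"
    have r: "0 < r" using xi False d by (simp add: r_def)
    have "\<xi> * (\<delta> / (\<xi> - \<delta>)\<^sup>2) = r + r\<^sup>2"
      using xi False d by (simp add: r_def power2_eq_square divide_simps) (simp add: algebra_simps)
    moreover have "(r + r\<^sup>2) * exp (- r) \<le> 2"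
    proof -
      have "1 + r + r\<^sup>2 / 2 \<le> exp r" by (rule exp_lower_Taylor_quadratic) (use r in simp)
      then have "r + r\<^sup>2 \<le> 2 * exp r" using r by (simp add: power2_eq_square)
      then show ?thesis by (simp add: exp_minus field_simps)
    qed
    ultimately have "(\<xi> * (\<delta> / (\<xi> - \<delta>)\<^sup>2)) * exp (- r) \<le> 2" by (simp only:)
    then have "\<xi> * (exp (- r) * (\<delta> / (\<xi> - \<delta>)\<^sup>2)) \<le> 2" by (simp only: mult_ac)
    then have "exp (- r) * (\<delta> / (\<xi> - \<delta>)\<^sup>2) \<le> 2 / \<xi>" using xi t by (simp add: field_simps)
    also have "\<dots> \<le> 2 / t'" using xi t by (intro divide_left_mono) auto
    finally have "(t - t') * (exp (- r) * (\<delta> / (\<xi> - \<delta>)\<^sup>2)) \<le> (t - t') * (2 / t')"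
      using lt by (intro mult_left_mono) auto
    then show ?thesis using eq False lt by (simp add: cutoff_def r_def mult_ac)
  qed
qed

lemma powr_mult_cutoff_diff:
  assumes s: "0 < s" "s < \<theta>" "\<theta> \<le> 1" and d: "0 < \<delta>" and t: "0 < t" "0 \<le> t'" "t' \<le> t"
  shows "\<bar>t powr s * cutoff \<delta> t - t' powr s * cutoff \<delta> t'\<bar> \<le> 5 * (t - t') powr \<theta> * t powr (s - \<theta>)"
proof -
  define r where "r = (t - t') / t"
  have r: "0 \<le> r" "r \<le> 1" using t by (auto simp: r_def)
  have rt: "r \<le> r powr \<theta>"
    using r s powr_mono'[of \<theta> 1 r] by (cases "r = 0") auto
  have t's: "t' powr s \<le> t powr s" using t s by (intro powr_mono2) auto
  have a: "t powr s - t' powr s \<le> t powr s * r"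
  proof -
    define q where "q = t' / t"
    have q: "0 \<le> q" "q \<le> 1" using t by (auto simp: q_def)
    have "q \<le> q powr s" using q s powr_mono'[of s 1 q] by (cases "q = 0") auto
    moreover have "t' powr s = t powr s * q powr s" unfolding q_def using t by (simp add: powr_divide)
    ultimately have "t powr s * q \<le> t' powr s" using t by simp
    moreover have "r = 1 - q" using t by (simp add: r_def q_def field_simps)
    ultimately show ?thesis by (simp only:) (simp add: algebra_simps)
  qed
  have b: "t' powr s * (cutoff \<delta> t - cutoff \<delta> t') \<le> 4 * (t powr s * r)"
  proof (cases "t' < t / 2")
    case True
    then have "1 / 2 \<le> r" using t by (simp add: r_def field_simps)
    have "t' powr s * (cutoff \<delta> t - cutoff \<delta> t') \<le> t powr s * 1"
      using t's cutoff_nonneg[of \<delta> t'] cutoff_le_1[OF d, of t] cutoff_mono[OF d t(3)] by (intro mult_mono) auto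
    also have "\<dots> \<le> t powr s * (4 * r)" using \<open>1 / 2 \<le> r\<close> by (intro mult_left_mono) auto
    finally show ?thesis by (simp add: mult_ac)
  next
    case False
    then have t': "0 < t'" using t by simp
    have "t' powr s * (cutoff \<delta> t - cutoff \<delta> t') \<le> t powr s * (2 * (t - t') / t')"
      using t's cutoff_diff[OF d t' t(3)] cutoff_mono[OF d t(3)] by (intro mult_mono) auto
    also have "\<dots> \<le> t powr s * (2 * (t - t') / (t / 2))"
      using False t t' by (intro mult_left_mono divide_left_mono) auto
    also have "\<dots> = 4 * (t powr s * r)" by (simp add: r_def)
    finally show ?thesis .
  qed
  have "t' powr s * cutoff \<delta> t' \<le> t powr s * cutoff \<delta> t"
    using t's cutoff_mono[OF d t(3)] cutoff_nonneg by (intro mult_mono) auto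
  then have "\<bar>t powr s * cutoff \<delta> t - t' powr s * cutoff \<delta> t'\<bar>
     = (t powr s - t' powr s) * cutoff \<delta> t + t' powr s * (cutoff \<delta> t - cutoff \<delta> t')"
    by (simp add: algebra_simps)
  also have "\<dots> \<le> t powr s * r + 4 * (t powr s * r)"
  proof (intro add_mono b)
    have "(t powr s - t' powr s) * cutoff \<delta> t \<le> (t powr s - t' powr s) * 1"
      using t's cutoff_le_1[OF d] by (intro mult_left_mono) auto
    then show "(t powr s - t' powr s) * cutoff \<delta> t \<le> t powr s * r" using a by simp
  qed
  also have "\<dots> = 5 * (t powr s * r)" by simp
  also have "\<dots> \<le> 5 * (t powr s * r powr \<theta>)" using rt by (intro mult_left_mono) auto
  also have "r powr \<theta> = (t - t') powr \<theta> / t powr \<theta>" unfolding r_def using t by (simp add: powr_divide)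
  finally show ?thesis using t by (simp add: powr_diff mult_ac)
qed

text \<open>The boundary weight $(1-x^2)^{-\gamma}$ on $(-1,1)$, extended by $0$.\<close>

definition bweight :: "real \<Rightarrow> real \<Rightarrow> real" where
  "bweight \<gamma> x = (if \<bar>x\<bar> < 1 then (1 - x\<^sup>2) powr (- \<gamma>) else 0)"

lemma bweight_nonneg: "0 \<le> bweight \<gamma> x" by (simp add: bweight_def)

lemma bweight_measurable [measurable]: "bweight \<gamma> \<in> borel_measurable borel"
  unfolding bweight_def by measurable

lemma bweight_ge_1: "\<bar>x\<bar> < 1 \<Longrightarrow> 0 \<le> \<gamma> \<Longrightarrow> 1 \<le> bweight \<gamma> x"
proof -
  assume x: "\<bar>x\<bar> < 1" and g: "0 \<le> \<gamma>"
  have p: "0 < 1 - x\<^sup>2" using x by (simp add: abs_square_less_1)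
  then have "(1 - x\<^sup>2) powr \<gamma> \<le> 1" using g by (intro powr_le1) auto
  then show ?thesis using x p by (simp add: bweight_def powr_minus_divide le_divide_eq)
qed

lemma cut_profile_measurable [measurable]: "cut_profile s c \<delta> \<in> borel_measurable borel"
  unfolding cut_profile_def by measurable

text \<open>The constant does not depend on $\delta$, so that the right-hand side serves as a majorant in the
  limit $\delta \to 0$. The exponent $\theta$ exceeds $s$ to make the right-hand side square integrable
  against the kernel near the diagonal, at the price of a boundary weight.\<close>

lemma cut_profile_Hoelder:
  assumes s: "0 < s" "s < \<theta>" "\<theta> \<le> 1" and c: "\<bar>c\<bar> < 1" and d: "0 < \<delta>"
  defines "b \<equiv> 1 / (1 - \<bar>c\<bar>)"
  shows "\<bar>cut_profile s c \<delta> x - cut_profile s c \<delta> y\<bar>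
    \<le> (b\<^sup>2 + 10 * b) * min 1 (\<bar>x - y\<bar> powr \<theta>) * (bweight (\<theta> - s) x + bweight (\<theta> - s) y)"
proof -
  let ?v = "cut_profile s c \<delta>" and ?h = "bweight (\<theta> - s)" and ?m = "min 1 (\<bar>x - y\<bar> powr \<theta>)"
  have b1: "1 \<le> b" using c by (simp add: b_def)
  have q: "0 < 1 - c * x" "1 / (1 - c * x) \<le> b" if "\<bar>x\<bar> < 1" for x
  proof -
    have "\<bar>c * x\<bar> \<le> \<bar>c\<bar>" using that by (simp add: abs_mult mult_left_le)
    then have "1 - \<bar>c\<bar> \<le> 1 - c * x" by linarith
    then show "0 < 1 - c * x" "1 / (1 - c * x) \<le> b" using c by (auto simp: b_def intro!: divide_left_mono)
  qed
  have vb: "0 \<le> ?v x" "?v x \<le> b" for x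
  proof -
    have p: "0 \<le> profile s c x" by (rule profile_nonneg[OF c])
    then show "0 \<le> ?v x" using cutoff_nonneg by (simp add: cut_profile_def)
    have "profile s c x \<le> b"
    proof (cases "\<bar>x\<bar> < 1")
      case True
      have "(1 - x\<^sup>2) powr s \<le> 1" using True s by (intro powr_le1) (auto simp: abs_square_le_1)
      then have "(1 - x\<^sup>2) powr s / (1 - c * x) \<le> 1 / (1 - c * x)" using q(1)[OF True] by (simp add: divide_right_mono)
      then show ?thesis using q(2)[OF True] True by (simp add: profile_def)
    qed (use b1 in \<open>simp add: profile_def\<close>)
    then have "profile s c x * cutoff \<delta> (1 - x\<^sup>2) \<le> b * 1"
      using p b1 cutoff_nonneg cutoff_le_1[OF d] by (intro mult_mono) auto
    then show "?v x \<le> b" by (simp add: cut_profile_def)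
  qed
  have main: "\<bar>?v x - ?v y\<bar> \<le> (b\<^sup>2 + 10 * b) * min 1 (\<bar>x - y\<bar> powr \<theta>) * ?h x"
    if x: "\<bar>x\<bar> < 1" and le: "wplus y \<le> wplus x" for x y
  proof -
    define t t' D where "t = wplus x" and "t' = wplus y" and "D = \<bar>x - y\<bar>"
    have t: "t = 1 - x\<^sup>2" "0 < t" "t \<le> 1" using x by (auto simp: t_def wplus_def abs_square_less_1 abs_square_le_1)
    have t': "0 \<le> t'" "t' \<le> t" "t' \<le> 1" using le by (auto simp: t'_def t_def wplus_def)
    have h1: "1 \<le> ?h x" by (rule bweight_ge_1) (use x s in auto)
    have hx: "?h x = t powr (s - \<theta>)" using x by (simp add: bweight_def t(1))
    show ?thesis
    proof (cases "D \<le> 1")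
      case False
      have "\<bar>?v x - ?v y\<bar> \<le> b" using vb[of x] vb[of y] by (simp add: abs_le_iff)
      also have "\<dots> \<le> b\<^sup>2 + 10 * b" using b1 by simp
      also have "\<dots> \<le> (b\<^sup>2 + 10 * b) * ?h x" using mult_left_mono[OF h1, of "b\<^sup>2 + 10 * b"] b1 by simp
      also have "\<dots> = (b\<^sup>2 + 10 * b) * min 1 (D powr \<theta>) * ?h x"
        using False s ge_one_powr_ge_zero[of D \<theta>] by simp
      finally show ?thesis by (simp add: D_def)
    next
      case True
      have Dm: "min 1 (D powr \<theta>) = D powr \<theta>" using True s by (simp add: D_def powr_le1 min_absorb2)
      have DD: "D \<le> D powr \<theta>" using True s powr_mono'[of \<theta> 1 D] by (cases "D = 0") (auto simp: D_def)
      have tD: "t - t' \<le> 2 * D"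
      proof (cases "\<bar>y\<bar> < 1")
        case yl: True
        then have "t' = 1 - y\<^sup>2" by (simp add: t'_def wplus_def abs_square_le_1)
        then have "t - t' = (y - x) * (x + y)" by (simp add: t(1) power2_eq_square algebra_simps)
        also have "\<dots> \<le> \<bar>y - x\<bar> * \<bar>x + y\<bar>" by (simp flip: abs_mult)
        also have "\<dots> \<le> \<bar>y - x\<bar> * 2" using x yl by (intro mult_left_mono) auto
        finally show ?thesis by (simp add: D_def abs_minus_commute)
      next
        case False
        then have "t' = 0" using abs_square_less_1[of y] by (simp add: t'_def wplus_def)
        moreover have "t = (1 - \<bar>x\<bar>) * (1 + \<bar>x\<bar>)" by (simp add: t(1) algebra_simps flip: power2_eq_square)
        moreover have "(1 - \<bar>x\<bar>) * (1 + \<bar>x\<bar>) \<le> D * 2"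
          using False x by (intro mult_mono) (auto simp: D_def)
        ultimately show ?thesis by simp
      qed
      have psi: "\<bar>t powr s * cutoff \<delta> t - t' powr s * cutoff \<delta> t'\<bar> \<le> 10 * D powr \<theta> * ?h x"
      proof -
        have "(t - t') powr \<theta> \<le> (2 * D) powr \<theta>" using tD t' s by (intro powr_mono2) auto
        also have "\<dots> = 2 powr \<theta> * D powr \<theta>" by (rule powr_mult)
        also have "\<dots> \<le> 2 * D powr \<theta>" using s powr_mono[of \<theta> 1 2] by (intro mult_right_mono) auto
        finally have "5 * (t - t') powr \<theta> * t powr (s - \<theta>) \<le> 5 * (2 * D powr \<theta>) * t powr (s - \<theta>)"
          by (intro mult_right_mono mult_left_mono) auto
        also have "\<dots> = 10 * D powr \<theta> * t powr (s - \<theta>)" by simp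
        finally show ?thesis using powr_mult_cutoff_diff[OF s d t(2) t'(1,2)] unfolding hx by linarith
      qed
      have vx: "?v x = 1 / (1 - c * x) * (t powr s * cutoff \<delta> t)"
        using x by (simp add: cut_profile_def profile_def t(1))
      have "\<bar>?v x - ?v y\<bar> \<le> b\<^sup>2 * D + b * \<bar>t powr s * cutoff \<delta> t - t' powr s * cutoff \<delta> t'\<bar>"
      proof (cases "\<bar>y\<bar> < 1")
        case y: True
        then have vy: "?v y = 1 / (1 - c * y) * (t' powr s * cutoff \<delta> t')"
          by (simp add: cut_profile_def profile_def t'_def wplus_def abs_square_le_1 max_absorb2)
        have "?v x - ?v y = (1 / (1 - c * x) - 1 / (1 - c * y)) * (t' powr s * cutoff \<delta> t')
           + 1 / (1 - c * x) * (t powr s * cutoff \<delta> t - t' powr s * cutoff \<delta> t')"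
          unfolding vx vy by (simp add: algebra_simps)
        also have "\<bar>\<dots>\<bar> \<le> \<bar>1 / (1 - c * x) - 1 / (1 - c * y)\<bar> * \<bar>t' powr s * cutoff \<delta> t'\<bar>
           + \<bar>1 / (1 - c * x)\<bar> * \<bar>t powr s * cutoff \<delta> t - t' powr s * cutoff \<delta> t'\<bar>"
          unfolding abs_mult[symmetric] by (rule abs_triangle_ineq)
        also have "\<dots> \<le> b\<^sup>2 * D * 1 + b * \<bar>t powr s * cutoff \<delta> t - t' powr s * cutoff \<delta> t'\<bar>"
        proof (intro add_mono mult_mono)
          have "1 / (1 - c * x) - 1 / (1 - c * y) = (c * (x - y)) * (1 / (1 - c * x) * (1 / (1 - c * y)))"
            using q(1)[OF x] q(1)[OF y] by (simp add: field_simps)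
          also have "\<bar>\<dots>\<bar> = (\<bar>c\<bar> * D) * (1 / (1 - c * x) * (1 / (1 - c * y)))"
            using q(1)[OF x] q(1)[OF y] by (simp add: abs_mult D_def)
          also have "\<dots> \<le> (1 * D) * (b * b)"
            using q[OF x] q[OF y] c b1 by (intro mult_mono) (auto simp: D_def)
          finally show "\<bar>1 / (1 - c * x) - 1 / (1 - c * y)\<bar> \<le> b\<^sup>2 * D" by (simp add: power2_eq_square mult_ac)
          have "t' powr s * cutoff \<delta> t' \<le> 1 * 1"
            using t' s cutoff_le_1[OF d] cutoff_nonneg by (intro mult_mono powr_le1) auto
          then show "\<bar>t' powr s * cutoff \<delta> t'\<bar> \<le> 1" using cutoff_nonneg by simp
          show "\<bar>1 / (1 - c * x)\<bar> \<le> b" using q[OF x] by simp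
        qed (use b1 in \<open>auto simp: D_def\<close>)
        finally show ?thesis by simp
      next
        case False
        then have "?v y = 0" by (simp add: cut_profile_def profile_def)
        moreover have "t' = 0" using False abs_square_less_1[of y] by (simp add: t'_def wplus_def)
        ultimately have "\<bar>?v x - ?v y\<bar> = 1 / (1 - c * x) * \<bar>t powr s * cutoff \<delta> t - t' powr s * cutoff \<delta> t'\<bar>"
          unfolding vx using q(1)[OF x] cutoff_nonneg[of \<delta> t] s by (simp add: abs_mult)
        also have "\<dots> \<le> b * \<bar>t powr s * cutoff \<delta> t - t' powr s * cutoff \<delta> t'\<bar>"
          using q(2)[OF x] by (intro mult_right_mono) auto
        finally show ?thesis by (simp add: D_def add_increasing)
      qed
      also have "\<dots> \<le> b\<^sup>2 * (D powr \<theta> * ?h x) + b * (10 * D powr \<theta> * ?h x)"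
      proof (intro add_mono mult_left_mono psi)
        have "D powr \<theta> * 1 \<le> D powr \<theta> * ?h x" using h1 by (intro mult_left_mono) auto
        then show "D \<le> D powr \<theta> * ?h x" using DD by simp
      qed (use b1 in auto)
      also have "\<dots> = (b\<^sup>2 + 10 * b) * min 1 (D powr \<theta>) * ?h x" unfolding Dm by (simp add: algebra_simps)
      finally show ?thesis by (simp add: D_def)
    qed
  qed
  have pos: "0 \<le> (b\<^sup>2 + 10 * b) * ?m" using b1 by simp
  have ext: "(b\<^sup>2 + 10 * b) * ?m * z \<le> (b\<^sup>2 + 10 * b) * ?m * (?h x + ?h y)" if "z = ?h x \<or> z = ?h y" for z
    using that pos bweight_nonneg[of "\<theta> - s"] by (intro mult_left_mono) auto
  consider "wplus y \<le> wplus x" "\<bar>x\<bar> < 1" | "wplus x \<le> wplus y" "\<bar>y\<bar> < 1" | "\<not> \<bar>x\<bar> < 1" "\<not> \<bar>y\<bar> < 1"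
    using abs_square_less_1[of x] abs_square_less_1[of y] by (fastforce simp: wplus_def max_def split: if_splits)
  then show ?thesis
  proof cases
    case 1
    then show ?thesis using main[OF 1(2,1)] ext[of "?h x"] by linarith
  next
    case 2
    then show ?thesis using main[OF 2(2,1)] ext[of "?h y"] by (simp add: abs_minus_commute)
  next
    case 3
    then show ?thesis using pos bweight_nonneg[of "\<theta> - s"] by (simp add: cut_profile_def profile_def)
  qed
qed

lemma cut_profile_tendsto:
  "((\<lambda>\<delta>. cut_profile s c \<delta> x) \<longlongrightarrow> profile s c x) (at_right 0)"
proof (cases "\<bar>x\<bar> < 1")
  case True
  then have "((\<lambda>\<delta>. profile s c x * cutoff \<delta> (1 - x\<^sup>2)) \<longlongrightarrow> profile s c x * 1) (at_right 0)"
    by (intro tendsto_intros cutoff_tendsto_1) (simp add: abs_square_less_1)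
  then show ?thesis by (simp add: cut_profile_def)
qed (simp add: cut_profile_def profile_def)

lemma profile_Hoelder:
  assumes s: "0 < s" "s < \<theta>" "\<theta> \<le> 1" and c: "\<bar>c\<bar> < 1"
  defines "b \<equiv> 1 / (1 - \<bar>c\<bar>)"
  shows "\<bar>profile s c x - profile s c y\<bar>
    \<le> (b\<^sup>2 + 10 * b) * min 1 (\<bar>x - y\<bar> powr \<theta>) * (bweight (\<theta> - s) x + bweight (\<theta> - s) y)"
proof (rule tendsto_upperbound)
  show "((\<lambda>\<delta>. \<bar>cut_profile s c \<delta> x - cut_profile s c \<delta> y\<bar>) \<longlongrightarrow> \<bar>profile s c x - profile s c y\<bar>) (at_right 0)"
    by (intro tendsto_intros cut_profile_tendsto)
  show "\<forall>\<^sub>F \<delta> in at_right 0. \<bar>cut_profile s c \<delta> x - cut_profile s c \<delta> y\<bar>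
    \<le> (b\<^sup>2 + 10 * b) * min 1 (\<bar>x - y\<bar> powr \<theta>) * (bweight (\<theta> - s) x + bweight (\<theta> - s) y)"
    using eventually_at_right_less[of 0] unfolding b_def
    by eventually_elim (rule cut_profile_Hoelder[OF s c])
qed simp

section \<open>Integrability of the Gagliardo majorant and a Hardy inequality\<close>

lemma le_add_four:
  fixes p q r t :: ennreal
  shows "p \<le> (p + q) + (r + t)" "q \<le> (p + q) + (r + t)" "r \<le> (p + q) + (r + t)" "t \<le> (p + q) + (r + t)"
proof -
  have "p \<le> p + q" "q \<le> p + q" "r \<le> r + t" "t \<le> r + t" by simp_all
  moreover have "p + q \<le> (p + q) + (r + t)" "r + t \<le> (p + q) + (r + t)" by simp_all
  ultimately show "p \<le> (p + q) + (r + t)" "q \<le> (p + q) + (r + t)" "r \<le> (p + q) + (r + t)" "t \<le> (p + q) + (r + t)"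
    by (blast intro: order_trans)+
qed

lemma ennreal_mult3:
  "0 \<le> a \<Longrightarrow> 0 \<le> b \<Longrightarrow> 0 \<le> c \<Longrightarrow> ennreal (a * b * c) = ennreal a * (ennreal b * ennreal c)"
  by (simp add: ennreal_mult mult.assoc)

lemma nn_integral_add_four:
  assumes [measurable]: "p \<in> borel_measurable M" "q \<in> borel_measurable M" "r \<in> borel_measurable M" "t \<in> borel_measurable M"
  shows "(\<integral>\<^sup>+x. (p x + q x) + (r x + t x) \<partial>M) = (integral\<^sup>N M p + integral\<^sup>N M q) + (integral\<^sup>N M r + integral\<^sup>N M t)"
  by (simp add: nn_integral_add)

lemma nn_integral_powr_0_1:
  assumes "\<gamma> < (1::real)"
  shows "(\<integral>\<^sup>+t. ennreal (indicator {0..A} t * t powr (- \<gamma>)) \<partial>lborel) < \<infinity>"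
proof (cases "0 \<le> A")
  case True
  have "(\<integral>\<^sup>+t. ennreal (t powr (- \<gamma>)) * indicator {0..A} t \<partial>lborel) = ennreal (A powr (- \<gamma> + 1) / (- \<gamma> + 1))"
    by (rule nn_integral_has_integral_lebesgue'[OF _ has_integral_powr_from_0]) (use assms True in auto)
  moreover have "(\<integral>\<^sup>+t. ennreal (indicator {0..A} t * t powr (- \<gamma>)) \<partial>lborel) = (\<integral>\<^sup>+t. ennreal (t powr (- \<gamma>)) * indicator {0..A} t \<partial>lborel)"
    by (intro nn_integral_cong) (simp add: indicator_def)
  ultimately show ?thesis by simp
qed simp

lemma nn_integral_bweight:
  assumes g: "0 \<le> \<gamma>" "\<gamma> < 1"
  shows "(\<integral>\<^sup>+x. ennreal (bweight \<gamma> x) \<partial>lborel) < \<infinity>"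
proof -
  let ?F = "\<lambda>t::real. ennreal (indicator {0..2} t * t powr (- \<gamma>))"
  have "(\<integral>\<^sup>+x. ennreal (bweight \<gamma> x) \<partial>lborel) \<le> (\<integral>\<^sup>+x. ?F (1 + x) + ?F (1 + -1 * x) \<partial>lborel)"
  proof (intro nn_integral_mono)
    fix x :: real
    show "ennreal (bweight \<gamma> x) \<le> ?F (1 + x) + ?F (1 + -1 * x)"
    proof (cases "\<bar>x\<bar> < 1")
      case True
      then have m: "\<bar>1 + x\<bar> = 1 + x" "0 < 1 + x" "0 < 1 - x" "1 + x \<le> 2" "1 - x \<le> 2" by auto
      have "(1 - x\<^sup>2) powr (- \<gamma>) \<le> (1 - \<bar>x\<bar>) powr (- \<gamma>)"
      proof (rule powr_mono2')
        have "(1 - \<bar>x\<bar>) * 1 \<le> (1 - \<bar>x\<bar>) * (1 + \<bar>x\<bar>)" using True by (intro mult_left_mono) auto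
        also have "\<dots> = 1 - x\<^sup>2" by (simp add: algebra_simps flip: power2_eq_square)
        finally show "1 - \<bar>x\<bar> \<le> 1 - x\<^sup>2" by simp
      qed (use True g in auto)
      also have "\<dots> \<le> (1 + x) powr (- \<gamma>) + (1 - x) powr (- \<gamma>)" by (cases "0 \<le> x") auto
      finally have "ennreal (bweight \<gamma> x) \<le> ennreal ((1 + x) powr (- \<gamma>) + (1 - x) powr (- \<gamma>))"
        using True by (intro ennreal_leI) (simp add: bweight_def)
      also have "\<dots> = ennreal ((1 + x) powr (- \<gamma>)) + ennreal ((1 - x) powr (- \<gamma>))" by (rule ennreal_plus) auto
      finally show ?thesis using m by simp
    qed (simp add: bweight_def)
  qed
  also have "\<dots> = (\<integral>\<^sup>+x. ?F (1 + x) \<partial>lborel) + (\<integral>\<^sup>+x. ?F (1 + -1 * x) \<partial>lborel)"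
    by (rule nn_integral_add) measurable
  also have "(\<integral>\<^sup>+x. ?F (1 + x) \<partial>lborel) = (\<integral>\<^sup>+x. ?F x \<partial>lborel)"
    by (subst (2) nn_integral_real_affine[where t = 1 and c = 1]) auto
  also have "(\<integral>\<^sup>+x. ?F (1 + -1 * x) \<partial>lborel) = (\<integral>\<^sup>+x. ?F x \<partial>lborel)"
    by (subst (2) nn_integral_real_affine[where t = 1 and c = "-1"]) auto
  also have "(\<integral>\<^sup>+x. ?F x \<partial>lborel) + (\<integral>\<^sup>+x. ?F x \<partial>lborel) < \<infinity>"
    using nn_integral_powr_0_1[OF g(2), of 2] by simp
  finally show ?thesis .
qed

lemma nn_integral_Hoelder_kern:
  assumes s: "0 < s" "s < \<theta>"
  shows "(\<integral>\<^sup>+t. ennreal ((min 1 (\<bar>t\<bar> powr \<theta>))\<^sup>2 * kern s 0 t) \<partial>lborel) < \<infinity>"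
proof -
  let ?F = "\<lambda>t::real. ennreal (indicator {0..1} t * t powr (- (1 - 2 * (\<theta> - s))))"
  have "(\<integral>\<^sup>+t. ennreal ((min 1 (\<bar>t\<bar> powr \<theta>))\<^sup>2 * kern s 0 t) \<partial>lborel)
    \<le> (\<integral>\<^sup>+t. (?F t + ?F (0 + -1 * t)) + (ennreal (indicator {1..} t * kern s 0 t) + ennreal (indicator {..-1} t * kern s 0 t)) \<partial>lborel)"
  proof (intro nn_integral_mono)
    fix t :: real
    have a: "(min 1 (\<bar>t\<bar> powr \<theta>))\<^sup>2 * kern s 0 t \<le> kern s 0 t"
      by (intro mult_left_le_one_le) (auto simp: power_le_one)
    have b: "(min 1 (\<bar>t\<bar> powr \<theta>))\<^sup>2 * kern s 0 t \<le> \<bar>t\<bar> powr (- (1 - 2 * (\<theta> - s)))" if t: "t \<noteq> 0"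
    proof -
      have "(min 1 (\<bar>t\<bar> powr \<theta>))\<^sup>2 * kern s 0 t \<le> (\<bar>t\<bar> powr \<theta>)\<^sup>2 * kern s 0 t"
        by (intro mult_right_mono power_mono) auto
      also have "\<dots> = \<bar>t\<bar> powr (2 * \<theta>) / \<bar>t\<bar> powr (1 + 2 * s)"
        using t by (simp add: powr_powr mult.commute flip: powr_numeral)
      also have "\<dots> = \<bar>t\<bar> powr (2 * \<theta> - (1 + 2 * s))" by (rule powr_diff[symmetric])
      also have "2 * \<theta> - (1 + 2 * s) = - (1 - 2 * (\<theta> - s))" by simp
      finally show ?thesis .
    qed
    consider "t = 0" | "0 < t" "t < 1" | "1 \<le> t" | "-1 < t" "t < 0" | "t \<le> -1" by linarith
    then show "ennreal ((min 1 (\<bar>t\<bar> powr \<theta>))\<^sup>2 * kern s 0 t) \<le> (?F t + ?F (0 + -1 * t))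
        + (ennreal (indicator {1..} t * kern s 0 t) + ennreal (indicator {..-1} t * kern s 0 t))"
    proof cases
      case 1 then show ?thesis by simp
    next
      case 2
      then have "ennreal ((min 1 (\<bar>t\<bar> powr \<theta>))\<^sup>2 * kern s 0 t) \<le> ?F t" using b by (intro ennreal_leI) auto
      then show ?thesis by (rule order_trans[OF _ le_add_four(1)])
    next
      case 3
      then have "ennreal ((min 1 (\<bar>t\<bar> powr \<theta>))\<^sup>2 * kern s 0 t) \<le> ennreal (indicator {1..} t * kern s 0 t)" using a by (intro ennreal_leI) auto
      then show ?thesis by (rule order_trans[OF _ le_add_four(3)])
    next
      case 4
      then have "ennreal ((min 1 (\<bar>t\<bar> powr \<theta>))\<^sup>2 * kern s 0 t) \<le> ?F (0 + -1 * t)" using b by (intro ennreal_leI) auto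
      then show ?thesis by (rule order_trans[OF _ le_add_four(2)])
    next
      case 5
      then have "ennreal ((min 1 (\<bar>t\<bar> powr \<theta>))\<^sup>2 * kern s 0 t) \<le> ennreal (indicator {..-1} t * kern s 0 t)" using a by (intro ennreal_leI) auto
      then show ?thesis by (rule order_trans[OF _ le_add_four(4)])
    qed
  qed
  also have "\<dots> = ((\<integral>\<^sup>+t. ?F t \<partial>lborel) + (\<integral>\<^sup>+t. ?F (0 + -1 * t) \<partial>lborel))
      + ((\<integral>\<^sup>+t. ennreal (indicator {1..} t * kern s 0 t) \<partial>lborel) + (\<integral>\<^sup>+t. ennreal (indicator {..-1} t * kern s 0 t) \<partial>lborel))"
    by (rule nn_integral_add_four) measurable
  also have "(\<integral>\<^sup>+t. ?F (0 + -1 * t) \<partial>lborel) = (\<integral>\<^sup>+x. ?F x \<partial>lborel)"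
    by (subst (2) nn_integral_real_affine[where t = 0 and c = "-1"]) auto
  also have "(\<integral>\<^sup>+t. ennreal (indicator {1..} t * kern s 0 t) \<partial>lborel) = ennreal ((1 - 0) powr (-2 * s) / (2 * s))"
    by (rule nn_integral_kern_tail) (use s in auto)
  also have "(\<integral>\<^sup>+t. ennreal (indicator {..-1} t * kern s 0 t) \<partial>lborel) = ennreal ((0 - -1) powr (-2 * s) / (2 * s))"
    by (rule nn_integral_kern_tail') (use s in auto)
  also have "((\<integral>\<^sup>+t. ?F t \<partial>lborel) + (\<integral>\<^sup>+x. ?F x \<partial>lborel))
      + (ennreal ((1 - 0) powr (-2 * s) / (2 * s)) + ennreal ((0 - -1) powr (-2 * s) / (2 * s))) < \<infinity>"
    using nn_integral_powr_0_1[of "1 - 2 * (\<theta> - s)" 1] s by simp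
  finally show ?thesis .
qed

text \<open>The majorant of \<open>cut_profile_Hoelder\<close> without its constant.\<close>

definition Hoelder_bound :: "real \<Rightarrow> real \<Rightarrow> real \<Rightarrow> real \<Rightarrow> real" where
  "Hoelder_bound s \<theta> x y = min 1 (\<bar>x - y\<bar> powr \<theta>) * (bweight (\<theta> - s) x + bweight (\<theta> - s) y)"

lemma integrable_Hoelder_bound:
  assumes s: "0 < s" "s < \<theta>" "2 * (\<theta> - s) < 1"
  shows "integrable plane (\<lambda>(x, y). (Hoelder_bound s \<theta> x y)\<^sup>2 * kern s x y)"
proof -
  define h where "h = bweight (2 * (\<theta> - s))"
  have h2: "(bweight (\<theta> - s) x)\<^sup>2 = h x" for x
  proof (cases "\<bar>x\<bar> < 1")
    case True
    then have "0 \<le> 1 - x\<^sup>2" by (simp add: abs_square_le_1)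
    then show ?thesis using True by (simp add: h_def bweight_def power2_eq_square flip: powr_add)
  qed (simp add: h_def bweight_def)
  have hm [measurable]: "h \<in> borel_measurable borel" unfolding h_def by measurable
  have h0: "0 \<le> h x" for x unfolding h_def by (rule bweight_nonneg)
  define k where "k t = (min 1 (\<bar>t\<bar> powr \<theta>))\<^sup>2 * kern s 0 t" for t
  have km [measurable]: "k \<in> borel_measurable borel" unfolding k_def by measurable
  have k0: "0 \<le> k t" for t by (simp add: k_def)
  define K where "K = (\<integral>\<^sup>+t. ennreal (k t) \<partial>lborel)"
  have K: "K < \<infinity>" unfolding K_def k_def by (rule nn_integral_Hoelder_kern[OF s(1,2)])
  have h_fin: "(\<integral>\<^sup>+x. ennreal (h x) \<partial>lborel) < \<infinity>" unfolding h_def by (rule nn_integral_bweight) (use s in auto)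
  have shift: "(\<integral>\<^sup>+y. ennreal (k (x - y)) \<partial>lborel) = K" for x
    unfolding K_def by (subst (2) nn_integral_real_affine[where t = x and c = "-1"]) auto
  have shift': "(\<integral>\<^sup>+x. ennreal (k (x - y)) \<partial>lborel) = K" for y
    unfolding K_def by (subst (2) nn_integral_real_affine[where t = "-y" and c = "1"]) auto
  have pt: "ennreal ((Hoelder_bound s \<theta> x y)\<^sup>2 * kern s x y) \<le> 2 * (ennreal (k (x - y)) * ennreal (h x)) + 2 * (ennreal (k (x - y)) * ennreal (h y))" for x y
  proof -
    have "(bweight (\<theta> - s) x + bweight (\<theta> - s) y)\<^sup>2 \<le> 2 * h x + 2 * h y"
      unfolding h2[symmetric] using sum_squares_bound[of "bweight (\<theta> - s) x" "bweight (\<theta> - s) y"]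
      by (simp add: power2_sum)
    then have "k (x - y) * (bweight (\<theta> - s) x + bweight (\<theta> - s) y)\<^sup>2 \<le> k (x - y) * (2 * h x + 2 * h y)"
      by (intro mult_left_mono k0)
    moreover have "kern s 0 (x - y) = kern s x y" by (simp add: abs_minus_commute)
    then have "(Hoelder_bound s \<theta> x y)\<^sup>2 * kern s x y = k (x - y) * (bweight (\<theta> - s) x + bweight (\<theta> - s) y)\<^sup>2"
      by (simp only: k_def Hoelder_bound_def power_mult_distrib mult_ac)
    moreover have "k (x - y) * (2 * h x + 2 * h y) = 2 * (k (x - y) * h x) + 2 * (k (x - y) * h y)"
      by (simp only: distrib_left mult.left_commute)
    ultimately have "(Hoelder_bound s \<theta> x y)\<^sup>2 * kern s x y \<le> 2 * (k (x - y) * h x) + 2 * (k (x - y) * h y)"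
      by (simp only:)
    then have "ennreal ((Hoelder_bound s \<theta> x y)\<^sup>2 * kern s x y) \<le> ennreal (2 * (k (x - y) * h x) + 2 * (k (x - y) * h y))"
      by (rule ennreal_leI)
    also have "\<dots> = ennreal (2 * (k (x - y) * h x)) + ennreal (2 * (k (x - y) * h y))"
      using h0 k0 by (intro ennreal_plus) auto
    also have "\<dots> = 2 * (ennreal (k (x - y)) * ennreal (h x)) + 2 * (ennreal (k (x - y)) * ennreal (h y))"
      using h0 k0 by (simp add: ennreal_mult)
    finally show ?thesis .
  qed
  show ?thesis
  proof (rule integrableI_nonneg)
    show "(\<lambda>(x, y). (Hoelder_bound s \<theta> x y)\<^sup>2 * kern s x y) \<in> borel_measurable plane"
      unfolding Hoelder_bound_def by measurable
    have m1: "(\<lambda>(x, y). 2 * (ennreal (k (x - y)) * ennreal (h x))) \<in> borel_measurable plane"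
      and m2: "(\<lambda>(x, y). 2 * (ennreal (k (x - y)) * ennreal (h y))) \<in> borel_measurable plane"
      by measurable
    have "(\<integral>\<^sup>+p. ennreal (case p of (x, y) \<Rightarrow> (Hoelder_bound s \<theta> x y)\<^sup>2 * kern s x y) \<partial>plane)
      \<le> (\<integral>\<^sup>+(x, y). 2 * (ennreal (k (x - y)) * ennreal (h x)) + 2 * (ennreal (k (x - y)) * ennreal (h y)) \<partial>plane)"
      using pt by (intro nn_integral_mono) auto
    also have "\<dots> = (\<integral>\<^sup>+(x, y). 2 * (ennreal (k (x - y)) * ennreal (h x)) \<partial>plane)
        + (\<integral>\<^sup>+(x, y). 2 * (ennreal (k (x - y)) * ennreal (h y)) \<partial>plane)"
      using nn_integral_add[OF m1 m2] by (simp add: split_beta')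
    also have "(\<integral>\<^sup>+(x, y). 2 * (ennreal (k (x - y)) * ennreal (h x)) \<partial>plane)
      = (\<integral>\<^sup>+x. \<integral>\<^sup>+y. 2 * (ennreal (k (x - y)) * ennreal (h x)) \<partial>lborel \<partial>lborel)"
      using lborel.nn_integral_fst[OF m1] by simp
    also have "\<dots> = (\<integral>\<^sup>+x. 2 * (K * ennreal (h x)) \<partial>lborel)"
      by (intro nn_integral_cong) (simp add: nn_integral_cmult nn_integral_multc shift del: ennreal_mult)
    also have "\<dots> = 2 * (K * (\<integral>\<^sup>+x. ennreal (h x) \<partial>lborel))"
      by (simp add: nn_integral_cmult)
    also have "(\<integral>\<^sup>+(x, y). 2 * (ennreal (k (x - y)) * ennreal (h y)) \<partial>plane)
      = (\<integral>\<^sup>+y. \<integral>\<^sup>+x. 2 * (ennreal (k (x - y)) * ennreal (h y)) \<partial>lborel \<partial>lborel)"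
      using lborel_pair.nn_integral_snd[OF m2] by simp
    also have "\<dots> = (\<integral>\<^sup>+y. 2 * (K * ennreal (h y)) \<partial>lborel)"
      by (intro nn_integral_cong) (simp add: nn_integral_cmult nn_integral_multc shift' del: ennreal_mult)
    also have "\<dots> = 2 * (K * (\<integral>\<^sup>+x. ennreal (h x) \<partial>lborel))"
      by (simp add: nn_integral_cmult)
    also have "2 * (K * (\<integral>\<^sup>+x. ennreal (h x) \<partial>lborel)) + 2 * (K * (\<integral>\<^sup>+x. ennreal (h x) \<partial>lborel)) < \<infinity>"
      using K h_fin by (simp add: ennreal_mult_less_top)
    finally show "(\<integral>\<^sup>+p. ennreal (case p of (x, y) \<Rightarrow> (Hoelder_bound s \<theta> x y)\<^sup>2 * kern s x y) \<partial>plane) < \<infinity>" .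
  qed auto
qed

text \<open>For $|x| < 1$ the kernel is integrated over one of the half-lines $y \ge 1$ and
  $y \le -1$, where $u$ vanishes; the half-line closer to $x$ suffices.\<close>

lemma Hardy_weight:
  assumes s: "0 < s" and u [measurable]: "u \<in> borel_measurable borel"
    and out: "\<And>x. 1 \<le> \<bar>x\<bar> \<Longrightarrow> u x = 0"
    and G: "integrable plane (\<lambda>(x, y). (u x - u y)\<^sup>2 * kern s x y)"
  shows "integrable lborel (\<lambda>x. (u x)\<^sup>2 * bweight (2 * s) x)"
proof (rule integrableI_nonneg)
  show "AE x in lborel. 0 \<le> (u x)\<^sup>2 * bweight (2 * s) x" by (intro AE_I2) (simp add: bweight_nonneg)
  have m: "(\<lambda>(x, y). ennreal ((u x - u y)\<^sup>2 * kern s x y)) \<in> borel_measurable plane"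
    by measurable
  have "(\<integral>\<^sup>+x. ennreal ((u x)\<^sup>2 * bweight (2 * s) x) \<partial>lborel)
     \<le> (\<integral>\<^sup>+x. ennreal (2 * s) * (\<integral>\<^sup>+y. ennreal ((u x - u y)\<^sup>2 * kern s x y) \<partial>lborel) \<partial>lborel)"
  proof (intro nn_integral_mono)
    fix x
    show "ennreal ((u x)\<^sup>2 * bweight (2 * s) x) \<le> ennreal (2 * s) * (\<integral>\<^sup>+y. ennreal ((u x - u y)\<^sup>2 * kern s x y) \<partial>lborel)"
    proof (cases "\<bar>x\<bar> < 1")
      case x: True
      have bw: "bweight (2 * s) x = (1 - x) powr (-2 * s) * (1 + x) powr (-2 * s)"
      proof -
        have "1 - x\<^sup>2 = (1 - x) * (1 + x)" by (simp add: algebra_simps power2_eq_square)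
        then show ?thesis using x by (simp add: bweight_def powr_mult)
      qed
      have em: "ennreal (2 * s * (u x)\<^sup>2 * W) = ennreal (2 * s) * (ennreal ((u x)\<^sup>2) * ennreal W)" if "0 \<le> W" for W
        by (rule ennreal_mult3) (use s that in auto)
      show ?thesis
      proof (cases "0 \<le> x")
        case True
        have "(1 + x) powr (-2 * s) \<le> 1 powr (-2 * s)" using True s by (intro powr_mono2') auto
        then have "bweight (2 * s) x \<le> (1 - x) powr (-2 * s)" unfolding bw by (simp add: mult_left_le)
        then have "ennreal ((u x)\<^sup>2 * bweight (2 * s) x) \<le> ennreal (2 * s * (u x)\<^sup>2 * ((1 - x) powr (-2 * s) / (2 * s)))"
          using s by (intro ennreal_leI) (simp add: mult_left_mono)
        also have "\<dots> = ennreal (2 * s) * (ennreal ((u x)\<^sup>2) * ennreal ((1 - x) powr (-2 * s) / (2 * s)))"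
          by (rule em) (use s in simp)
        also have "ennreal ((1 - x) powr (-2 * s) / (2 * s)) = (\<integral>\<^sup>+y. ennreal (indicator {1..} y * kern s x y) \<partial>lborel)"
          by (rule nn_integral_kern_tail[symmetric]) (use s x in auto)
        also have "ennreal ((u x)\<^sup>2) * (\<integral>\<^sup>+y. ennreal (indicator {1..} y * kern s x y) \<partial>lborel)
            = (\<integral>\<^sup>+y. ennreal ((u x)\<^sup>2) * ennreal (indicator {1..} y * kern s x y) \<partial>lborel)"
          by (rule nn_integral_cmult[symmetric]) measurable
        also have "\<dots> \<le> (\<integral>\<^sup>+y. ennreal ((u x - u y)\<^sup>2 * kern s x y) \<partial>lborel)"
          by (intro nn_integral_mono) (auto simp: indicator_def out simp flip: ennreal_mult)
        finally show ?thesis by (simp add: mult_left_mono)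
      next
        case False
        have "(1 - x) powr (-2 * s) \<le> 1 powr (-2 * s)" using False s by (intro powr_mono2') auto
        then have "bweight (2 * s) x \<le> (x - -1) powr (-2 * s)" unfolding bw by (simp add: mult_left_le_one_le add.commute)
        then have "ennreal ((u x)\<^sup>2 * bweight (2 * s) x) \<le> ennreal (2 * s * (u x)\<^sup>2 * ((x - -1) powr (-2 * s) / (2 * s)))"
          using s by (intro ennreal_leI) (simp add: mult_left_mono)
        also have "\<dots> = ennreal (2 * s) * (ennreal ((u x)\<^sup>2) * ennreal ((x - -1) powr (-2 * s) / (2 * s)))"
          by (rule em) (use s in simp)
        also have "ennreal ((x - -1) powr (-2 * s) / (2 * s)) = (\<integral>\<^sup>+y. ennreal (indicator {..-1} y * kern s x y) \<partial>lborel)"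
          by (rule nn_integral_kern_tail'[symmetric]) (use s x in auto)
        also have "ennreal ((u x)\<^sup>2) * (\<integral>\<^sup>+y. ennreal (indicator {..-1} y * kern s x y) \<partial>lborel)
            = (\<integral>\<^sup>+y. ennreal ((u x)\<^sup>2) * ennreal (indicator {..-1} y * kern s x y) \<partial>lborel)"
          by (rule nn_integral_cmult[symmetric]) measurable
        also have "\<dots> \<le> (\<integral>\<^sup>+y. ennreal ((u x - u y)\<^sup>2 * kern s x y) \<partial>lborel)"
          by (intro nn_integral_mono) (auto simp: indicator_def out simp flip: ennreal_mult)
        finally show ?thesis by (simp add: mult_left_mono)
      qed
    qed (simp add: bweight_def)
  qed
  also have "\<dots> = ennreal (2 * s) * (\<integral>\<^sup>+x. \<integral>\<^sup>+y. ennreal ((u x - u y)\<^sup>2 * kern s x y) \<partial>lborel \<partial>lborel)"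
    by (rule nn_integral_cmult) measurable
  also have "(\<integral>\<^sup>+x. \<integral>\<^sup>+y. ennreal ((u x - u y)\<^sup>2 * kern s x y) \<partial>lborel \<partial>lborel)
     = (\<integral>\<^sup>+(x, y). ennreal ((u x - u y)\<^sup>2 * kern s x y) \<partial>plane)"
    using lborel.nn_integral_fst[OF m] by simp
  finally have le: "(\<integral>\<^sup>+x. ennreal ((u x)\<^sup>2 * bweight (2 * s) x) \<partial>lborel)
     \<le> ennreal (2 * s) * (\<integral>\<^sup>+(x, y). ennreal ((u x - u y)\<^sup>2 * kern s x y) \<partial>plane)" .
  have "(\<integral>\<^sup>+(x, y). ennreal ((u x - u y)\<^sup>2 * kern s x y) \<partial>plane)
      = (\<integral>\<^sup>+p. ennreal (norm (case p of (x, y) \<Rightarrow> (u x - u y)\<^sup>2 * kern s x y)) \<partial>plane)"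
    by (intro nn_integral_cong) auto
  also have "\<dots> < \<infinity>" using G unfolding integrable_iff_bounded by blast
  finally have "ennreal (2 * s) * (\<integral>\<^sup>+(x, y). ennreal ((u x - u y)\<^sup>2 * kern s x y) \<partial>plane) < \<infinity>"
    by (simp add: ennreal_mult_less_top)
  with le show "(\<integral>\<^sup>+x. ennreal ((u x)\<^sup>2 * bweight (2 * s) x) \<partial>lborel) < \<infinity>" by (rule le_less_trans)
qed measurable

lemma integrable_mult_bweight:
  assumes u [measurable]: "u \<in> borel_measurable borel"
    and H: "integrable lborel (\<lambda>x. (u x)\<^sup>2 * bweight (2 * s) x)"
  shows "integrable lborel (\<lambda>x. \<bar>u x\<bar> * bweight s x)"
proof (rule Bochner_Integration.integrable_bound)
  show "integrable lborel (\<lambda>x. (u x)\<^sup>2 * bweight (2 * s) x + indicator {-1..1} x)"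
    by (intro Bochner_Integration.integrable_add H) auto
  show "AE x in lborel. norm (\<bar>u x\<bar> * bweight s x) \<le> norm ((u x)\<^sup>2 * bweight (2 * s) x + indicator {-1..1} x)"
  proof (intro AE_I2)
    fix x
    show "norm (\<bar>u x\<bar> * bweight s x) \<le> norm ((u x)\<^sup>2 * bweight (2 * s) x + indicator {-1..1} x)"
    proof (cases "\<bar>x\<bar> < 1")
      case True
      then have "0 \<le> 1 - x\<^sup>2" by (simp add: abs_square_le_1)
      then have e: "bweight (2 * s) x = (bweight s x)\<^sup>2"
        using True by (simp add: bweight_def power2_eq_square flip: powr_add)
      define z where "z = \<bar>u x\<bar> * bweight s x"
      have "2 * z \<le> z\<^sup>2 + 1" using zero_le_power2[of "z - 1"] by (simp add: power2_eq_square algebra_simps)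
      moreover have "(u x)\<^sup>2 * bweight (2 * s) x = z\<^sup>2" unfolding z_def e by (simp add: power_mult_distrib)
      moreover have "0 \<le> z" by (simp add: z_def bweight_nonneg)
      moreover have "x \<in> {-1..1}" using True by auto
      ultimately show ?thesis unfolding z_def[symmetric] by simp
    qed (simp add: bweight_def)
  qed
qed measurable

section \<open>The truncated bilinear form\<close>

lemma exists_Hoelder_exponent:
  assumes "0 < s" "s < (1::real)"
  obtains \<theta> where "s < \<theta>" "\<theta> \<le> 1" "2 * (\<theta> - s) < 1"
proof
  \<comment> \<open>any exponent in $(s, s + 1/2)$ up to $1$ would do\<close>
  show "s < min 1 (s + 1 / 4)" "min 1 (s + 1 / 4) \<le> 1" "2 * (min 1 (s + 1 / 4) - s) < 1" using assms by (auto simp: min_def)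
qed

text \<open>Used both for removing the truncation and for removing the cutoff; \<open>d n x y\<close> is the increment of
  the second argument of the form.\<close>

lemma form_convergence:
  fixes d :: "nat \<Rightarrow> real \<Rightarrow> real \<Rightarrow> real"
  assumes s: "0 < s" "s < \<theta>" "2 * (\<theta> - s) < 1" and u [measurable]: "u \<in> borel_measurable borel"
    and G: "integrable plane (\<lambda>(x, y). (u x - u y)\<^sup>2 * kern s x y)"
    and dm [measurable]: "\<And>n. (\<lambda>p. d n (fst p) (snd p)) \<in> borel_measurable (borel \<Otimes>\<^sub>M borel)"
    and lm [measurable]: "(\<lambda>p. l (fst p) (snd p)) \<in> borel_measurable (borel \<Otimes>\<^sub>M borel)"
    and bd: "\<And>n x y. \<bar>d n x y\<bar> \<le> M * Hoelder_bound s \<theta> x y"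
    and lim: "\<And>x y. (\<lambda>n. d n x y) \<longlonglongrightarrow> l x y"
  shows "(\<lambda>n. \<integral>(x, y). (u x - u y) * d n x y * kern s x y \<partial>plane)
    \<longlonglongrightarrow> (\<integral>(x, y). (u x - u y) * l x y * kern s x y \<partial>plane)"
proof (rule integral_dominated_convergence)
  let ?w = "\<lambda>(x, y). (u x - u y)\<^sup>2 * kern s x y + M\<^sup>2 * ((Hoelder_bound s \<theta> x y)\<^sup>2 * kern s x y)"
  have "integrable plane (\<lambda>p. (case p of (x, y) \<Rightarrow> (u x - u y)\<^sup>2 * kern s x y)
      + M\<^sup>2 * (case p of (x, y) \<Rightarrow> (Hoelder_bound s \<theta> x y)\<^sup>2 * kern s x y))"
    by (intro Bochner_Integration.integrable_add G integrable_mult_right integrable_Hoelder_bound s)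
  then show "integrable plane ?w" by (simp add: split_beta')
  show "(\<lambda>(x, y). (u x - u y) * l x y * kern s x y) \<in> borel_measurable plane"
    unfolding split_beta' by measurable
  show "(\<lambda>(x, y). (u x - u y) * d n x y * kern s x y) \<in> borel_measurable plane" for n
    unfolding split_beta' by measurable
  show "AE p in plane. (\<lambda>n. case p of (x, y) \<Rightarrow> (u x - u y) * d n x y * kern s x y)
    \<longlonglongrightarrow> (case p of (x, y) \<Rightarrow> (u x - u y) * l x y * kern s x y)"
    unfolding split_beta' by (intro AE_I2 tendsto_mult tendsto_const lim)
  show "AE p in plane. norm (case p of (x, y) \<Rightarrow> (u x - u y) * d n x y * kern s x y) \<le> ?w p" for n
  proof (intro AE_I2)
    fix p :: "real \<times> real"
    obtain x y where p: "p = (x, y)" by (cases p)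
    define A B where "A = \<bar>u x - u y\<bar>" and "B = M * Hoelder_bound s \<theta> x y"
    have "\<bar>(u x - u y) * d n x y\<bar> \<le> A * B"
      unfolding abs_mult A_def B_def using bd by (intro mult_left_mono) auto
    also have "\<dots> \<le> A\<^sup>2 + B\<^sup>2"
      using sum_squares_bound[of A B] zero_le_power2[of A] zero_le_power2[of B] by linarith
    finally have "\<bar>(u x - u y) * d n x y\<bar> * kern s x y \<le> (A\<^sup>2 + B\<^sup>2) * kern s x y"
      by (intro mult_right_mono) auto
    moreover have "norm ((u x - u y) * d n x y * kern s x y) = \<bar>(u x - u y) * d n x y\<bar> * kern s x y"
      by (simp add: abs_mult)
    moreover have "(A\<^sup>2 + B\<^sup>2) * kern s x y = (u x - u y)\<^sup>2 * kern s x y + M\<^sup>2 * ((Hoelder_bound s \<theta> x y)\<^sup>2 * kern s x y)"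
      by (simp only: A_def B_def power2_abs power_mult_distrib distrib_right mult.assoc)
    ultimately show "norm (case p of (x, y) \<Rightarrow> (u x - u y) * d n x y * kern s x y) \<le> ?w p"
      unfolding p by (simp only: prod.case)
  qed
qed

text \<open>The remainder after the cancellation of the terms of order $\epsilon^{-2s}$.\<close>

definition trunc_err :: "real \<Rightarrow> real \<Rightarrow> real \<Rightarrow> real" where
  "trunc_err s \<epsilon> x = \<epsilon> powr (-2 * s) * ((1 + x * \<epsilon>) powr (2 * s) + (1 - x * \<epsilon>) powr (2 * s) - 2 * (1 - \<epsilon>\<^sup>2) powr s)"

lemma trunc_err_bound:
  assumes s: "0 < s" "s < 1" and x: "\<bar>x\<bar> < 1" and e: "0 < \<epsilon>" "\<epsilon> < 1"
  shows "\<bar>trunc_err s \<epsilon> x\<bar> \<le> 4 * \<epsilon> powr (2 - 2 * s)"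
proof -
  define h where "h = x * \<epsilon>"
  have h2: "h\<^sup>2 \<le> \<epsilon>\<^sup>2" unfolding h_def power_mult_distrib using x by (simp add: abs_square_le_1 mult_left_le_one_le)
  have e2: "0 < \<epsilon>\<^sup>2" "\<epsilon>\<^sup>2 < 1" using e by (auto simp: power_less_one_iff abs_square_less_1)
  have "\<bar>h\<bar> < 1" using h2 e2 abs_square_less_1[of h] by linarith
  then have hp: "0 < 1 + h" "0 < 1 - h" by auto
  have B: "1 - y \<le> (1 - y) powr s" if "0 \<le> y" "y < 1" for y
    using powr_mono'[of s 1 "1 - y"] that s by auto
  have up: "(1 + h) powr (2 * s) + (1 - h) powr (2 * s) \<le> 2 + 2 * \<epsilon>\<^sup>2"
  proof -
    have "(1 + h) powr (2 * s) \<le> 1 + s * ((1 + h)\<^sup>2 - 1)" "(1 - h) powr (2 * s) \<le> 1 + s * ((1 - h)\<^sup>2 - 1)"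
      using powr_Bernoulli[of s "(1 + h)\<^sup>2"] powr_Bernoulli[of s "(1 - h)\<^sup>2"] hp s
        powr_of_square[of "1 + h" s] powr_of_square[of "1 - h" s] by auto
    then have "(1 + h) powr (2 * s) + (1 - h) powr (2 * s) \<le> 2 + 2 * (s * h\<^sup>2)"
      by (simp add: power2_eq_square algebra_simps)
    moreover have "s * h\<^sup>2 \<le> 1 * \<epsilon>\<^sup>2" using h2 s by (intro mult_mono) auto
    ultimately show ?thesis by linarith
  qed
  have low: "2 - 2 * \<epsilon>\<^sup>2 \<le> (1 + h) powr (2 * s) + (1 - h) powr (2 * s)"
  proof -
    define P N where "P = (1 + h) powr s" and "N = (1 - h) powr s"
    have "P * N = (1 - h\<^sup>2) powr s"
      unfolding P_def N_def powr_mult[symmetric] by (simp add: power2_eq_square algebra_simps)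
    moreover have "1 - h\<^sup>2 \<le> (1 - h\<^sup>2) powr s" using h2 e2 by (intro B) auto
    moreover have "2 * (P * N) \<le> P\<^sup>2 + N\<^sup>2" using sum_squares_bound[of P N] by simp
    moreover have "P\<^sup>2 = (1 + h) powr (2 * s)" "N\<^sup>2 = (1 - h) powr (2 * s)"
      unfolding P_def N_def power2_eq_square by (simp_all only: mult_2 powr_add)
    ultimately show ?thesis using h2 by linarith
  qed
  have "1 - \<epsilon>\<^sup>2 \<le> (1 - \<epsilon>\<^sup>2) powr s" "(1 - \<epsilon>\<^sup>2) powr s \<le> 1"
    using B[of "\<epsilon>\<^sup>2"] e2 s by (auto intro!: powr_le1)
  with up low have "\<bar>(1 + h) powr (2 * s) + (1 - h) powr (2 * s) - 2 * (1 - \<epsilon>\<^sup>2) powr s\<bar> \<le> 4 * \<epsilon>\<^sup>2"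
    using e2 by (simp add: abs_le_iff)
  then have "\<bar>trunc_err s \<epsilon> x\<bar> \<le> \<epsilon> powr (-2 * s) * (4 * \<epsilon>\<^sup>2)"
    unfolding trunc_err_def h_def[symmetric] abs_mult by (intro mult_mono) auto
  also have "\<dots> = 4 * (\<epsilon> powr (-2 * s) * \<epsilon> powr 2)" using e by (simp add: powr_numeral)
  also have "\<epsilon> powr (-2 * s) * \<epsilon> powr 2 = \<epsilon> powr (2 - 2 * s)" by (simp flip: powr_add)
  finally show ?thesis .
qed

text \<open>The integral of the kernel over the truncated domain, see \<open>integral_kern_far\<close>.\<close>

definition mass_far :: "real \<Rightarrow> real \<Rightarrow> real \<Rightarrow> real" where
  "mass_far s \<epsilon> x = (1 - x\<^sup>2) powr (-2 * s) * \<epsilon> powr (-2 * s) * ((1 + x * \<epsilon>) powr (2 * s) + (1 - x * \<epsilon>) powr (2 * s)) / (2 * s)"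

text \<open>The parameter $\sigma = 1 - \tau^2$ for $\tau = (c-x)/(1-cx)$.\<close>

definition moebius_sigma :: "real \<Rightarrow> real \<Rightarrow> real" where
  "moebius_sigma c x = (1 - c\<^sup>2) * (1 - x\<^sup>2) / (1 - c * x)\<^sup>2"

text \<open>The integral of a profile times the kernel over the truncated domain, see
  \<open>integral_profile_far\<close>.\<close>

definition profile_far :: "real \<Rightarrow> real \<Rightarrow> real \<Rightarrow> real \<Rightarrow> real" where
  "profile_far s c \<epsilon> x = (1 - x\<^sup>2) powr (-s) / (1 - c * x) *
     ((1 / \<epsilon>\<^sup>2 - 1) powr s / s - moebius_sigma c x powr s * beta_part s ((1 / \<epsilon>\<^sup>2 - 1) / moebius_sigma c x))"

lemma beta_part_mono:
  assumes "0 < s" "s < 1" shows "mono (beta_part s)"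
  unfolding mono_def beta_part_def
  by (intro allI impI integral_mono beta_part_integrable assms) (auto simp: indicator_def)

lemma beta_part_measurable [measurable]:
  "0 < s \<Longrightarrow> s < 1 \<Longrightarrow> beta_part s \<in> borel_measurable borel"
  by (intro borel_measurable_mono beta_part_mono)

lemma far_identity:
  assumes s: "0 < s" "s < 1" and x: "\<bar>x\<bar> < 1" and c: "\<bar>c\<bar> < 1" and e: "0 < \<epsilon>" "\<epsilon> < 1"
  shows "profile s c x * mass_far s \<epsilon> x - profile_far s c \<epsilon> x
    = bweight s x / (1 - c * x) * (trunc_err s \<epsilon> x / (2 * s))
      + (1 - c\<^sup>2) powr s * (1 - c * x) powr (-1 - 2 * s) * beta_part s ((1 / \<epsilon>\<^sup>2 - 1) / moebius_sigma c x)"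
proof -
  define A E where "A = 1 - x\<^sup>2" and "E = 1 - c * x"
  define R where "R = beta_part s ((1 / \<epsilon>\<^sup>2 - 1) / moebius_sigma c x)"
  define P N where "P = (1 + x * \<epsilon>) powr (2 * s)" and "N = (1 - x * \<epsilon>) powr (2 * s)"
  define W where "W = (1 - \<epsilon>\<^sup>2) powr s"
  define e2 where "e2 = \<epsilon> powr (-2 * s)"
  have A: "0 < A" using x by (simp add: A_def abs_square_less_1)
  have E: "0 < E" using one_plus_pos(2)[OF c, of x] x by (simp add: E_def)
  have bw: "bweight s x = A powr (-s)" using x by (simp add: bweight_def A_def)
  have pm: "profile s c x * (A powr (-2 * s)) = A powr (-s) / E"
    using x by (simp add: profile_def A_def E_def flip: powr_add)
  have T: "(1 / \<epsilon>\<^sup>2 - 1) powr s = e2 * W"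
  proof -
    have "1 / \<epsilon>\<^sup>2 - 1 = (1 - \<epsilon>\<^sup>2) / \<epsilon>\<^sup>2" using e by (simp add: field_simps)
    then have "(1 / \<epsilon>\<^sup>2 - 1) powr s = W / \<epsilon> powr (2 * s)"
      using e powr_of_square[of \<epsilon> s] by (simp only: W_def powr_divide)
    then show ?thesis unfolding e2_def using powr_minus_divide[of \<epsilon> "2 * s"] by simp
  qed
  have sg: "A powr (-s) / E * moebius_sigma c x powr s = (1 - c\<^sup>2) powr s * E powr (-1 - 2 * s)"
  proof -
    have ms: "moebius_sigma c x powr s = (1 - c\<^sup>2) powr s * A powr s / E powr (2 * s)"
      unfolding moebius_sigma_def A_def[symmetric] E_def[symmetric] powr_mult powr_divide
      using E powr_of_square[of E s] by simp
    have Ep: "E powr (-1 - 2 * s) = 1 / E / E powr (2 * s)"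
      unfolding powr_diff using E powr_minus_divide[of E 1] by simp
    have alg: "A powr (-s) / E * (C * A powr s / D) = C * (1 / E / D)" for C D
    proof -
      have "A powr (-s) * A powr s = 1" using A powr_add[of A "-s" s] by simp
      then have "A powr (-s) * (C * A powr s) = C" by (metis mult.left_commute mult.right_neutral)
      then show ?thesis by (simp add: field_simps)
    qed
    show ?thesis unfolding ms Ep by (rule alg)
  qed
  have "profile s c x * mass_far s \<epsilon> x = (profile s c x * A powr (-2 * s)) * (e2 * (P + N) / (2 * s))"
    unfolding mass_far_def A_def P_def N_def e2_def by simp
  also have "\<dots> = A powr (-s) / E * (e2 * (P + N) / (2 * s))" unfolding pm ..
  finally have 1: "profile s c x * mass_far s \<epsilon> x = A powr (-s) / E * (e2 * (P + N) / (2 * s))" .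
  have 2: "profile_far s c \<epsilon> x = A powr (-s) / E * (e2 * W / s) - A powr (-s) / E * moebius_sigma c x powr s * R"
    unfolding profile_far_def T R_def A_def E_def by (simp add: right_diff_distrib)
  have 3: "trunc_err s \<epsilon> x / (2 * s) = e2 * (P + N) / (2 * s) - e2 * W / s"
    unfolding trunc_err_def P_def N_def W_def e2_def using s by (simp add: field_simps)
  show ?thesis unfolding 1 2 3 bw sg R_def[symmetric] E_def[symmetric] by (simp add: right_diff_distrib)
qed

lemma one_minus_bounds:
  fixes c x :: real
  assumes c: "\<bar>c\<bar> < 1" and x: "\<bar>x\<bar> < 1"
  shows "0 < 1 - c * x" "1 / (1 - c * x) \<le> 1 / (1 - \<bar>c\<bar>)"
proof -
  have "\<bar>c * x\<bar> \<le> \<bar>c\<bar>" using x unfolding abs_mult by (intro mult_left_le) auto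
  then have "1 - \<bar>c\<bar> \<le> 1 - c * x" by linarith
  then show "0 < 1 - c * x" "1 / (1 - c * x) \<le> 1 / (1 - \<bar>c\<bar>)" using c by (auto intro!: divide_left_mono)
qed

text \<open>Away from the diagonal the four products can be integrated separately, and by symmetry
  only $\int u(x) \int (p(x) - p(y)) K(x,y)\,dy\,dx$ remains.\<close>

lemma truncated_form:
  assumes s: "0 < s" "s < 1" and c: "\<bar>c\<bar> < 1" and e: "0 < \<epsilon>" "\<epsilon> < 1"
    and u [measurable]: "u \<in> borel_measurable borel" and out: "\<And>x. 1 \<le> \<bar>x\<bar> \<Longrightarrow> u x = 0"
    and U: "integrable lborel (\<lambda>x. \<bar>u x\<bar> * bweight s x)"
  shows "(\<integral>(x, y). (u x - u y) * (indicator (far \<epsilon> x) y * (profile s c x - profile s c y)) * kern s x y \<partial>plane)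
    = 2 * (\<integral>x. u x * (profile s c x * mass_far s \<epsilon> x - profile_far s c \<epsilon> x) \<partial>lborel)"
proof -
  let ?p = "profile s c" and ?L = plane
  define b where "b = 1 / (1 - \<bar>c\<bar>)"
  define T where "T = 1 / \<epsilon>\<^sup>2 - 1"
  have b0: "0 < b" using c by (simp add: b_def)
  have q: "0 < 1 - c * x" "1 / (1 - c * x) \<le> b" if "\<bar>x\<bar> < 1" for x
    using one_minus_bounds[OF c that] by (simp_all add: b_def)
  have [measurable]: "(\<lambda>p. indicator (far \<epsilon> (fst p)) (snd p) :: real) \<in> borel_measurable ?L"
    unfolding far_def indicator_def mem_Collect_eq by measurable
  have [measurable]: "mass_far s \<epsilon> \<in> borel_measurable borel" unfolding mass_far_def by measurable
  have [measurable]: "profile_far s c \<epsilon> \<in> borel_measurable borel"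
    unfolding profile_far_def moebius_sigma_def using s by measurable
  \<comment> \<open>after symmetrization the integrand is $g(x,y) + g(y,x)$ with $g = f_1 - f_2$\<close>
  define f1 where "f1 = (\<lambda>(x, y). u x * ?p x * (indicator (far \<epsilon> x) y * kern s x y))"
  define f2 where "f2 = (\<lambda>(x, y). u x * (indicator (far \<epsilon> x) y * (?p y * kern s x y)))"
  have m1: "f1 \<in> borel_measurable ?L" unfolding f1_def split_beta' by measurable
  have m2: "f2 \<in> borel_measurable ?L" unfolding f2_def split_beta' by measurable
  have k1: "has_bochner_integral lborel (\<lambda>y. indicator (far \<epsilon> x) y * kern s x y) (mass_far s \<epsilon> x)" if "\<bar>x\<bar> < 1" for x
    using integral_kern_far[OF s(1) that e] by (simp add: mass_far_def)
  have k2: "has_bochner_integral lborel (\<lambda>y. indicator (far \<epsilon> x) y * (?p y * kern s x y)) (profile_far s c \<epsilon> x)" if "\<bar>x\<bar> < 1" for x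
    using integral_profile_far[OF s that c e] by (simp add: profile_far_def moebius_sigma_def)
  have i1: "has_bochner_integral lborel (\<lambda>y. f1 (x, y)) (u x * ?p x * mass_far s \<epsilon> x)" for x
  proof (cases "\<bar>x\<bar> < 1")
    case True
    then show ?thesis unfolding f1_def prod.case by (intro has_bochner_integral_mult_right k1)
  qed (simp add: f1_def out has_bochner_integral_zero)
  have i2: "has_bochner_integral lborel (\<lambda>y. f2 (x, y)) (u x * profile_far s c \<epsilon> x)" for x
  proof (cases "\<bar>x\<bar> < 1")
    case True
    then show ?thesis unfolding f2_def prod.case by (intro has_bochner_integral_mult_right k2)
  qed (simp add: f2_def out has_bochner_integral_zero)
  have n1: "(\<integral>y. norm (f1 (x, y)) \<partial>lborel) = \<bar>u x\<bar> * ?p x * mass_far s \<epsilon> x" for x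
  proof (cases "\<bar>x\<bar> < 1")
    case True
    have "norm (f1 (x, y)) = \<bar>u x\<bar> * ?p x * (indicator (far \<epsilon> x) y * kern s x y)" for y
      using profile_nonneg[OF c, of s x] by (simp add: f1_def abs_mult)
    then show ?thesis using has_bochner_integral_mult_right[OF k1[OF True], of "\<bar>u x\<bar> * ?p x"] by (simp add: has_bochner_integral_iff)
  qed (simp add: f1_def out)
  have n2: "(\<integral>y. norm (f2 (x, y)) \<partial>lborel) = \<bar>u x\<bar> * profile_far s c \<epsilon> x" for x
  proof (cases "\<bar>x\<bar> < 1")
    case True
    have "norm (f2 (x, y)) = \<bar>u x\<bar> * (indicator (far \<epsilon> x) y * (?p y * kern s x y))" for y
      using profile_nonneg[OF c, of s y] by (simp add: f2_def abs_mult)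
    then show ?thesis using has_bochner_integral_mult_right[OF k2[OF True], of "\<bar>u x\<bar>"] by (simp add: has_bochner_integral_iff)
  qed (simp add: f2_def out)
  have b1: "\<bar>u x\<bar> * ?p x * mass_far s \<epsilon> x \<le> (b * (\<epsilon> powr (-2 * s) * (2 * 2 powr (2 * s)) / (2 * s))) * (\<bar>u x\<bar> * bweight s x)" for x
  proof (cases "\<bar>x\<bar> < 1")
    case True
    define V where "V = (1 + x * \<epsilon>) powr (2 * s) + (1 - x * \<epsilon>) powr (2 * s)"
    have "\<bar>x * \<epsilon>\<bar> \<le> 1" using True e by (simp add: abs_mult mult_le_one)
    then have "(1 + x * \<epsilon>) powr (2 * s) \<le> 2 powr (2 * s)" "(1 - x * \<epsilon>) powr (2 * s) \<le> 2 powr (2 * s)"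
      using s by (auto intro!: powr_mono2)
    then have V: "V \<le> 2 * 2 powr (2 * s)" by (simp add: V_def)
    have "?p x * mass_far s \<epsilon> x = 1 / (1 - c * x) * (\<epsilon> powr (-2 * s) * V / (2 * s)) * bweight s x"
    proof -
      have "(1 - x\<^sup>2) powr s * (1 - x\<^sup>2) powr (-2 * s) = (1 - x\<^sup>2) powr (- s)" by (simp flip: powr_add)
      then show ?thesis using True by (simp add: profile_def mass_far_def V_def bweight_def)
    qed
    also have "\<dots> \<le> b * (\<epsilon> powr (-2 * s) * (2 * 2 powr (2 * s)) / (2 * s)) * bweight s x"
      using q[OF True] V s b0 bweight_nonneg[of s x]
      by (intro mult_right_mono mult_mono divide_right_mono mult_left_mono) (auto simp: V_def)
    finally have "\<bar>u x\<bar> * (?p x * mass_far s \<epsilon> x) \<le> \<bar>u x\<bar> * (b * (\<epsilon> powr (-2 * s) * (2 * 2 powr (2 * s)) / (2 * s)) * bweight s x)"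
      by (rule mult_left_mono) simp
    then show ?thesis by (simp only: mult_ac)
  qed (simp add: out)
  have b2: "\<bar>u x\<bar> * profile_far s c \<epsilon> x \<le> (b * (T powr s / s)) * (\<bar>u x\<bar> * bweight s x)" for x
  proof (cases "\<bar>x\<bar> < 1")
    case True
    have "profile_far s c \<epsilon> x = bweight s x * (1 / (1 - c * x)) * (T powr s / s - moebius_sigma c x powr s * beta_part s (T / moebius_sigma c x))"
      using True by (simp add: profile_far_def bweight_def T_def)
    also have "\<dots> \<le> bweight s x * (1 / (1 - c * x)) * (T powr s / s)"
      using q[OF True] bweight_nonneg[of s x] beta_part_bounds(1)[OF s] by (intro mult_left_mono) auto
    also have "\<dots> \<le> bweight s x * b * (T powr s / s)"
      using q[OF True] bweight_nonneg[of s x] s by (intro mult_right_mono mult_left_mono) auto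
    finally have "\<bar>u x\<bar> * profile_far s c \<epsilon> x \<le> \<bar>u x\<bar> * (bweight s x * b * (T powr s / s))" by (rule mult_left_mono) simp
    then show ?thesis by (simp only: mult_ac)
  qed (simp add: out)
  have nn1: "0 \<le> \<bar>u x\<bar> * ?p x * mass_far s \<epsilon> x" for x unfolding n1[symmetric] by simp
  have nn2: "0 \<le> \<bar>u x\<bar> * profile_far s c \<epsilon> x" for x unfolding n2[symmetric] by simp
  have norm_le: "norm a \<le> norm d" if "0 \<le> a" "a \<le> d" for a d :: real using that by simp
  have I1: "integrable ?L f1"
  proof (rule lborel_pair.Fubini_integrable[OF m1])
    show "integrable lborel (\<lambda>x. \<integral>y. norm (f1 (x, y)) \<partial>lborel)"
      unfolding n1
    proof (rule Bochner_Integration.integrable_bound[OF integrable_mult_right[OF U]])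
      show "AE x in lborel. norm (\<bar>u x\<bar> * ?p x * mass_far s \<epsilon> x) \<le> norm ((b * (\<epsilon> powr (-2 * s) * (2 * 2 powr (2 * s)) / (2 * s))) * (\<bar>u x\<bar> * bweight s x))"
        by (intro AE_I2 norm_le[OF nn1 b1])
    qed measurable
    show "AE x in lborel. integrable lborel (\<lambda>y. f1 (x, y))" using i1 by (auto simp: has_bochner_integral_iff)
  qed
  have I2: "integrable ?L f2"
  proof (rule lborel_pair.Fubini_integrable[OF m2])
    show "integrable lborel (\<lambda>x. \<integral>y. norm (f2 (x, y)) \<partial>lborel)"
      unfolding n2
    proof (rule Bochner_Integration.integrable_bound[OF integrable_mult_right[OF U]])
      show "AE x in lborel. norm (\<bar>u x\<bar> * profile_far s c \<epsilon> x) \<le> norm ((b * (T powr s / s)) * (\<bar>u x\<bar> * bweight s x))"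
        by (intro AE_I2 norm_le[OF nn2 b2])
    qed measurable
    show "AE x in lborel. integrable lborel (\<lambda>y. f2 (x, y))" using i2 by (auto simp: has_bochner_integral_iff)
  qed
  have v1: "integral\<^sup>L ?L f1 = (\<integral>x. u x * ?p x * mass_far s \<epsilon> x \<partial>lborel)"
    using lborel_pair.integral_fst'[OF I1] i1 by (simp add: has_bochner_integral_iff)
  have v2: "integral\<^sup>L ?L f2 = (\<integral>x. u x * profile_far s c \<epsilon> x \<partial>lborel)"
    using lborel_pair.integral_fst'[OF I2] i2 by (simp add: has_bochner_integral_iff)
  have j1: "integrable lborel (\<lambda>x. u x * ?p x * mass_far s \<epsilon> x)"
    using lborel_pair.integrable_fst'[OF I1] i1 by (simp add: has_bochner_integral_iff)
  have j2: "integrable lborel (\<lambda>x. u x * profile_far s c \<epsilon> x)"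
    using lborel_pair.integrable_fst'[OF I2] i2 by (simp add: has_bochner_integral_iff)
  define g where "g p = f1 p - f2 p" for p
  have gI: "integrable ?L g" unfolding g_def using I1 I2 by simp
  have gS: "integrable ?L (\<lambda>(x, y). g (y, x))" using lborel_pair.integrable_product_swap[OF gI] .
  have "(\<lambda>(x, y). (u x - u y) * (indicator (far \<epsilon> x) y * (?p x - ?p y)) * kern s x y) = (\<lambda>p. g p + (case p of (x, y) \<Rightarrow> g (y, x)))"
  proof (rule ext)
    fix p :: "real \<times> real"
    obtain x y where p: "p = (x, y)" by (cases p)
    have "indicator (far \<epsilon> y) x = (indicator (far \<epsilon> x) y :: real)" using far_sym by (simp add: indicator_def)
    moreover have "kern s y x = kern s x y" by (simp add: abs_minus_commute)
    ultimately show "(case p of (x, y) \<Rightarrow> (u x - u y) * (indicator (far \<epsilon> x) y * (?p x - ?p y)) * kern s x y) = g p + (case p of (x, y) \<Rightarrow> g (y, x))"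
      unfolding p g_def f1_def f2_def prod.case by (simp only:) (simp only: algebra_simps)
  qed
  then have "(\<integral>(x, y). (u x - u y) * (indicator (far \<epsilon> x) y * (profile s c x - profile s c y)) * kern s x y \<partial>?L)
     = integral\<^sup>L ?L g + (\<integral>(x, y). g (y, x) \<partial>?L)"
    using Bochner_Integration.integral_add[OF gI gS] by simp
  also have "(\<integral>(x, y). g (y, x) \<partial>?L) = integral\<^sup>L ?L g"
    by (rule lborel_pair.integral_product_swap) (use gI in auto)
  also have "integral\<^sup>L ?L g = (\<integral>x. u x * (?p x * mass_far s \<epsilon> x - profile_far s c \<epsilon> x) \<partial>lborel)"
    unfolding g_def using Bochner_Integration.integral_diff[OF I1 I2] Bochner_Integration.integral_diff[OF j1 j2]
    by (simp add: v1 v2 algebra_simps)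
  finally show ?thesis by simp
qed

section \<open>The bilinear form against a profile\<close>

text \<open>The weak form of $(-\Delta)^s p_c = \kappa (1-c^2)^s (1-cx)^{-1-2s}$, without the constant in
  front of the form; the factor $2$ comes from the symmetrization.\<close>

lemma form_profile:
  assumes s: "0 < s" "s < 1" and c: "\<bar>c\<bar> < 1"
    and u [measurable]: "u \<in> borel_measurable borel" and out: "\<And>x. 1 \<le> \<bar>x\<bar> \<Longrightarrow> u x = 0"
    and G: "integrable plane (\<lambda>(x, y). (u x - u y)\<^sup>2 * kern s x y)"
  shows "(\<integral>(x, y). (u x - u y) * (profile s c x - profile s c y) * kern s x y \<partial>plane)
    = 2 * (beta_full s * (1 - c\<^sup>2) powr s * (\<integral>x. u x * (1 - c * x) powr (-1 - 2 * s) \<partial>lborel))"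
proof -
  let ?p = "profile s c" and ?L = plane
  obtain \<theta> where t: "s < \<theta>" "\<theta> \<le> 1" "2 * (\<theta> - s) < 1" using exists_Hoelder_exponent[OF s] .
  define b where "b = 1 / (1 - \<bar>c\<bar>)"
  have b0: "0 < b" using c by (simp add: b_def)
  define \<epsilon> where "\<epsilon> n = 1 / (real n + 2)" for n
  have e: "0 < \<epsilon> n" "\<epsilon> n < 1" for n by (auto simp: \<epsilon>_def)
  have e_lim: "\<epsilon> \<longlonglongrightarrow> 0" unfolding \<epsilon>_def by real_asymp
  have U: "integrable lborel (\<lambda>x. \<bar>u x\<bar> * bweight s x)"
    using integrable_mult_bweight[OF u Hardy_weight[OF s(1) u out G]] by simp
  have farm: "(\<lambda>p. indicator (far r (fst p)) (snd p) :: real) \<in> borel_measurable (borel \<Otimes>\<^sub>M borel)" for r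
    unfolding far_def indicator_def mem_Collect_eq by measurable
  have "(\<lambda>n. \<integral>(x, y). (u x - u y) * (indicator (far (\<epsilon> n) x) y * (?p x - ?p y)) * kern s x y \<partial>?L)
    \<longlonglongrightarrow> (\<integral>(x, y). (u x - u y) * (?p x - ?p y) * kern s x y \<partial>?L)"
  proof (rule form_convergence[OF s(1) t(1,3) u G, where M = "b\<^sup>2 + 10 * b"])
    show "(\<lambda>p. indicator (far (\<epsilon> n) (fst p)) (snd p) * (?p (fst p) - ?p (snd p))) \<in> borel_measurable (borel \<Otimes>\<^sub>M borel)" for n
      using farm[of "\<epsilon> n"] by measurable
    show "(\<lambda>p. ?p (fst p) - ?p (snd p)) \<in> borel_measurable (borel \<Otimes>\<^sub>M borel)" by measurable
    show "\<bar>indicator (far (\<epsilon> n) x) y * (?p x - ?p y)\<bar> \<le> (b\<^sup>2 + 10 * b) * Hoelder_bound s \<theta> x y" for n x y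
    proof -
      have "\<bar>indicator (far (\<epsilon> n) x) y * (?p x - ?p y)\<bar> \<le> \<bar>?p x - ?p y\<bar>" by (simp add: indicator_def)
      also have "\<dots> \<le> (b\<^sup>2 + 10 * b) * Hoelder_bound s \<theta> x y"
        using profile_Hoelder[OF s(1) t(1,2) c] unfolding Hoelder_bound_def b_def by (simp add: mult.assoc)
      finally show ?thesis .
    qed
    show "(\<lambda>n. indicator (far (\<epsilon> n) x) y * (?p x - ?p y)) \<longlonglongrightarrow> ?p x - ?p y" for x y
    proof (cases "x = y")
      case False
      have "(\<lambda>n. \<epsilon> n * \<bar>1 - x * y\<bar>) \<longlonglongrightarrow> 0 * \<bar>1 - x * y\<bar>" by (intro tendsto_intros e_lim)
      then have "\<forall>\<^sub>F n in sequentially. \<epsilon> n * \<bar>1 - x * y\<bar> < \<bar>x - y\<bar>"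
        by (rule order_tendstoD) (use False in simp)
      then have "\<forall>\<^sub>F n in sequentially. ?p x - ?p y = indicator (far (\<epsilon> n) x) y * (?p x - ?p y)"
        by eventually_elim (simp add: far_def indicator_def)
      then show ?thesis by (rule Lim_transform_eventually[OF tendsto_const])
    qed simp
  qed
  then have lim1: "(\<lambda>n. 2 * (\<integral>x. u x * (?p x * mass_far s (\<epsilon> n) x - profile_far s c (\<epsilon> n) x) \<partial>lborel))
    \<longlonglongrightarrow> (\<integral>(x, y). (u x - u y) * (?p x - ?p y) * kern s x y \<partial>?L)"
    by (simp only: truncated_form[OF s c e u out U])
  define J where "J n x = bweight s x / (1 - c * x) * (trunc_err s (\<epsilon> n) x / (2 * s))
      + (1 - c\<^sup>2) powr s * (1 - c * x) powr (-1 - 2 * s) * beta_part s ((1 / (\<epsilon> n)\<^sup>2 - 1) / moebius_sigma c x)" for n x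
  have uJ: "u x * (?p x * mass_far s (\<epsilon> n) x - profile_far s c (\<epsilon> n) x) = u x * J n x" for n x
    using far_identity[OF s _ c e(1,2), of x n] out[of x] unfolding J_def by (cases "\<bar>x\<bar> < 1") auto
  have [measurable]: "J n \<in> borel_measurable borel" for n
    unfolding J_def trunc_err_def moebius_sigma_def using s by measurable
  have c2: "0 < 1 - c\<^sup>2" using c by (simp add: abs_square_less_1)
  define C where "C = b * (4 / (2 * s)) + b powr (1 + 2 * s) * beta_full s"
  have JC: "\<bar>J n x\<bar> \<le> C * bweight s x" if x: "\<bar>x\<bar> < 1" for n x
  proof -
    note q = one_minus_bounds[OF c x, folded b_def]
    have bw: "1 \<le> bweight s x" by (rule bweight_ge_1) (use x s in auto)
    have te: "\<bar>trunc_err s (\<epsilon> n) x\<bar> \<le> 4"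
    proof -
      have "(\<epsilon> n) powr (2 - 2 * s) \<le> 1" using e[of n] s by (intro powr_le1) auto
      then show ?thesis using trunc_err_bound[OF s x e, of n] by linarith
    qed
    have "\<bar>bweight s x / (1 - c * x) * (trunc_err s (\<epsilon> n) x / (2 * s))\<bar>
       = (1 / (1 - c * x)) * (\<bar>trunc_err s (\<epsilon> n) x\<bar> / (2 * s)) * bweight s x"
      using q bw s by (simp add: abs_mult)
    also have "\<dots> \<le> (b * (4 / (2 * s))) * bweight s x"
      using q bw s te b0 by (intro mult_right_mono mult_mono divide_right_mono) auto
    finally have 1: "\<bar>bweight s x / (1 - c * x) * (trunc_err s (\<epsilon> n) x / (2 * s))\<bar> \<le> (b * (4 / (2 * s))) * bweight s x" .
    have "(1 - c * x) powr (-1 - 2 * s) = (1 / (1 - c * x)) powr (1 + 2 * s)"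
    proof -
      have "-1 - 2 * s = - (1 + 2 * s)" by simp
      then show ?thesis using q by (simp only: powr_minus_divide powr_divide powr_one_eq_one)
    qed
    also have "\<dots> \<le> b powr (1 + 2 * s)" using q s by (intro powr_mono2) auto
    finally have 2: "(1 - c * x) powr (-1 - 2 * s) \<le> b powr (1 + 2 * s)" .
    have "(1 - c\<^sup>2) powr s \<le> 1" using c2 s by (intro powr_le1) auto
    then have "(1 - c\<^sup>2) powr s * (1 - c * x) powr (-1 - 2 * s) * beta_part s ((1 / (\<epsilon> n)\<^sup>2 - 1) / moebius_sigma c x)
       \<le> 1 * b powr (1 + 2 * s) * beta_full s"
      using 2 beta_part_bounds[OF s] by (intro mult_mono) auto
    also have "\<dots> \<le> (b powr (1 + 2 * s) * beta_full s) * bweight s x"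
      using mult_left_mono[OF bw, of "b powr (1 + 2 * s) * beta_full s"] beta_full_pos[OF s] by simp
    finally have "\<bar>(1 - c\<^sup>2) powr s * (1 - c * x) powr (-1 - 2 * s) * beta_part s ((1 / (\<epsilon> n)\<^sup>2 - 1) / moebius_sigma c x)\<bar>
       \<le> (b powr (1 + 2 * s) * beta_full s) * bweight s x"
      using beta_part_bounds(1)[OF s] by simp
    with 1 show ?thesis unfolding J_def C_def distrib_right
      by (intro order_trans[OF abs_triangle_ineq add_mono])
  qed
  have "(\<lambda>n. \<integral>x. u x * J n x \<partial>lborel) \<longlonglongrightarrow> (\<integral>x. u x * ((1 - c\<^sup>2) powr s * (1 - c * x) powr (-1 - 2 * s) * beta_full s) \<partial>lborel)"
  proof (rule integral_dominated_convergence[where w = "\<lambda>x. C * (\<bar>u x\<bar> * bweight s x)"])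
    show "integrable lborel (\<lambda>x. C * (\<bar>u x\<bar> * bweight s x))" by (rule integrable_mult_right[OF U])
    show "AE x in lborel. norm (u x * J n x) \<le> C * (\<bar>u x\<bar> * bweight s x)" for n
    proof (intro AE_I2)
      fix x
      show "norm (u x * J n x) \<le> C * (\<bar>u x\<bar> * bweight s x)"
      proof (cases "\<bar>x\<bar> < 1")
        case True
        have "\<bar>u x\<bar> * \<bar>J n x\<bar> \<le> \<bar>u x\<bar> * (C * bweight s x)" by (intro mult_left_mono JC True) auto
        then show ?thesis by (simp add: abs_mult mult_ac)
      qed (simp add: out)
    qed
    show "AE x in lborel. (\<lambda>n. u x * J n x) \<longlonglongrightarrow> u x * ((1 - c\<^sup>2) powr s * (1 - c * x) powr (-1 - 2 * s) * beta_full s)"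
    proof (intro AE_I2)
      fix x
      show "(\<lambda>n. u x * J n x) \<longlonglongrightarrow> u x * ((1 - c\<^sup>2) powr s * (1 - c * x) powr (-1 - 2 * s) * beta_full s)"
      proof (cases "\<bar>x\<bar> < 1")
        case True
        have "(\<lambda>n. trunc_err s (\<epsilon> n) x) \<longlonglongrightarrow> 0"
        proof (rule Lim_null_comparison)
          show "\<forall>\<^sub>F n in sequentially. norm (trunc_err s (\<epsilon> n) x) \<le> 4 * (\<epsilon> n) powr (2 - 2 * s)"
            using trunc_err_bound[OF s True e] by (intro always_eventually) auto
          have "2 - 2 * s > 0" using s by simp
          then have "(\<lambda>n. 4 * (\<epsilon> n) powr (2 - 2 * s)) \<longlonglongrightarrow> 4 * 0"
            by (intro tendsto_mult tendsto_const tendsto_zero_powrI[OF e_lim tendsto_const]) (auto intro!: always_eventually less_imp_le[OF e(1)])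
          then show "(\<lambda>n. 4 * (\<epsilon> n) powr (2 - 2 * s)) \<longlonglongrightarrow> 0" by simp
        qed
        moreover have "(\<lambda>n. beta_part s ((1 / (\<epsilon> n)\<^sup>2 - 1) / moebius_sigma c x)) \<longlonglongrightarrow> beta_full s"
        proof (rule filterlim_compose[OF beta_part_tendsto[OF s]])
          have "0 < moebius_sigma c x"
            using True c2 one_minus_bounds(1)[OF c True] by (simp add: moebius_sigma_def abs_square_less_1)
          moreover have "filterlim (\<lambda>n. 1 / (\<epsilon> n)\<^sup>2 - 1) at_top sequentially" unfolding \<epsilon>_def by real_asymp
          ultimately have "filterlim (\<lambda>n. inverse (moebius_sigma c x) * (1 / (\<epsilon> n)\<^sup>2 - 1)) at_top sequentially"
            by (intro filterlim_tendsto_pos_mult_at_top[OF tendsto_const]) auto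
          then show "filterlim (\<lambda>n. (1 / (\<epsilon> n)\<^sup>2 - 1) / moebius_sigma c x) at_top sequentially"
            by (simp only: divide_inverse mult.commute)
        qed
        ultimately have "(\<lambda>n. u x * J n x) \<longlonglongrightarrow> u x * (bweight s x / (1 - c * x) * (0 / (2 * s))
           + (1 - c\<^sup>2) powr s * (1 - c * x) powr (-1 - 2 * s) * beta_full s)"
          unfolding J_def using s by (intro tendsto_mult tendsto_add tendsto_divide tendsto_const) auto
        then show ?thesis by simp
      qed (simp add: out)
    qed
  qed measurable
  moreover have "(\<integral>x. u x * ((1 - c\<^sup>2) powr s * (1 - c * x) powr (-1 - 2 * s) * beta_full s) \<partial>lborel)
    = beta_full s * (1 - c\<^sup>2) powr s * (\<integral>x. u x * (1 - c * x) powr (-1 - 2 * s) \<partial>lborel)"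
    by (subst integral_mult_right_zero[symmetric]) (simp only: mult_ac)
  ultimately have "(\<lambda>n. 2 * (\<integral>x. u x * (?p x * mass_far s (\<epsilon> n) x - profile_far s c (\<epsilon> n) x) \<partial>lborel))
    \<longlonglongrightarrow> 2 * (beta_full s * (1 - c\<^sup>2) powr s * (\<integral>x. u x * (1 - c * x) powr (-1 - 2 * s) \<partial>lborel))"
    unfolding uJ by (simp only:) (intro tendsto_mult tendsto_const)
  from LIMSEQ_unique[OF lim1 this] show ?thesis .
qed

text \<open>The profiles are admissible in the weak formulation.\<close>

lemma weak_form_profile:
  assumes s: "0 < s" "s < 1" and c: "\<bar>c\<bar> < 1"
    and u: "u \<in> borel_measurable borel"
    and G: "integrable plane (\<lambda>(x, y). (u x - u y)\<^sup>2 * kern s x y)"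
    and fm [measurable]: "f \<in> borel_measurable (lebesgue_on {-1<..<1})"
    and fI: "integrable (lebesgue_on {-1<..<1}) (\<lambda>x. f x * (1 - x\<^sup>2) powr s)"
    and weak: "\<And>v. v \<in> test_functions (-1) 1 \<Longrightarrow>
      K * (\<integral>(x, y). (u x - u y) * (v x - v y) * kern s x y \<partial>plane) = (\<integral>x. f x * v x \<partial>lebesgue_on {-1<..<1})"
  shows "K * (\<integral>(x, y). (u x - u y) * (profile s c x - profile s c y) * kern s x y \<partial>plane)
    = (\<integral>x. f x * profile s c x \<partial>lebesgue_on {-1<..<1})"
proof -
  let ?p = "profile s c" and ?L = plane and ?M = "lebesgue_on {-1<..<1::real}"
  obtain \<theta> where t: "s < \<theta>" "\<theta> \<le> 1" "2 * (\<theta> - s) < 1" using exists_Hoelder_exponent[OF s] .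
  define b where "b = 1 / (1 - \<bar>c\<bar>)"
  have b0: "0 < b" using c by (simp add: b_def)
  define \<delta> where "\<delta> n = 1 / (real n + 2)" for n
  have d: "0 < \<delta> n" for n by (auto simp: \<delta>_def)
  have "\<delta> \<longlonglongrightarrow> 0" unfolding \<delta>_def by real_asymp
  then have d_lim: "filterlim \<delta> (at_right 0) sequentially"
    using d by (intro filterlim_at_withinI) (auto intro!: always_eventually simp: less_imp_neq[symmetric])
  define v where "v n = cut_profile s c (\<delta> n)" for n
  have v_lim: "(\<lambda>n. v n x) \<longlonglongrightarrow> ?p x" for x
    unfolding v_def by (rule filterlim_compose[OF cut_profile_tendsto d_lim])
  have "(\<lambda>n. \<integral>(x, y). (u x - u y) * (v n x - v n y) * kern s x y \<partial>?L)
    \<longlonglongrightarrow> (\<integral>(x, y). (u x - u y) * (?p x - ?p y) * kern s x y \<partial>?L)"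
  proof (rule form_convergence[OF s(1) t(1,3) u G, where M = "b\<^sup>2 + 10 * b"])
    show "(\<lambda>p. v n (fst p) - v n (snd p)) \<in> borel_measurable (borel \<Otimes>\<^sub>M borel)" for n
      unfolding v_def by measurable
    show "(\<lambda>p. ?p (fst p) - ?p (snd p)) \<in> borel_measurable (borel \<Otimes>\<^sub>M borel)" by measurable
    show "\<bar>v n x - v n y\<bar> \<le> (b\<^sup>2 + 10 * b) * Hoelder_bound s \<theta> x y" for n x y
      using cut_profile_Hoelder[OF s(1) t(1,2) c d] unfolding Hoelder_bound_def b_def v_def by (simp add: mult.assoc)
    show "(\<lambda>n. v n x - v n y) \<longlonglongrightarrow> ?p x - ?p y" for x y
      by (intro tendsto_diff v_lim)
  qed
  then have "(\<lambda>n. K * (\<integral>(x, y). (u x - u y) * (v n x - v n y) * kern s x y \<partial>?L))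
    \<longlonglongrightarrow> K * (\<integral>(x, y). (u x - u y) * (?p x - ?p y) * kern s x y \<partial>?L)"
    by (intro tendsto_mult tendsto_const)
  then have lim1: "(\<lambda>n. \<integral>x. f x * v n x \<partial>?M) \<longlonglongrightarrow> K * (\<integral>(x, y). (u x - u y) * (?p x - ?p y) * kern s x y \<partial>?L)"
    unfolding v_def by (simp only: weak[OF cut_profile_test_function[OF c d]])
  have bm: "g \<in> borel_measurable ?M" if "g \<in> borel_measurable borel" for g :: "real \<Rightarrow> real"
    using that by (intro measurable_restrict_space1 measurable_completion) simp
  have "(\<lambda>n. \<integral>x. f x * v n x \<partial>?M) \<longlonglongrightarrow> (\<integral>x. f x * ?p x \<partial>?M)"
  proof (rule integral_dominated_convergence[where w = "\<lambda>x. b * norm (f x * (1 - x\<^sup>2) powr s)"])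
    show "integrable ?M (\<lambda>x. b * norm (f x * (1 - x\<^sup>2) powr s))"
      by (intro integrable_mult_right integrable_norm fI)
    show "(\<lambda>x. f x * ?p x) \<in> borel_measurable ?M" by (intro borel_measurable_times fm bm) measurable
    show "(\<lambda>x. f x * v n x) \<in> borel_measurable ?M" for n unfolding v_def by (intro borel_measurable_times fm bm) measurable
    show "AE x in ?M. (\<lambda>n. f x * v n x) \<longlonglongrightarrow> f x * ?p x" by (intro AE_I2 tendsto_mult tendsto_const v_lim)
    show "AE x in ?M. norm (f x * v n x) \<le> b * norm (f x * (1 - x\<^sup>2) powr s)" for n
    proof (intro AE_I2)
      fix x assume "x \<in> space ?M"
      then have x: "\<bar>x\<bar> < 1" by (simp add: abs_less_iff)
      note q = one_minus_bounds[OF c x, folded b_def]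
      have "v n x = 1 / (1 - c * x) * (1 - x\<^sup>2) powr s * cutoff (\<delta> n) (1 - x\<^sup>2)"
        using x by (simp add: v_def cut_profile_def profile_def)
      also have "\<bar>\<dots>\<bar> \<le> b * (1 - x\<^sup>2) powr s * 1"
        using q b0 cutoff_nonneg[of "\<delta> n"] cutoff_le_1[OF d, of n] unfolding abs_mult
        by (intro mult_mono) auto
      finally have "\<bar>f x\<bar> * \<bar>v n x\<bar> \<le> \<bar>f x\<bar> * (b * (1 - x\<^sup>2) powr s * 1)" by (rule mult_left_mono) simp
      then show "norm (f x * v n x) \<le> b * norm (f x * (1 - x\<^sup>2) powr s)" by (simp add: abs_mult mult_ac)
    qed
  qed
  from LIMSEQ_unique[OF lim1 this] show ?thesis .
qed

lemma eigen_factor_sums: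
  assumes z: "\<bar>z\<bar> < (1::real)"
  shows "(\<lambda>n. eigen_factor s n * z ^ n) sums (1 - z) powr (-1 - 2 * s)"
proof -
  have "(\<lambda>n. ((-1 - 2 * s) gchoose n) * (- z) ^ n) sums (1 + - z) powr (-1 - 2 * s)"
    by (rule gen_binomial_real) (use z in simp)
  moreover have "((-1 - 2 * s) gchoose n) * (- z) ^ n = eigen_factor s n * z ^ n" for n
  proof -
    have "- (-1 - 2 * s) = 1 + 2 * s" by simp
    then have "((-1 - 2 * s) gchoose n) = (-1) ^ n * eigen_factor s n" by (simp add: gbinomial_pochhammer eigen_factor_def add.commute)
    moreover have "(- z) ^ n = (-1) ^ n * z ^ n" by (rule power_minus)
    moreover have "((-1)::real) ^ n * (-1) ^ n = 1" by (simp flip: power_mult_distrib)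
    ultimately show ?thesis by (simp add: mult_ac)
  qed
  ultimately show ?thesis by simp
qed

text \<open>Termwise integration of a power series with nonnegative coefficients.\<close>

lemma moment_series:
  fixes g :: "real \<Rightarrow> real"
  assumes g: "integrable M g" and x1: "\<And>x. x \<in> space M \<Longrightarrow> g x \<noteq> 0 \<Longrightarrow> \<bar>x\<bar> \<le> 1"
    and xm: "(\<lambda>x. x) \<in> borel_measurable M"
    and a: "\<And>n. 0 \<le> a n" and c: "\<bar>c\<bar> < 1"
    and sm: "\<And>z. \<bar>z\<bar> < 1 \<Longrightarrow> (\<lambda>n. a n * z ^ n) sums h z"
  shows "(\<lambda>n. a n * (\<integral>x. g x * x ^ n \<partial>M) * c ^ n) sums (\<integral>x. g x * h (c * x) \<partial>M)"
proof -
  have bd: "\<bar>g x * x ^ n\<bar> \<le> \<bar>g x\<bar>" if "x \<in> space M" for x n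
    using x1[OF that] by (cases "g x = 0") (auto simp: abs_mult power_abs intro!: mult_left_le power_le_one)
  have gm: "(\<lambda>x. g x * x ^ n) \<in> borel_measurable M" for n
    using g xm by (intro borel_measurable_times borel_measurable_power) auto
  have gi: "integrable M (\<lambda>x. g x * x ^ n)" for n
    by (rule Bochner_Integration.integrable_bound[OF g gm]) (use bd in \<open>auto intro!: AE_I2\<close>)
  let ?f = "\<lambda>n x. (a n * c ^ n) * (g x * x ^ n)"
  have sc: "summable (\<lambda>n. a n * \<bar>c\<bar> ^ n)" using sums_summable[OF sm[of "\<bar>c\<bar>"]] c by simp
  have nf: "norm (?f n x) \<le> (a n * \<bar>c\<bar> ^ n) * \<bar>g x\<bar>" if "x \<in> space M" for n x
  proof -
    have "norm (?f n x) = (a n * \<bar>c\<bar> ^ n) * \<bar>g x * x ^ n\<bar>" using a[of n] by (simp add: abs_mult power_abs)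
    also have "\<dots> \<le> (a n * \<bar>c\<bar> ^ n) * \<bar>g x\<bar>" using bd[OF that] a by (intro mult_left_mono) auto
    finally show ?thesis .
  qed
  have S: "(\<lambda>n. integral\<^sup>L M (?f n)) sums (\<integral>x. (\<Sum>n. ?f n x) \<partial>M)"
  proof (rule sums_integral)
    show "integrable M (?f n)" for n by (rule integrable_mult_right[OF gi])
    show "AE x in M. summable (\<lambda>n. norm (?f n x))"
      by (intro AE_I2 summable_comparison_test'[OF summable_mult2[OF sc]]) (use nf in auto)
    show "summable (\<lambda>n. \<integral>x. norm (?f n x) \<partial>M)"
    proof (rule summable_comparison_test'[OF summable_mult2[OF sc]])
      fix n
      have "(\<integral>x. norm (?f n x) \<partial>M) \<le> (\<integral>x. (a n * \<bar>c\<bar> ^ n) * \<bar>g x\<bar> \<partial>M)"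
        using nf by (intro integral_mono integrable_norm integrable_mult_right gi integrable_abs g) auto
      then show "norm (\<integral>x. norm (?f n x) \<partial>M) \<le> a n * \<bar>c\<bar> ^ n * (\<integral>x. \<bar>g x\<bar> \<partial>M)" by simp
    qed
  qed
  have In: "integral\<^sup>L M (?f n) = a n * (\<integral>x. g x * x ^ n \<partial>M) * c ^ n" for n
    by (subst integral_mult_right_zero) (simp only: mult_ac)
  have Ix: "(\<integral>x. (\<Sum>n. ?f n x) \<partial>M) = (\<integral>x. g x * h (c * x) \<partial>M)"
  proof (rule Bochner_Integration.integral_cong[OF refl])
    fix x assume x: "x \<in> space M"
    show "(\<Sum>n. ?f n x) = g x * h (c * x)"
    proof (cases "g x = 0")
      case False
      have "\<bar>c * x\<bar> < 1" using c x1[OF x False] mult_le_one[of "\<bar>c\<bar>" "\<bar>x\<bar>"]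
        by (metis abs_ge_zero abs_mult mult_left_le order_le_less_trans)
      from sums_mult[OF sm[OF this], of "g x"] have "(\<lambda>n. g x * (a n * (c * x) ^ n)) sums (g x * h (c * x))" .
      moreover have "g x * (a n * (c * x) ^ n) = ?f n x" for n by (simp add: power_mult_distrib)
      ultimately show ?thesis by (simp add: sums_iff)
    qed simp
  qed
  show ?thesis using S unfolding In Ix .
qed

lemma weighted_L2_integrable:
  assumes s: "0 < s" and f: "f \<in> weighted_L2 s (-1) 1"
  shows "integrable (lebesgue_on {-1<..<1}) (\<lambda>x. f x * (1 - x\<^sup>2) powr s)"
proof (rule Bochner_Integration.integrable_bound)
  let ?M = "lebesgue_on {-1<..<1::real}"
  have wm: "(\<lambda>x. (1 - x\<^sup>2) powr s) \<in> borel_measurable ?M"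
    by (intro measurable_restrict_space1 measurable_completion) measurable
  have "integrable ?M (\<lambda>x. 1 :: real)"
    by (intro finite_measure.integrable_const finite_measure_lebesgue_on) auto
  then show "integrable ?M (\<lambda>x. (f x)\<^sup>2 * (1 - x\<^sup>2) powr s + 1)"
    using f by (intro Bochner_Integration.integrable_add) (auto simp: weighted_L2_def omega_unit)
  show "(\<lambda>x. f x * (1 - x\<^sup>2) powr s) \<in> borel_measurable ?M"
    using f wm by (auto simp: weighted_L2_def)
  show "AE x in ?M. norm (f x * (1 - x\<^sup>2) powr s) \<le> norm ((f x)\<^sup>2 * (1 - x\<^sup>2) powr s + 1)"
  proof (intro AE_I2)
    fix x assume "x \<in> space ?M"
    then have x: "\<bar>x\<bar> < 1" by (simp add: abs_less_iff)
    define w where "w = (1 - x\<^sup>2) powr s"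
    have w: "0 \<le> w" "w \<le> 1" using x s by (auto simp: w_def abs_square_le_1 intro!: powr_le1)
    have "2 * \<bar>f x\<bar> \<le> (f x)\<^sup>2 + 1" using zero_le_power2[of "\<bar>f x\<bar> - 1"] by (simp add: power2_eq_square algebra_simps)
    then have "(2 * \<bar>f x\<bar>) * w \<le> ((f x)\<^sup>2 + 1) * w" using w by (intro mult_right_mono) auto
    then have "\<bar>f x\<bar> * w \<le> (f x)\<^sup>2 * w + 1" using w mult_nonneg_nonneg[OF abs_ge_zero w(1), of "f x"] unfolding distrib_right by linarith
    then show "norm (f x * (1 - x\<^sup>2) powr s) \<le> norm ((f x)\<^sup>2 * (1 - x\<^sup>2) powr s + 1)"
      unfolding w_def[symmetric] using w by (simp add: abs_mult)
  qed
qed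

text \<open>The eigenvalue relation tested against the solution. The factor \<open>K\<close> stands for the constant in
  front of the bilinear form, after rescaling.\<close>

lemma coefficient_relation:
  assumes s: "0 < s" "s < 1"
    and u [measurable]: "u \<in> borel_measurable borel" and out: "\<And>x. 1 \<le> \<bar>x\<bar> \<Longrightarrow> u x = 0"
    and G: "integrable plane (\<lambda>(x, y). (u x - u y)\<^sup>2 * kern s x y)"
    and f: "f \<in> weighted_L2 s (-1) 1"
    and weak: "\<And>v. v \<in> test_functions (-1) 1 \<Longrightarrow>
      K * (\<integral>(x, y). (u x - u y) * (v x - v y) * kern s x y \<partial>plane) = (\<integral>x. f x * v x \<partial>lebesgue_on {-1<..<1})"
  shows "(\<integral>x. f x * gegenbauer (s + 1/2) n x * (1 - x\<^sup>2) powr s \<partial>lebesgue_on {-1<..<1})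
    = 2 * K * beta_full s * eigen_factor s n * (\<integral>x. u x * gegenbauer (s + 1/2) n x \<partial>lborel)"
proof -
  let ?M = "lebesgue_on {-1<..<1::real}"
  define g where "g x = f x * (1 - x\<^sup>2) powr s" for x
  have fm: "f \<in> borel_measurable ?M" using f by (simp add: weighted_L2_def)
  have gI: "integrable ?M g" unfolding g_def by (rule weighted_L2_integrable[OF s(1) f])
  have uI: "integrable lborel u"
  proof (rule Bochner_Integration.integrable_bound)
    show "integrable lborel (\<lambda>x. \<bar>u x\<bar> * bweight s x)"
      using integrable_mult_bweight[OF u Hardy_weight[OF s(1) u out G]] by simp
    show "AE x in lborel. norm (u x) \<le> norm (\<bar>u x\<bar> * bweight s x)"
    proof (intro AE_I2)
      fix x
      show "norm (u x) \<le> norm (\<bar>u x\<bar> * bweight s x)"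
      proof (cases "\<bar>x\<bar> < 1")
        case True
        then have "1 \<le> bweight s x" using s by (intro bweight_ge_1) auto
        then show ?thesis using mult_left_mono[of 1 "bweight s x" "\<bar>u x\<bar>"] by (simp add: abs_mult)
      qed (simp add: out)
    qed
  qed measurable
  have idm: "(\<lambda>x. x) \<in> borel_measurable ?M"
    by (intro measurable_restrict_space1 measurable_completion) measurable
  define F U where "F n = (\<integral>x. g x * x ^ n \<partial>?M)" and "U n = (\<integral>x. u x * x ^ n \<partial>lborel)" for n
  define H where "H c = (\<integral>x. u x * (1 - c * x) powr (-1 - 2 * s) \<partial>lborel)" for c
  have Fs: "(\<lambda>n. F n * c ^ n) sums (2 * K * beta_full s * (1 - c\<^sup>2) powr s * H c)" if c: "\<bar>c\<bar> < 1" for c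
  proof -
    have "(\<lambda>n. 1 * (\<integral>x. g x * x ^ n \<partial>?M) * c ^ n) sums (\<integral>x. g x * (\<lambda>z. 1 / (1 - z)) (c * x) \<partial>?M)"
    proof (rule moment_series[OF gI _ idm _ c])
      show "\<bar>x\<bar> \<le> 1" if "x \<in> space ?M" for x using that by (simp add: abs_le_iff)
      show "(\<lambda>n. 1 * z ^ n) sums (1 / (1 - z))" if "\<bar>z\<bar> < 1" for z :: real
        using geometric_sums[of z] that by simp
    qed simp
    also have "(\<integral>x. g x * (\<lambda>z. 1 / (1 - z)) (c * x) \<partial>?M) = (\<integral>x. f x * profile s c x \<partial>?M)"
      by (intro Bochner_Integration.integral_cong refl) (auto simp: g_def profile_def abs_less_iff)
    also have "\<dots> = K * (\<integral>(x, y). (u x - u y) * (profile s c x - profile s c y) * kern s x y \<partial>plane)"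
      using weak_form_profile[OF s c u G fm gI[unfolded g_def] weak] by simp
    also have "\<dots> = 2 * K * beta_full s * (1 - c\<^sup>2) powr s * H c"
      unfolding H_def by (rule trans[OF arg_cong[OF form_profile[OF s c u out G]]]) (simp_all add: mult_ac)
    finally show ?thesis unfolding F_def by simp
  qed
  have Us: "(\<lambda>n. eigen_factor s n * U n * c ^ n) sums H c" if c: "\<bar>c\<bar> < 1" for c
    unfolding U_def H_def
  proof (rule moment_series[OF uI _ _ _ c])
    show "\<bar>x\<bar> \<le> 1" if "u x \<noteq> 0" for x using out[of x] that by linarith
    show "0 \<le> eigen_factor s n" for n using eigen_factor_pos[OF s(1)] by (simp add: less_imp_le)
    show "(\<lambda>n. eigen_factor s n * z ^ n) sums (1 - z) powr (-1 - 2 * s)" if "\<bar>z\<bar> < 1" for z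
      by (rule eigen_factor_sums[OF that])
  qed simp
  let ?c = "gegenbauer_mono (s + 1/2) n"
  have FI: "integrable ?M (\<lambda>x. g x * x ^ m)" for m
  proof (rule Bochner_Integration.integrable_bound[OF gI])
    show "(\<lambda>x. g x * x ^ m) \<in> borel_measurable ?M"
      using gI idm by (intro borel_measurable_times borel_measurable_power) auto
    show "AE x in ?M. norm (g x * x ^ m) \<le> norm (g x)"
      by (intro AE_I2) (auto simp: abs_mult power_abs abs_le_iff intro!: mult_left_le power_le_one)
  qed
  have UI: "integrable lborel (\<lambda>x. u x * x ^ m)" for m
  proof (rule Bochner_Integration.integrable_bound[OF uI])
    show "AE x in lborel. norm (u x * x ^ m) \<le> norm (u x)"
    proof (intro AE_I2)
      fix x show "norm (u x * x ^ m) \<le> norm (u x)"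
        by (cases "\<bar>x\<bar> < 1") (auto simp: out abs_mult power_abs intro!: mult_left_le power_le_one)
    qed
  qed measurable
  have "(\<integral>x. f x * gegenbauer (s + 1/2) n x * (1 - x\<^sup>2) powr s \<partial>?M) = (\<integral>x. (\<Sum>m\<le>n. ?c m * (g x * x ^ m)) \<partial>?M)"
    by (intro Bochner_Integration.integral_cong refl) (simp add: gegenbauer_eq_sum g_def sum_distrib_left sum_distrib_right mult_ac)
  also have "\<dots> = (\<Sum>m\<le>n. ?c m * F m)"
    using FI by (subst Bochner_Integration.integral_sum) (auto simp: F_def)
  also have "\<dots> = 2 * K * beta_full s * eigen_factor s n * (\<Sum>m\<le>n. ?c m * U m)"
    by (rule generating_identity_gegenbauer[OF s(1) Fs Us])
  also have "(\<Sum>m\<le>n. ?c m * U m) = (\<integral>x. (\<Sum>m\<le>n. ?c m * (u x * x ^ m)) \<partial>lborel)"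
    using UI by (subst Bochner_Integration.integral_sum) (auto simp: U_def)
  also have "\<dots> = (\<integral>x. u x * gegenbauer (s + 1/2) n x \<partial>lborel)"
    by (intro Bochner_Integration.integral_cong refl) (simp add: gegenbauer_eq_sum sum_distrib_left mult_ac)
  finally show ?thesis .
qed

section \<open>Borel representatives and rescaling\<close>

lemma borel_measurable_completion_AE:
  fixes F g :: "'a \<Rightarrow> 'b::topological_space"
  assumes g: "g \<in> borel_measurable M" and ae: "AE x in M. F x = g x"
  shows "F \<in> borel_measurable (completion M)"
proof (rule measurableI)
  obtain N where N': "{x \<in> space M. \<not> F x = g x} \<subseteq> N" "emeasure M N = 0" "N \<in> sets M"
    by (rule AE_E[OF ae])
  have N: "N \<in> null_sets M" by (rule null_setsI[OF N'(2,3)])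
  fix S :: "'b set" assume S: "S \<in> sets borel"
  have key: "F x = g x" if "x \<in> space M" "x \<notin> N" for x using that N'(1) by auto
  have eq: "F -` S \<inter> space M = (g -` S \<inter> space M - N) \<union> (F -` S \<inter> space M \<inter> N)"
  proof (rule set_eqI)
    fix x
    show "x \<in> F -` S \<inter> space M \<longleftrightarrow> x \<in> (g -` S \<inter> space M - N) \<union> (F -` S \<inter> space M \<inter> N)"
      by (cases "x \<in> N"; cases "x \<in> space M") (simp_all add: key)
  qed
  have a: "g -` S \<inter> space M - N \<in> sets (completion M)"
    by (rule sets_completionI_sets[OF sets.Diff[OF measurable_sets[OF g S] N'(3)]])
  have b: "F -` S \<inter> space M \<inter> N \<in> sets (completion M)"
    by (rule sets_completionI_sub[OF N]) blast
  show "F -` S \<inter> space (completion M) \<in> sets (completion M)"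
    unfolding space_completion by (subst eq) (rule sets.Un[OF a b])
qed simp

lemma test_function_borel:
  assumes "v \<in> test_functions a b" shows "v \<in> borel_measurable borel"
proof -
  have "(deriv ^^ 0) v field_differentiable at x" for x using assms unfolding test_functions_def by blast
  then have "isCont v x" for x by (simp add: field_differentiable_imp_continuous_at)
  then show ?thesis by (intro borel_measurable_continuous_onI continuous_at_imp_continuous_on) auto
qed

text \<open>A Borel representative that vanishes everywhere outside the interval, so that Fubini's theorem
  applies to the product of two copies of \<open>lborel\<close>.\<close>

lemma weak_solution_borel_representative:
  assumes "weak_solution s a b f u"
  obtains w where "w \<in> borel_measurable borel" "\<And>x. x \<notin> {a<..<b} \<Longrightarrow> w x = 0"
    "AE x in lebesgue. u x = w x"
    "integrable plane (\<lambda>(x, y). (w x - w y)\<^sup>2 * kern s x y)"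
    "\<And>v. v \<in> test_functions a b \<Longrightarrow> frac_const s / 2 *
       (\<integral>(x, y). (w x - w y) * (v x - v y) * kern s x y \<partial>plane) = (\<integral>x. f x * v x \<partial>lebesgue_on {a<..<b})"
proof -
  have um: "u \<in> borel_measurable lebesgue" and ui: "integrable lebesgue (\<lambda>(x, y). (u x - u y)\<^sup>2 / \<bar>x - y\<bar> powr (1 + 2 * s))"
    and out: "AE x in lebesgue. x \<notin> {a<..<b} \<longrightarrow> u x = 0"
    and weak: "\<And>v. v \<in> test_functions a b \<Longrightarrow> frac_form s u v = (\<integral>x. f x * v x \<partial>lebesgue_on {a<..<b})"
    using assms by (auto simp: weak_solution_def frac_sobolev_def)
  obtain u0 where u0 [measurable]: "u0 \<in> borel_measurable borel" and eq0: "AE x in lborel. u x = u0 x"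
    using completion_ex_borel_measurable_real[OF um] by auto
  define w where "w x = (if x \<in> {a<..<b} then u0 x else 0)" for x
  have wm [measurable]: "w \<in> borel_measurable borel" unfolding w_def by measurable
  have aew: "AE x in lborel. u x = w x"
    using eq0 out[unfolded AE_completion_iff] by eventually_elim (auto simp: w_def)
  let ?L = plane
  have ae2: "AE p in ?L. u (fst p) = w (fst p) \<and> u (snd p) = w (snd p)"
  proof -
    obtain N where "{x \<in> space lborel. \<not> u x = w x} \<subseteq> N" "emeasure lborel N = 0" "N \<in> sets lborel"
      using AE_E[OF aew] by blast
    then have N: "N \<in> null_sets lborel" "{x. u x \<noteq> w x} \<subseteq> N" by (auto intro: null_setsI)
    have "N \<times> UNIV \<in> null_sets ?L" "UNIV \<times> N \<in> null_sets ?L"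
      using N(1) by (auto simp: null_sets_def lborel.emeasure_pair_measure_Times)
    then have "AE p in ?L. p \<notin> N \<times> UNIV" "AE p in ?L. p \<notin> UNIV \<times> N" by (auto intro: AE_not_in)
    then show ?thesis by eventually_elim (use N(2) in auto)
  qed
  have transfer: "integral\<^sup>L lebesgue F = integral\<^sup>L ?L g" "integrable lebesgue F \<longleftrightarrow> integrable ?L g"
    if g: "g \<in> borel_measurable ?L" and ae: "AE p in ?L. F p = g p" for F g :: "real \<times> real \<Rightarrow> real"
  proof -
    have g': "g \<in> borel_measurable lborel" and ae': "AE p in lborel. F p = g p"
      using g ae by (simp_all only: lborel_prod)
    have F: "F \<in> borel_measurable lebesgue" by (rule borel_measurable_completion_AE[OF g' ae'])
    have aec: "AE p in lebesgue. F p = g p" using ae' by (rule AE_completion)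
    have gc: "g \<in> borel_measurable lebesgue" by (rule measurable_completion[OF g'])
    have "integral\<^sup>L lebesgue F = integral\<^sup>L lebesgue g" by (rule integral_cong_AE[OF F gc aec])
    also have "\<dots> = integral\<^sup>L ?L g" unfolding lborel_prod by (rule integral_completion[OF g'])
    finally show "integral\<^sup>L lebesgue F = integral\<^sup>L ?L g" .
    have "integrable lebesgue F \<longleftrightarrow> integrable lebesgue g" by (rule integrable_cong_AE[OF F gc aec])
    also have "\<dots> \<longleftrightarrow> integrable ?L g" unfolding lborel_prod by (rule integrable_completion[OF g'])
    finally show "integrable lebesgue F \<longleftrightarrow> integrable ?L g" .
  qed
  show thesis
  proof
    show "w \<in> borel_measurable borel" by (rule wm)
    show "w x = 0" if "x \<notin> {a<..<b}" for x using that by (auto simp: w_def)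
    show "AE x in lebesgue. u x = w x" using aew by (rule AE_completion)
    show "integrable ?L (\<lambda>(x, y). (w x - w y)\<^sup>2 * kern s x y)"
    proof (rule transfer(2)[THEN iffD1, OF _ _ ui])
      show "(\<lambda>(x, y). (w x - w y)\<^sup>2 * kern s x y) \<in> borel_measurable ?L" unfolding split_beta' by measurable
      show "AE p in ?L. (case p of (x, y) \<Rightarrow> (u x - u y)\<^sup>2 / \<bar>x - y\<bar> powr (1 + 2 * s)) = (case p of (x, y) \<Rightarrow> (w x - w y)\<^sup>2 * kern s x y)"
        using ae2 by eventually_elim (simp add: split_beta')
    qed
    fix v assume v: "v \<in> test_functions a b"
    have [measurable]: "v \<in> borel_measurable borel" by (rule test_function_borel[OF v])
    have "(\<integral>(x, y). (u x - u y) * (v x - v y) / \<bar>x - y\<bar> powr (1 + 2 * s) \<partial>lebesgue)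
      = (\<integral>(x, y). (w x - w y) * (v x - v y) * kern s x y \<partial>?L)"
    proof (rule transfer(1))
      show "(\<lambda>(x, y). (w x - w y) * (v x - v y) * kern s x y) \<in> borel_measurable ?L" unfolding split_beta' by measurable
      show "AE p in ?L. (case p of (x, y) \<Rightarrow> (u x - u y) * (v x - v y) / \<bar>x - y\<bar> powr (1 + 2 * s)) = (case p of (x, y) \<Rightarrow> (w x - w y) * (v x - v y) * kern s x y)"
        using ae2 by eventually_elim (simp add: split_beta')
    qed
    then show "frac_const s / 2 * (\<integral>(x, y). (w x - w y) * (v x - v y) * kern s x y \<partial>?L) = (\<integral>x. f x * v x \<partial>lebesgue_on {a<..<b})"
      using weak[OF v] by (simp only: frac_form_def)
  qed
qed

lemma test_function_affine:
  assumes v: "v \<in> test_functions (-1) 1" and h: "0 < h"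
  shows "(\<lambda>x. v ((x - m) / h)) \<in> test_functions (m - h) (m + h)"
proof -
  let ?v = "\<lambda>x. v ((x - m) / h)"
  have diff: "(deriv ^^ n) v field_differentiable at x" for n x using v unfolding test_functions_def by blast
  have D: "((\<lambda>x. (1 / h) ^ n * (deriv ^^ n) v ((x - m) / h)) has_field_derivative (1 / h) ^ Suc n * (deriv ^^ Suc n) v ((x - m) / h)) (at x)" for n x
  proof -
    have "((deriv ^^ n) v has_field_derivative (deriv ^^ Suc n) v ((x - m) / h)) (at ((x - m) / h))"
      using DERIV_deriv_iff_field_differentiable[THEN iffD2, OF diff[of n "(x - m) / h"]] by simp
    moreover have "((\<lambda>x. (x - m) / h) has_field_derivative 1 / h) (at x)"
      using h by (auto intro!: derivative_eq_intros)
    ultimately have "((\<lambda>x. (deriv ^^ n) v ((x - m) / h)) has_field_derivative (deriv ^^ Suc n) v ((x - m) / h) * (1 / h)) (at x)"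
      by (rule DERIV_chain2)
    from DERIV_cmult[OF this, of "(1 / h) ^ n"] show ?thesis by (simp only: power_Suc mult_ac)
  qed
  have it: "(deriv ^^ n) ?v = (\<lambda>x. (1 / h) ^ n * (deriv ^^ n) v ((x - m) / h))" for n
  proof (induction n)
    case 0
    show ?case by simp
  next
    case (Suc n)
    have "(deriv ^^ Suc n) ?v = deriv (\<lambda>x. (1 / h) ^ n * (deriv ^^ n) v ((x - m) / h))"
      unfolding funpow.simps o_apply Suc.IH ..
    also have "\<dots> = (\<lambda>x. (1 / h) ^ Suc n * (deriv ^^ Suc n) v ((x - m) / h))" by (intro ext DERIV_imp_deriv D)
    finally show ?case .
  qed
  have smooth: "(deriv ^^ n) ?v field_differentiable at x" for n x
    unfolding it field_differentiable_def by (rule exI) (rule D)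
  define Z where "Z = closure {x. v x \<noteq> 0}"
  note v' = v[unfolded test_functions_def mem_Collect_eq]
  have Z: "compact Z" "Z \<subseteq> {-1<..<1}"
    unfolding Z_def by (rule v'[THEN conjunct2, THEN conjunct1], rule v'[THEN conjunct2, THEN conjunct2])
  define Y where "Y = (\<lambda>x. m + h * x) ` Z"
  have Y: "compact Y" unfolding Y_def by (intro compact_continuous_image continuous_intros Z)
  have YI: "Y \<subseteq> {m - h<..<m + h}"
  proof
    fix y assume "y \<in> Y"
    then obtain x where "y = m + h * x" "x \<in> Z" unfolding Y_def by blast
    moreover from this have "x \<in> {-1<..<1}" using Z(2) by blast
    ultimately have x: "y = m + h * x" "-1 < x" "x < 1" by simp_all
    have "h * -1 < h * x" "h * x < h * 1" by (rule mult_strict_left_mono[OF _ h], fact)+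
    then show "y \<in> {m - h<..<m + h}" unfolding x(1) by simp
  qed
  have sub: "{x. ?v x \<noteq> 0} \<subseteq> Y"
  proof
    fix x assume "x \<in> {x. ?v x \<noteq> 0}"
    then have "(x - m) / h \<in> {x. v x \<noteq> 0}" by simp
    then have "(x - m) / h \<in> Z" unfolding Z_def by (rule subsetD[OF closure_subset])
    moreover have "x = m + h * ((x - m) / h)" using h by simp
    ultimately show "x \<in> Y" unfolding Y_def by (intro image_eqI)
  qed
  then have cl: "closure {x. ?v x \<noteq> 0} \<subseteq> Y" using Y by (intro closure_minimal compact_imp_closed)
  have cc: "compact (closure {x. ?v x \<noteq> 0})"
    unfolding compact_closure by (rule bounded_subset[OF compact_imp_bounded[OF Y] sub])
  show ?thesis unfolding test_functions_def mem_Collect_eq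
    by (intro conjI allI smooth cc order_trans[OF cl YI])
qed

lemma integral_affine_plane:
  fixes F :: "real \<times> real \<Rightarrow> real"
  assumes F: "F \<in> borel_measurable plane" and h: "0 < h"
  shows "integral\<^sup>L plane F = h\<^sup>2 * (\<integral>(x, y). F (m + h * x, m + h * y) \<partial>plane)"
    and "integrable plane F \<Longrightarrow> integrable plane (\<lambda>(x, y). F (m + h * x, m + h * y))"
proof -
  have [measurable]: "F \<in> borel_measurable borel" using F by (simp add: lborel_prod)
  have Fe: "F ((m, m) + h *\<^sub>R p) = (case p of (x, y) \<Rightarrow> F (m + h * x, m + h * y))" for p :: "real \<times> real"
    by (cases p) simp
  have L: "(lborel :: (real \<times> real) measure) = density (distr lborel borel (\<lambda>p. (m, m) + h *\<^sub>R p)) (\<lambda>_. ennreal (h\<^sup>2))"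
    using lborel_affine[of h "(m, m) :: real \<times> real"] h by (simp add: power2_eq_square)
  show "integral\<^sup>L plane F = h\<^sup>2 * (\<integral>(x, y). F (m + h * x, m + h * y) \<partial>plane)"
    unfolding lborel_prod
    by (subst L) (simp add: integral_density integral_distr Fe)
  show "integrable plane (\<lambda>(x, y). F (m + h * x, m + h * y))" if "integrable plane F"
    using that h unfolding lborel_prod
    by (subst (asm) L) (simp add: integrable_density integrable_distr_eq Fe)
qed

lemma integral_affine_lebesgue:
  fixes g :: "real \<Rightarrow> real"
  assumes g [measurable]: "g \<in> borel_measurable lebesgue" and h: "0 < h"
  shows "(\<integral>x. g ((x - m) / h) \<partial>lebesgue) = h * integral\<^sup>L lebesgue g"
proof -
  have L: "lebesgue = density (distr lebesgue lebesgue (\<lambda>x. (- m / h) + (1 / h) * x)) (\<lambda>_. ennreal \<bar>1 / h\<bar>)"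
    using h by (intro lebesgue_real_affine) simp
  have [measurable]: "(\<lambda>x. (- m / h) + (1 / h) * x) \<in> lebesgue \<rightarrow>\<^sub>M lebesgue"
    using lebesgue_affine_measurable[of "\<lambda>_. 1 / h" "- m / h"] h by simp
  have "integral\<^sup>L lebesgue g = integral\<^sup>L (density (distr lebesgue lebesgue (\<lambda>x. (- m / h) + (1 / h) * x)) (\<lambda>_. ennreal \<bar>1 / h\<bar>)) g"
    using L by simp
  also have "\<dots> = (1 / h) * (\<integral>x. g ((- m / h) + (1 / h) * x) \<partial>lebesgue)"
  proof -
    have T: "(\<lambda>x. (- m / h) + (1 / h) * x) \<in> lebesgue \<rightarrow>\<^sub>M lebesgue" by fact
    have "integral\<^sup>L (density (distr lebesgue lebesgue (\<lambda>x. (- m / h) + (1 / h) * x)) (\<lambda>_. ennreal \<bar>1 / h\<bar>)) g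
       = (\<integral>x. \<bar>1 / h\<bar> *\<^sub>R g x \<partial>distr lebesgue lebesgue (\<lambda>x. (- m / h) + (1 / h) * x))"
      by (rule integral_density) auto
    also have "\<dots> = \<bar>1 / h\<bar> * integral\<^sup>L (distr lebesgue lebesgue (\<lambda>x. (- m / h) + (1 / h) * x)) g" by simp
    also have "\<dots> = (1 / h) * (\<integral>x. g ((- m / h) + (1 / h) * x) \<partial>lebesgue)"
      using h by (simp only: integral_distr[OF T g]) simp
    finally show ?thesis .
  qed
  also have "(\<lambda>x. g ((- m / h) + (1 / h) * x)) = (\<lambda>x. g ((x - m) / h))"
    by (simp add: diff_divide_distrib)
  finally show ?thesis using h by simp
qed

lemma frac_const_pos: "0 < s \<Longrightarrow> s < 1 \<Longrightarrow> 0 < frac_const s"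
  unfolding frac_const_def by (intro divide_pos_pos mult_pos_pos Gamma_real_pos) auto

text \<open>In the variable $\xi = (x-m)/h$ the bilinear form scales with $h^{1-2s}$ and the right-hand side
  with $h$.\<close>

lemma weak_form_rescale:
  assumes h: "0 < h" and s: "0 < s" and f: "(\<lambda>\<xi>. f (m + h * \<xi>)) \<in> borel_measurable (lebesgue_on {-1<..<1})"
    and w [measurable]: "w \<in> borel_measurable borel"
    and G: "integrable plane (\<lambda>(x, y). (w x - w y)\<^sup>2 * kern s x y)"
    and weak: "\<And>v. v \<in> test_functions (m - h) (m + h) \<Longrightarrow> K *
       (\<integral>(x, y). (w x - w y) * (v x - v y) * kern s x y \<partial>plane) = (\<integral>x. f x * v x \<partial>lebesgue_on {m - h<..<m + h})"
  defines "w' \<equiv> \<lambda>\<xi>. w (m + h * \<xi>)"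
  shows "integrable plane (\<lambda>(x, y). (w' x - w' y)\<^sup>2 * kern s x y)"
    and "\<And>v. v \<in> test_functions (-1) 1 \<Longrightarrow> K * h powr (-2 * s) *
       (\<integral>(x, y). (w' x - w' y) * (v x - v y) * kern s x y \<partial>plane) = (\<integral>x. f (m + h * x) * v x \<partial>lebesgue_on {-1<..<1})"
proof -
  let ?L = plane
  have kern: "kern s (m + h * x) (m + h * y) = h powr (-1 - 2 * s) * kern s x y" for x y
  proof -
    have "m + h * x - (m + h * y) = h * (x - y)" by (simp add: algebra_simps)
    then have "\<bar>m + h * x - (m + h * y)\<bar> = h * \<bar>x - y\<bar>" using h by (simp add: abs_mult)
    then have "kern s (m + h * x) (m + h * y) = 1 / (h powr (1 + 2 * s)) * kern s x y"
      by (simp only: powr_mult times_divide_times_eq mult_1)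
    moreover have "-1 - 2 * s = - (1 + 2 * s)" by simp
    ultimately show ?thesis by (simp only: powr_minus_divide)
  qed
  have "integrable ?L (\<lambda>(x, y). (\<lambda>(x, y). (w x - w y)\<^sup>2 * kern s x y) (m + h * x, m + h * y))"
    by (rule integral_affine_plane(2)[OF _ h G]) (unfold split_beta', measurable)
  then have scaled: "integrable ?L (\<lambda>p. h powr (-1 - 2 * s) * (case p of (x, y) \<Rightarrow> (w' x - w' y)\<^sup>2 * kern s x y))"
    unfolding w'_def prod.case kern by (simp only: split_beta' mult.left_commute)
  then show "integrable ?L (\<lambda>(x, y). (w' x - w' y)\<^sup>2 * kern s x y)"
  proof -
    have one: "h powr (1 + 2 * s) * h powr (-1 - 2 * s) = 1" using h powr_add[of h "1 + 2 * s" "-1 - 2 * s"] by simp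
    show ?thesis
      using integrable_mult_right[OF scaled, of "h powr (1 + 2 * s)"] unfolding mult.assoc[symmetric] one mult_1 .
  qed
  fix v assume v: "v \<in> test_functions (-1) 1"
  define V where "V x = v ((x - m) / h)" for x
  have Vt: "V \<in> test_functions (m - h) (m + h)" unfolding V_def by (rule test_function_affine[OF v h])
  have [measurable]: "V \<in> borel_measurable borel" by (rule test_function_borel[OF Vt])
  have vm: "v \<in> borel_measurable borel" by (rule test_function_borel[OF v])
  have VT: "V (m + h * x) = v x" for x using h by (simp add: V_def)
  define I where "I = (\<integral>(x, y). (w' x - w' y) * (v x - v y) * kern s x y \<partial>?L)"
  define R where "R = (\<integral>x. f (m + h * x) * v x \<partial>lebesgue_on {-1<..<1})"
  have "(\<integral>(x, y). (w x - w y) * (V x - V y) * kern s x y \<partial>?L)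
    = h\<^sup>2 * (\<integral>(x, y). (\<lambda>(x, y). (w x - w y) * (V x - V y) * kern s x y) (m + h * x, m + h * y) \<partial>?L)"
    by (rule integral_affine_plane(1)[OF _ h]) (unfold split_beta', measurable)
  also have "(\<integral>(x, y). (\<lambda>(x, y). (w x - w y) * (V x - V y) * kern s x y) (m + h * x, m + h * y) \<partial>?L)
    = (\<integral>p. h powr (-1 - 2 * s) * (case p of (x, y) \<Rightarrow> (w' x - w' y) * (v x - v y) * kern s x y) \<partial>?L)"
    unfolding w'_def prod.case kern VT by (simp only: split_beta' mult.left_commute)
  also have "\<dots> = h powr (-1 - 2 * s) * I" unfolding I_def by (rule integral_mult_right_zero)
  finally have lhs: "(\<integral>(x, y). (w x - w y) * (V x - V y) * kern s x y \<partial>?L) = h\<^sup>2 * (h powr (-1 - 2 * s) * I)" .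
  have rhs: "(\<integral>x. f x * V x \<partial>lebesgue_on {m - h<..<m + h}) = h * R"
  proof -
    define g where "g x = indicator {-1<..<1} x * (f (m + h * x) * v x)" for x
    have "(\<lambda>x. f (m + h * x) * v x) \<in> borel_measurable (lebesgue_on {-1<..<1})"
      using vm by (intro borel_measurable_times f measurable_restrict_space1 measurable_completion) simp
    then have gm: "g \<in> borel_measurable lebesgue"
      unfolding g_def by (subst (asm) borel_measurable_restrict_space_iff) (simp_all add: mult.commute)
    have "(\<integral>x. f x * V x \<partial>lebesgue_on {m - h<..<m + h}) = (\<integral>x. indicator {m - h<..<m + h} x *\<^sub>R (f x * V x) \<partial>lebesgue)"
      by (rule integral_restrict_space) simp
    also have "\<dots> = (\<integral>x. g ((x - m) / h) \<partial>lebesgue)"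
    proof (rule Bochner_Integration.integral_cong[OF refl])
      fix x
      have "m + h * ((x - m) / h) = x" using h by simp
      moreover have "(x - m) / h \<in> {-1<..<1} \<longleftrightarrow> x \<in> {m - h<..<m + h}" using h by (auto simp: field_simps)
      ultimately show "indicator {m - h<..<m + h} x *\<^sub>R (f x * V x) = g ((x - m) / h)"
        by (simp add: g_def V_def indicator_def)
    qed
    also have "\<dots> = h * integral\<^sup>L lebesgue g" by (rule integral_affine_lebesgue[OF gm h])
    also have "integral\<^sup>L lebesgue g = R"
      unfolding R_def g_def by (subst integral_restrict_space) simp_all
    finally show ?thesis .
  qed
  have "K * (h\<^sup>2 * (h powr (-1 - 2 * s) * I)) = h * R" using weak[OF Vt] unfolding lhs rhs .
  moreover have "h\<^sup>2 * (h powr (-1 - 2 * s) * I) = h * (h powr (-2 * s) * I)"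
  proof -
    have "h * h powr (-1 - 2 * s) = h powr (-2 * s)" using h powr_add[of h 1 "-1 - 2 * s"] by simp
    then show ?thesis by (simp only: power2_eq_square mult.assoc) (simp only: mult.assoc[symmetric])
  qed
  ultimately have "h * (K * (h powr (-2 * s) * I)) = h * R" by (simp only: mult.left_commute)
  then show "K * h powr (-2 * s) * I = R" using h by (simp add: mult.assoc)
qed

section \<open>Regularity in the weighted Sobolev scale\<close>

lemma gegenbauer_borel [measurable]: "gegenbauer \<alpha> n \<in> borel_measurable borel"
  unfolding gegenbauer_eq_sum[abs_def] by measurable

lemma quotient_in_weighted_L2:
  assumes s: "0 < s" and w [measurable]: "w \<in> borel_measurable borel"
    and H: "integrable lborel (\<lambda>x. (w x)\<^sup>2 * bweight (2 * s) x)"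
  shows "(\<lambda>x. C * (w x / (1 - x\<^sup>2) powr s)) \<in> weighted_L2 s (-1) 1"
proof -
  let ?M = "lebesgue_on {-1<..<1::real}"
  have bm: "g \<in> borel_measurable ?M" if "g \<in> borel_measurable borel" for g :: "real \<Rightarrow> real"
    using that by (intro measurable_restrict_space1 measurable_completion) simp
  have m1: "(\<lambda>x. C * (w x / (1 - x\<^sup>2) powr s)) \<in> borel_measurable ?M" by (rule bm) measurable
  have m2: "(\<lambda>x. (C * (w x / (1 - x\<^sup>2) powr s))\<^sup>2 * (1 - x\<^sup>2) powr s) \<in> borel_measurable ?M" by (rule bm) measurable
  have I: "integrable ?M (\<lambda>x. C\<^sup>2 * ((w x)\<^sup>2 * bweight (2 * s) x))"
    by (intro integrable_mult_right integrable_restrict_space[THEN iffD2] integrable_mult_indicator)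
      (use H in \<open>simp_all add: integrable_completion integrable_mult_indicator\<close>)
  have "integrable ?M (\<lambda>x. (C * (w x / (1 - x\<^sup>2) powr s))\<^sup>2 * (1 - x\<^sup>2) powr s)"
  proof (rule Bochner_Integration.integrable_bound[OF I m2])
    show "AE x in ?M. norm ((C * (w x / (1 - x\<^sup>2) powr s))\<^sup>2 * (1 - x\<^sup>2) powr s) \<le> norm (C\<^sup>2 * ((w x)\<^sup>2 * bweight (2 * s) x))"
    proof (intro AE_I2)
      fix x assume "x \<in> space ?M"
      then have x: "\<bar>x\<bar> < 1" by (simp add: abs_less_iff)
      define p where "p = (1 - x\<^sup>2) powr s"
      have "0 < 1 - x\<^sup>2" using x by (simp add: abs_square_less_1)
      then have p: "0 < p" "p \<le> 1" using s unfolding p_def by (simp, intro powr_le1) auto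
      have b: "bweight (2 * s) x = 1 / p\<^sup>2"
      proof -
        have "(1 - x\<^sup>2) powr (2 * s) = p\<^sup>2" unfolding p_def power2_eq_square powr_add[symmetric] by (simp only: mult_2)
        then show ?thesis using x by (simp only: bweight_def powr_minus_divide if_True)
      qed
      have "(C * (w x / p))\<^sup>2 * p \<le> (C * (w x / p))\<^sup>2 * 1" using p by (intro mult_left_mono) auto
      also have "\<dots> = C\<^sup>2 * ((w x)\<^sup>2 * (1 / p\<^sup>2))" by (simp add: power_mult_distrib power_divide)
      finally show "norm ((C * (w x / (1 - x\<^sup>2) powr s))\<^sup>2 * (1 - x\<^sup>2) powr s) \<le> norm (C\<^sup>2 * ((w x)\<^sup>2 * bweight (2 * s) x))"
        unfolding p_def[symmetric] b using p by simp
    qed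
  qed
  then show ?thesis using m1 by (simp add: weighted_L2_def omega_unit)
qed

lemma gegenbauer_coeff_quotient:
  assumes w [measurable]: "w \<in> borel_measurable borel" and out: "\<And>x. 1 \<le> \<bar>x\<bar> \<Longrightarrow> w x = 0"
  shows "gegenbauer_coeff s (\<lambda>x. C * (w x / (1 - x\<^sup>2) powr s)) j =
    C * (\<integral>x. w x * gegenbauer (s + 1/2) j x \<partial>lborel) /
      sqrt (\<integral>y. (gegenbauer (s + 1/2) j y)\<^sup>2 * (1 - y\<^sup>2) powr s \<partial>lebesgue_on {-1<..<1})"
proof -
  let ?M = "lebesgue_on {-1<..<1::real}" and ?g = "gegenbauer (s + 1/2) j"
  define N where "N = sqrt (\<integral>y. (?g y)\<^sup>2 * (1 - y\<^sup>2) powr s \<partial>?M)"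
  have "gegenbauer_coeff s (\<lambda>x. C * (w x / (1 - x\<^sup>2) powr s)) j = (\<integral>x. (C / N) * (w x * ?g x) \<partial>?M)"
    unfolding gegenbauer_coeff_def gegenbauer_normalized_def N_def[symmetric]
  proof (rule Bochner_Integration.integral_cong[OF refl])
    fix x assume "x \<in> space ?M"
    then have "\<bar>x\<bar> < 1" by (simp add: abs_less_iff)
    then have "0 < 1 - x\<^sup>2" by (simp add: abs_square_less_1)
    then have "0 < (1 - x\<^sup>2) powr s" by simp
    then show "C * (w x / (1 - x\<^sup>2) powr s) * (?g x / N) * (1 - x\<^sup>2) powr s = (C / N) * (w x * ?g x)" by simp
  qed
  also have "\<dots> = (C / N) * (\<integral>x. w x * ?g x \<partial>?M)" by (rule integral_mult_right_zero)
  also have "(\<integral>x. w x * ?g x \<partial>?M) = (\<integral>x. indicator {-1<..<1} x *\<^sub>R (w x * ?g x) \<partial>lebesgue)"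
    by (rule integral_restrict_space) simp
  also have "\<dots> = (\<integral>x. w x * ?g x \<partial>lebesgue)"
  proof (rule Bochner_Integration.integral_cong[OF refl])
    fix x
    show "indicator {-1<..<1} x *\<^sub>R (w x * ?g x) = w x * ?g x"
    proof (cases "1 \<le> \<bar>x\<bar>")
      case True then show ?thesis by (simp add: out)
    next
      case False then have "x \<in> {-1<..<1}" by (simp add: abs_less_iff not_le) then show ?thesis by simp
    qed
  qed
  also have "\<dots> = (\<integral>x. w x * ?g x \<partial>lborel)" by (rule integral_completion) measurable
  finally show ?thesis unfolding N_def by simp
qed

lemma weighted_sobolev_unit_gain:
  assumes s: "0 < s" "s < 1" and \<kappa>: "0 < \<kappa>"
    and \<phi>: "\<phi> \<in> weighted_L2 s (-1) 1" and f: "f \<in> weighted_sobolev_unit r s"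
    and rel: "\<And>j. gegenbauer_coeff s f j = \<kappa> * eigen_factor s j * gegenbauer_coeff s \<phi> j"
  shows "\<phi> \<in> weighted_sobolev_unit (r + 2 * s) s"
proof -
  let ?b = "\<lambda>j::nat. 1 + (real j)\<^sup>2"
  define C where "C = (4 powr s / \<kappa>)\<^sup>2"
  have sm: "summable (\<lambda>j. ?b j powr r * \<bar>gegenbauer_coeff s f j\<bar>\<^sup>2)"
    using f by (simp add: weighted_sobolev_unit_def)
  have "summable (\<lambda>j. ?b j powr (r + 2 * s) * \<bar>gegenbauer_coeff s \<phi> j\<bar>\<^sup>2)"
  proof (rule summable_comparison_test'[OF summable_mult[OF sm, of C]])
    fix j
    define B e y where "B = ?b j powr s" and "e = eigen_factor s j" and "y = gegenbauer_coeff s \<phi> j"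
    have e: "0 < e" unfolding e_def by (rule eigen_factor_pos[OF s(1)])
    have B: "0 \<le> B" "B \<le> 4 powr s * e" unfolding B_def e_def using eigen_factor_lower_bound[OF s] by auto
    have "?b j powr (r + 2 * s) = ?b j powr r * B\<^sup>2"
      unfolding B_def power2_eq_square by (simp only: powr_add mult_2)
    then have "?b j powr (r + 2 * s) * \<bar>y\<bar>\<^sup>2 = ?b j powr r * (B * \<bar>y\<bar>)\<^sup>2" by (simp add: power_mult_distrib)
    also have "\<dots> \<le> ?b j powr r * (4 powr s * e * \<bar>y\<bar>)\<^sup>2"
      using B by (intro mult_left_mono power_mono mult_right_mono) auto
    also have "4 powr s * e * \<bar>y\<bar> = (4 powr s / \<kappa>) * \<bar>gegenbauer_coeff s f j\<bar>"
      unfolding rel e_def[symmetric] y_def[symmetric] using \<kappa> e by (simp add: abs_mult)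
    also have "?b j powr r * ((4 powr s / \<kappa>) * \<bar>gegenbauer_coeff s f j\<bar>)\<^sup>2
       = C * (?b j powr r * \<bar>gegenbauer_coeff s f j\<bar>\<^sup>2)"
      unfolding power_mult_distrib C_def by (simp only: mult_ac)
    finally show "norm (?b j powr (r + 2 * s) * \<bar>gegenbauer_coeff s \<phi> j\<bar>\<^sup>2) \<le> C * (?b j powr r * \<bar>gegenbauer_coeff s f j\<bar>\<^sup>2)"
      unfolding y_def by simp
  qed
  then show ?thesis using \<phi> by (simp add: weighted_sobolev_unit_def)
qed

theorem corollary4p13:
  fixes s a b r :: real and f u :: "real \<Rightarrow> real"
  assumes "0 < s" "s < 1"
    and "a < b"
    and "0 \<le> r"
    and "f \<in> weighted_sobolev r s a b"
    and "weak_solution s a b f u"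
  shows "\<exists>\<phi> \<in> weighted_sobolev (r + 2 * s) s a b.
           AE x in lebesgue. x \<in> {a<..<b} \<longrightarrow> u x = omega a b x powr s * \<phi> x"
proof -
  note s = assms(1,2)
  define m h where "m = (a + b) / 2" and "h = (b - a) / 2"
  have h: "0 < h" and ab: "a = m - h" "b = m + h" using assms(3) by (auto simp: m_def h_def field_simps)
  have T: "a + (b - a) * (\<xi> + 1) / 2 = m + h * \<xi>" for \<xi>
    unfolding ab by (simp add: field_simps)
  define F where "F \<xi> = f (m + h * \<xi>)" for \<xi>
  have F: "F \<in> weighted_sobolev_unit r s" using assms(5) unfolding weighted_sobolev_def T F_def by simp
  then have FL: "F \<in> weighted_L2 s (-1) 1" by (simp add: weighted_sobolev_unit_def)
  obtain w where w [measurable]: "w \<in> borel_measurable borel" and w0: "\<And>x. x \<notin> {a<..<b} \<Longrightarrow> w x = 0"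
    and uw: "AE x in lebesgue. u x = w x"
    and G: "integrable plane (\<lambda>(x, y). (w x - w y)\<^sup>2 * kern s x y)"
    and weak: "\<And>v. v \<in> test_functions a b \<Longrightarrow> frac_const s / 2 *
       (\<integral>(x, y). (w x - w y) * (v x - v y) * kern s x y \<partial>plane) = (\<integral>x. f x * v x \<partial>lebesgue_on {a<..<b})"
    by (rule weak_solution_borel_representative[OF assms(6)]) (rule that)
  define W where "W \<xi> = w (m + h * \<xi>)" for \<xi>
  have W [measurable]: "W \<in> borel_measurable borel" unfolding W_def by measurable
  have Wout: "W \<xi> = 0" if "1 \<le> \<bar>\<xi>\<bar>" for \<xi>
  proof -
    have "h * 1 \<le> h * \<bar>\<xi>\<bar>" using that h by (intro mult_left_mono) auto
    then have "h \<le> h * \<xi> \<or> h * \<xi> \<le> - h" by (cases "0 \<le> \<xi>") simp_all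
    then have "m + h * \<xi> \<notin> {a<..<b}" unfolding ab by auto
    then show ?thesis unfolding W_def by (rule w0)
  qed
  have Fm: "(\<lambda>\<xi>. f (m + h * \<xi>)) \<in> borel_measurable (lebesgue_on {-1<..<1})"
    using FL unfolding F_def weighted_L2_def by simp
  note scaled = weak_form_rescale[OF h s(1) Fm w G weak[unfolded ab], folded W_def F_def]
  have H: "integrable lborel (\<lambda>x. (W x)\<^sup>2 * bweight (2 * s) x)"
    by (rule Hardy_weight[OF s(1) W Wout scaled(1)])
  note coeffs = coefficient_relation[OF s W Wout scaled(1) FL scaled(2)]
  define C where "C = h powr (-2 * s)"
  define \<phi> where "\<phi> x = w x / omega a b x powr s" for x
  define \<Phi> where "\<Phi> \<xi> = C * (W \<xi> / (1 - \<xi>\<^sup>2) powr s)" for \<xi>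
  have \<phi>T: "\<phi> (m + h * \<xi>) = \<Phi> \<xi>" for \<xi>
  proof (cases "\<bar>\<xi>\<bar> < 1")
    case True
    have "omega a b (m + h * \<xi>) = h\<^sup>2 * (1 - \<xi>\<^sup>2)"
      unfolding omega_def ab by (simp add: power2_eq_square algebra_simps)
    then have "omega a b (m + h * \<xi>) powr s = h powr (2 * s) * (1 - \<xi>\<^sup>2) powr s"
      using h powr_of_square[of h s] by (simp only: powr_mult)
    then show ?thesis unfolding \<phi>_def \<Phi>_def W_def C_def using powr_minus_divide[of h "2 * s"] by simp
  next
    case False
    then have "W \<xi> = 0" by (intro Wout) simp
    then show ?thesis by (simp add: \<phi>_def \<Phi>_def W_def)
  qed
  have \<Phi>L: "\<Phi> \<in> weighted_L2 s (-1) 1"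
    unfolding \<Phi>_def[abs_def] by (rule quotient_in_weighted_L2[OF s(1) W H])
  define \<kappa> where "\<kappa> = frac_const s * beta_full s"
  have \<kappa>: "0 < \<kappa>" unfolding \<kappa>_def using frac_const_pos[OF s] beta_full_pos[OF s] by simp
  \<comment> \<open>the norm of the Gegenbauer polynomial divides both sides, so its value is irrelevant\<close>
  have rel: "gegenbauer_coeff s F j = \<kappa> * eigen_factor s j * gegenbauer_coeff s \<Phi> j" for j
  proof -
    let ?g = "gegenbauer (s + 1/2) j"
    define N where "N = sqrt (\<integral>y. (?g y)\<^sup>2 * (1 - y\<^sup>2) powr s \<partial>lebesgue_on {-1<..<1})"
    define I where "I = (\<integral>x. W x * ?g x \<partial>lborel)"
    have "gegenbauer_coeff s F j = (\<integral>x. (1 / N) * (F x * ?g x * (1 - x\<^sup>2) powr s) \<partial>lebesgue_on {-1<..<1})"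
      unfolding gegenbauer_coeff_def gegenbauer_normalized_def N_def[symmetric]
      by (intro Bochner_Integration.integral_cong refl) simp
    also have "\<dots> = (1 / N) * (\<integral>x. F x * ?g x * (1 - x\<^sup>2) powr s \<partial>lebesgue_on {-1<..<1})"
      by (rule integral_mult_right_zero)
    also have "(\<integral>x. F x * ?g x * (1 - x\<^sup>2) powr s \<partial>lebesgue_on {-1<..<1})
       = 2 * (frac_const s / 2 * C) * beta_full s * eigen_factor s j * I"
      unfolding C_def I_def by (rule coeffs)
    finally have "gegenbauer_coeff s F j = \<kappa> * eigen_factor s j * (C * I / N)" unfolding \<kappa>_def by simp
    moreover have "gegenbauer_coeff s \<Phi> j = C * I / N"
      unfolding \<Phi>_def[abs_def] I_def N_def by (rule gegenbauer_coeff_quotient[OF W Wout])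
    ultimately show ?thesis by simp
  qed
  have "\<Phi> \<in> weighted_sobolev_unit (r + 2 * s) s"
    by (rule weighted_sobolev_unit_gain[OF s \<kappa> \<Phi>L F rel])
  then have "\<phi> \<in> weighted_sobolev (r + 2 * s) s a b"
    unfolding weighted_sobolev_def mem_Collect_eq T \<phi>T .
  moreover have "AE x in lebesgue. x \<in> {a<..<b} \<longrightarrow> u x = omega a b x powr s * \<phi> x"
    using uw
  proof eventually_elim
    case (elim x)
    show ?case
    proof
      assume "x \<in> {a<..<b}"
      then have "0 < omega a b x" by (simp add: omega_def)
      then show "u x = omega a b x powr s * \<phi> x" using elim by (simp add: \<phi>_def)
    qed
  qed
  ultimately show ?thesis by blast
qed

end
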